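(* Let $\mathbb X=\mathbb T^d=\mathbb R^d/\mathbb Z^d$ with $d\ge2$, let $s>d/2$, and let $K$ be a continuous symmetric positive definite kernel on $\mathbb T^d$ with $H_K(\mathbb T^d)=H^s(\mathbb T^d)$ with equivalent norms. Then for every $\mu\in\mathcal P(\mathbb T^d)$ absolutely continuous with positive density $\rho\in H^s(\mathbb T^d)$ there is a constant $c>0$, depending on $d$, $K$ and $\rho$, such that for all $L\ge1$ $$\min_{\nu\in\mathcal P^{\mathrm{Acurve}}_L(\mathbb T^d)}\mathscr D_K(\mu,\nu)\le\min_{\nu\in\mathcal P^{\mathrm{Lcurve}}_L(\mathbb T^d)}\mathscr D_K(\mu,\nu)\le c\,L^{-\frac{s}{d-1}}.$$
   Context: $\mathbb T^d$ carries the flat metric and normalized Lebesgue measure. $H^s(\mathbb T^d)=\{f\in L^2:\sum_{k\in\mathbb Z^d}(1+4\pi^2|k|^2)^s|\hat f_k|^2<\infty\}$. $H_K$: reproducing kernel Hilbert space of $K$; $\mathscr D_K(\mu,\nu)=\sup_{\|\varphi\|_{H_K}\le1}|\int\varphi\,d(\mu-\nu)|$. $\mathrm{Lip}(\mathbb T^d)$: Lipschitz $\gamma\colon[0,1]\to\mathbb T^d$ with $\gamma(0)=\gamma(1)$, $L(\gamma)$ optimal Lipschitz constant; $\lambda$ Lebesgue measure on $[0,1]$; $\gamma_*$ pushforward. $\mathcal P^{\mathrm{Acurve}}_L=\{\gamma_*(\rho'\lambda):\gamma\in\mathrm{Lip},L(\gamma)\le L,\rho'\ge0,\int_0^1\rho'=1,L(\rho')\le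 L\}$; $\mathcal P^{\mathrm{Lcurve}}_L=\{\gamma_*\lambda:\gamma\in\mathrm{Lip},L(\gamma)\le L\}$. *)

theory Defs
  imports "HOL-Analysis.Analysis"
begin

text \<open>The torus T^d = R^d / Z^d.  Points are represented by vectors in real^'d,
  functions on T^d by Z^d-periodic functions on real^'d, and measures on T^d by
  measures on real^'d concentrated on the fundamental domain [0,1)^d (the image of
  torus_proj).\<close>

definition int_vecs :: "(real^'d) set" where
  "int_vecs = {k. \<forall>i. k $ i \<in> \<int>}"

definition torus_periodic :: "(real^'d \<Rightarrow> 'b) \<Rightarrow> bool" where
  "torus_periodic f \<longleftrightarrow> (\<forall>x. \<forall>k\<in>int_vecs. f (x + k) = f x)"

definition torus_proj :: "real^'d \<Rightarrow> real^'d" where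
  "torus_proj x = (\<chi> i. frac (x $ i))"

definition torus_dist :: "real^'d \<Rightarrow> real^'d \<Rightarrow> real" where
  "torus_dist x y = Inf {norm (x - y - k) | k. k \<in> int_vecs}"

definition unit_cube :: "(real^'d) set" where
  "unit_cube = cbox 0 One"

definition torus_lebesgue :: "(real^'d) measure" where
  "torus_lebesgue = lebesgue_on unit_cube"

definition fourier_coeff :: "(real^'d \<Rightarrow> real) \<Rightarrow> (int^'d) \<Rightarrow> complex" where
  "fourier_coeff f k = integral\<^sup>L torus_lebesgue
     (\<lambda>x. complex_of_real (f x) * cis (- 2 * pi * (\<Sum>i\<in>UNIV. real_of_int (k $ i) * x $ i)))"

definition sobolev_weight :: "real \<Rightarrow> (int^'d) \<Rightarrow> real" where
  "sobolev_weight s k = (1 + 4 * pi\<^sup>2 * (\<Sum>i\<in>UNIV. (real_of_int (k $ i))\<^sup>2)) powr s"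

definition in_Hs :: "real \<Rightarrow> (real^'d \<Rightarrow> real) \<Rightarrow> bool" where
  "in_Hs s f \<longleftrightarrow> f \<in> borel_measurable torus_lebesgue
     \<and> integrable torus_lebesgue (\<lambda>x. (f x)\<^sup>2)
     \<and> (\<lambda>k. sobolev_weight s k * (cmod (fourier_coeff f k))\<^sup>2) summable_on UNIV"

definition Hs_norm :: "real \<Rightarrow> (real^'d \<Rightarrow> real) \<Rightarrow> real" where
  "Hs_norm s f = sqrt (\<Sum>\<^sub>\<infinity>k. sobolev_weight s k * (cmod (fourier_coeff f k))\<^sup>2)"

definition psd_kernel :: "('a \<Rightarrow> 'a \<Rightarrow> real) \<Rightarrow> bool" where
  "psd_kernel K \<longleftrightarrow> (\<forall>x y. K x y = K y x) \<and>
     (\<forall>n (a :: nat \<Rightarrow> real) (x :: nat \<Rightarrow> 'a).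
        0 \<le> (\<Sum>i<n. \<Sum>j<n. a i * a j * K (x i) (x j)))"

definition torus_kernel :: "(real^'d \<Rightarrow> real^'d \<Rightarrow> real) \<Rightarrow> bool" where
  "torus_kernel K \<longleftrightarrow> psd_kernel K \<and> continuous_on UNIV (\<lambda>(x, y). K x y)
     \<and> (\<forall>y. torus_periodic (\<lambda>x. K x y))"

text \<open>RKHS norm of f in H_K (Aronszajn):
  sup of |sum a_i f(x_i)| over all finite combinations with
  norm (sum a_i K(x_i,.)) \<le> 1, i.e. sum a_i a_j K(x_i,x_j) \<le> 1;
  f belongs to H_K iff this supremum is finite.\<close>
definition rkhs_vals :: "('a \<Rightarrow> 'a \<Rightarrow> real) \<Rightarrow> ('a \<Rightarrow> real) \<Rightarrow> real set" where
  "rkhs_vals K f = {\<bar>\<Sum>i<n. a i * f (x i)\<bar> | n (a :: nat \<Rightarrow> real) (x :: nat \<Rightarrow> 'a).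
      (\<Sum>i<n. \<Sum>j<n. a i * a j * K (x i) (x j)) \<le> 1}"

definition in_rkhs :: "('a \<Rightarrow> 'a \<Rightarrow> real) \<Rightarrow> ('a \<Rightarrow> real) \<Rightarrow> bool" where
  "in_rkhs K f \<longleftrightarrow> bdd_above (rkhs_vals K f)"

definition rkhs_norm :: "('a \<Rightarrow> 'a \<Rightarrow> real) \<Rightarrow> ('a \<Rightarrow> real) \<Rightarrow> real" where
  "rkhs_norm K f = Sup (rkhs_vals K f)"

definition discrepancy :: "(real^'d \<Rightarrow> real^'d \<Rightarrow> real) \<Rightarrow> (real^'d) measure \<Rightarrow> (real^'d) measure \<Rightarrow> real" where
  "discrepancy K \<mu> \<nu> = Sup {\<bar>integral\<^sup>L \<mu> \<phi> - integral\<^sup>L \<nu> \<phi>\<bar> | \<phi>.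
      in_rkhs K \<phi> \<and> rkhs_norm K \<phi> \<le> 1}"

definition torus_lip_curve :: "real \<Rightarrow> (real \<Rightarrow> real^'d) \<Rightarrow> bool" where
  "torus_lip_curve L \<gamma> \<longleftrightarrow> torus_proj (\<gamma> 0) = torus_proj (\<gamma> 1)
     \<and> (\<forall>s\<in>{0..1}. \<forall>t\<in>{0..1}. torus_dist (\<gamma> s) (\<gamma> t) \<le> L * \<bar>s - t\<bar>)"

definition Lcurve_measures :: "real \<Rightarrow> ((real^'d) measure) set" where
  "Lcurve_measures L = {distr (lebesgue_on {0..1}) borel (torus_proj \<circ> \<gamma>) | \<gamma>.
      torus_lip_curve L \<gamma>}"

definition Acurve_measures :: "real \<Rightarrow> ((real^'d) measure) set" where
  "Acurve_measures L = {distr (density (lebesgue_on {0..1}) (\<lambda>t. ennreal (w t))) borel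
        (torus_proj \<circ> \<gamma>) | \<gamma> w.
      torus_lip_curve L \<gamma> \<and> (\<forall>t\<in>{0..1}. 0 \<le> w t)
      \<and> integral\<^sup>L (lebesgue_on {0..1}) w = 1 \<and> L-lipschitz_on {0..1} w}"

end

theory Submission
  imports Defs "HOL-Complex_Analysis.Great_Picard"
begin

text \<open>
  The closed geodesic \<open>t \<mapsto> t (1, N, ..., N\<^sup>d\<^sup>-\<^sup>1)\<close> has length of order \<open>N\<^sup>d\<^sup>-\<^sup>1\<close>.  Integrating a character
  along it gives \<open>0\<close> unless the frequency \<open>k\<close> is resonant, that is \<open>\<Sum>\<^sub>i k\<^sub>i N\<^sup>i = 0\<close>; by uniqueness of base-\<open>N\<close>
  digits a nonzero resonant frequency has sup norm at least \<open>N\<close>, and so do differences of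
  resonant frequencies.  Hence the sum of \<open>|k|\<^sup>-\<^sup>2\<^sup>s\<close> over nonzero resonant \<open>k\<close> is of order \<open>N\<^sup>-\<^sup>2\<^sup>s\<close>, because
  \<open>2 s > d\<close>.  For \<open>\<phi>\<close> in the unit ball the quadrature error of \<open>\<phi> \<rho>\<close> along the geodesic is the sum of
  \<open>\<phi>\<^sub>j \<rho>\<^sub>l\<close> (Fourier coefficients) over the pairs with \<open>j + l\<close> nonzero resonant; one of \<open>j\<close>, \<open>l\<close> is then at least half as large as
  \<open>j + l\<close>, and Cauchy-Schwarz bounds the error by a multiple of \<open>N\<^sup>-\<^sup>s\<close> without using that \<open>H\<^sup>s\<close> is an algebra.
  Running along the geodesic at speed inversely proportional to \<open>\<rho>\<close> realises the normalised weight \<open>\<rho>\<close>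
  by an unweighted curve.  Minimisers exist because the integral of each \<open>\<phi>\<close> is continuous along
  uniformly convergent curves and weights (Arzela-Ascoli), so the discrepancy is lower
  semicontinuous as a supremum.
\<close>

section \<open>Lattice sums over resonant frequencies\<close>

text \<open>The rate comes from one trade: a geodesic with Lipschitz constant of order N^(d-1) has
  error of order N^(-s), so N of order L^(1/(d-1)) yields L^(-s/(d-1)). The Fourier expansion has to
  hold at every point: a curve is a null set, so identities almost everywhere say nothing about
  integrals along it. Since 2s > d makes the coefficients summable, the quadrature error becomes an
  exact sum over pairs of frequencies. The mean of the density along the geodesic need not be 1, so
  the reparametrised curve computes a quotient; its denominator is corrected by applying the same
  estimate to the product of 1 and the density. When L is too small for the geodesic family, a
  trivial bound on the discrepancy is absorbed by c. A second obstacle is that a curve is Lipschitz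
  only modulo Z^d: as a map into R^d it may jump by lattice vectors and need not even be measurable.
  Topological arguments therefore pass through the embedding of the torus into C^d by the points
  cis(2 pi x_i), whose image is compact: limits of curves, measurability of the projected curve,
  density of trigonometric polynomials.\<close>

definition supn :: "int^'d \<Rightarrow> real" where
  "supn k = Max (range (\<lambda>i. \<bar>real_of_int (k $ i)\<bar>))"

lemma supn_ge: "\<bar>real_of_int (k $ i)\<bar> \<le> supn k"
  unfolding supn_def by (rule Max_ge) auto

lemma supn_attained: "\<exists>i. supn k = \<bar>real_of_int (k $ i)\<bar>"
proof -
  have "supn k \<in> range (\<lambda>i. \<bar>real_of_int (k $ i)\<bar>)"
    unfolding supn_def by (rule Max_in) auto
  then show ?thesis by auto
qed

lemma supn_leI: "(\<And>i. \<bar>real_of_int (k $ i)\<bar> \<le> b) \<Longrightarrow> supn k \<le> b"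
  by (metis supn_attained)

lemma supn_nonneg: "0 \<le> supn k"
  by (meson abs_ge_zero order_trans supn_ge)

lemma supn_add: "supn (j + l) \<le> supn j + supn l"
proof (rule supn_leI)
  fix i
  have "\<bar>real_of_int ((j + l) $ i)\<bar> \<le> \<bar>real_of_int (j $ i)\<bar> + \<bar>real_of_int (l $ i)\<bar>"
    by simp
  also have "\<dots> \<le> supn j + supn l"
    by (intro add_mono supn_ge)
  finally show "\<bar>real_of_int ((j + l) $ i)\<bar> \<le> supn j + supn l" .
qed

lemma sobolev_weight_pos: "0 < sobolev_weight s k"
  unfolding sobolev_weight_def
  by (metis add_pos_nonneg mult_nonneg_nonneg powr_gt_zero sum_nonneg zero_le_power2 zero_less_one
      less_numeral_extra(3) zero_le_numeral)

lemma sobolev_weight_ge: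
  assumes "0 \<le> s"
  shows "(1 + supn k) powr (2 * s) \<le> sobolev_weight s k"
proof -
  obtain i where i: "supn k = \<bar>real_of_int (k $ i)\<bar>"
    using supn_attained by blast
  define r where "r = \<bar>k $ i\<bar>"
  have r: "supn k = real_of_int r" "r \<ge> 0"
    by (simp_all add: i r_def)
  \<comment> \<open>Integrality of r is what absorbs the cross term 2r of the square into
    3r^2.\<close>
  have rr: "real_of_int r \<le> (real_of_int r)\<^sup>2"
  proof -
    have "r \<le> r\<^sup>2"
      using r(2) by (cases "r = 0") (auto simp: power2_eq_square mult_le_cancel_left1)
    then show ?thesis
      by (metis of_int_le_iff of_int_power)
  qed
  have pi1: "1 \<le> pi\<^sup>2"
    using pi_ge_two by (intro one_le_power) simp
  have "(1 + real_of_int r)\<^sup>2 \<le> 1 + 3 * (real_of_int r)\<^sup>2"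
    using rr by (simp add: power2_eq_square algebra_simps)
  also have "\<dots> \<le> 1 + 4 * pi\<^sup>2 * (real_of_int r)\<^sup>2"
    using mult_right_mono[of 3 "4 * pi\<^sup>2" "(real_of_int r)\<^sup>2"] pi1 by simp
  also have "(real_of_int r)\<^sup>2 \<le> (\<Sum>i\<in>UNIV. (real_of_int (k $ i))\<^sup>2)"
  proof -
    have "(real_of_int r)\<^sup>2 = (real_of_int (k $ i))\<^sup>2"
      by (simp add: r_def)
    also have "\<dots> \<le> (\<Sum>i\<in>UNIV. (real_of_int (k $ i))\<^sup>2)"
      by (rule member_le_sum) auto
    finally show ?thesis .
  qed
  finally have le: "(1 + real_of_int r)\<^sup>2 \<le> 1 + 4 * pi\<^sup>2 * (\<Sum>i\<in>UNIV. (real_of_int (k $ i))\<^sup>2)"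
    by (simp add: mult_left_mono)
  have "(1 + supn k) powr (2 * s) = ((1 + real_of_int r)\<^sup>2) powr s"
    using r by (simp add: powr_powr[symmetric] powr_numeral)
  also have "\<dots> \<le> sobolev_weight s k"
    unfolding sobolev_weight_def using assms le by (intro powr_mono2) auto
  finally show ?thesis .
qed

lemma summable_on_int_powr:
  assumes "1 < p"
  shows "(\<lambda>n::int. (1 + \<bar>real_of_int n\<bar>) powr - p) summable_on UNIV"
proof -
  have sm: "summable (\<lambda>n::nat. (1 + real n) powr - p)"
    using assms summable_real_powr_iff[of "-p"] 
      summable_Suc_iff[of "\<lambda>n::nat. real n powr - p"]
    by (simp add: add.commute)
  then have sm': "(\<lambda>n::nat. (1 + real n) powr - p) summable_on UNIV"
    by (subst summable_on_UNIV_nonneg_real_iff) auto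
  have "(\<lambda>n::int. (1 + \<bar>real_of_int n\<bar>) powr - p) summable_on range int"
    by (subst summable_on_reindex) (use sm' in \<open>auto simp: o_def\<close>)
  moreover have "(\<lambda>n::int. (1 + \<bar>real_of_int n\<bar>) powr - p) summable_on range (\<lambda>n. - int n)"
    by (subst summable_on_reindex) (use sm' in \<open>auto simp: o_def inj_on_def\<close>)
  ultimately have "(\<lambda>n::int. (1 + \<bar>real_of_int n\<bar>) powr - p) summable_on
      (range int \<union> range (\<lambda>n. - int n))"
    by (rule summable_on_union)
  also have "range int \<union> range (\<lambda>n. - int n) = UNIV"
    by (auto simp: image_iff) (metis int_cases2)
  finally show ?thesis .
qed

text \<open>The sup norm dominates every coordinate, so splitting the exponent 2s evenly into d
  parts \<open>p\<close> bounds each term by a product of one-dimensional terms;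
  \<open>p > 1\<close> is exactly 2s > d. A finite set lies in the box of its projections, over
  which the sum factorises.\<close>

lemma summable_on_supn_powr:
  fixes s :: real
  assumes "real CARD('d::finite) < 2 * s"
  shows "(\<lambda>k::int^'d. (1 + supn k) powr - (2 * s)) summable_on UNIV"
proof -
  define d where "d = real CARD('d)"
  have d: "d > 0" by (simp add: d_def)
  define p where "p = 2 * s / d"
  have p: "p > 1"
    using assms d by (simp add: p_def d_def[symmetric])
  define g where "g = (\<lambda>n::int. (1 + \<bar>real_of_int n\<bar>) powr - p)"
  have g: "g summable_on UNIV" and g0: "\<And>n. g n \<ge> 0"
    using summable_on_int_powr[OF p] by (simp_all add: g_def)
  have le: "(1 + supn k) powr - (2 * s) \<le> (\<Prod>i\<in>UNIV. g (k $ i))" for k :: "int^'d"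
  proof -
    have "(1 + supn k) powr - (2 * s) = (\<Prod>i\<in>(UNIV::'d set). (1 + supn k) powr - p)"
      using supn_nonneg[of k] d by (simp add: p_def d_def powr_power)
    also have "\<dots> \<le> (\<Prod>i\<in>UNIV. g (k $ i))"
      unfolding g_def using p supn_nonneg[of k]
      by (intro prod_mono conjI powr_mono2') (auto simp: supn_ge add_pos_nonneg)
    finally show ?thesis .
  qed
  show ?thesis
  proof (rule nonneg_bdd_above_summable_on)
    show "bdd_above (sum (\<lambda>k::int^'d. (1 + supn k) powr - (2 * s)) ` {F. F \<subseteq> UNIV \<and> finite F})"
    proof (rule bdd_aboveI2)
      fix F :: "(int^'d) set"
      assume "F \<in> {F. F \<subseteq> UNIV \<and> finite F}"
      then have F: "finite F" by simp
      define B where "B = (\<lambda>i::'d. (\<lambda>k. k $ i) ` F)"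
      have B: "finite (B i)" for i
        using F by (simp add: B_def)
      have "(\<Sum>k\<in>F. (1 + supn k) powr - (2 * s)) \<le> (\<Sum>k\<in>F. \<Prod>i\<in>UNIV. g (k $ i))"
        by (intro sum_mono le)
      also have "\<dots> = (\<Sum>h\<in>vec_nth ` F. \<Prod>i\<in>UNIV. g (h i))"
        by (subst sum.reindex) (auto simp: inj_on_def vec_nth_inject)
      also have "\<dots> \<le> (\<Sum>h\<in>PiE UNIV B. \<Prod>i\<in>UNIV. g (h i))"
        using B g0 by (intro sum_mono2 finite_PiE prod_nonneg) (auto simp: B_def)
      also have "\<dots> = (\<Prod>i\<in>UNIV. \<Sum>n\<in>B i. g n)"
        using B by (simp add: prod_sum_PiE)
      also have "\<dots> \<le> (\<Prod>i\<in>(UNIV::'d set). infsum g UNIV)"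
        using B g g0 by (intro prod_mono conjI sum_nonneg finite_sum_le_infsum) auto
      finally show "(\<Sum>k\<in>F. (1 + supn k) powr - (2 * s)) \<le> (\<Prod>i\<in>(UNIV::'d set). infsum g UNIV)" .
    qed
  qed auto
qed

text \<open>An Epstein zeta function for the sup norm, shifted by 1 so that the origin can be
  included. The \<open>itself\<close> argument records the dimension, which the real value cannot
  reveal.\<close>

definition lattice_zeta :: "'d::finite itself \<Rightarrow> real \<Rightarrow> real" where
  "lattice_zeta _ s = (\<Sum>\<^sub>\<infinity>q::int^'d. (1 + supn q) powr - (2 * s))"

lemma lattice_zeta_nonneg: "0 \<le> lattice_zeta TYPE('d::finite) s"
  unfolding lattice_zeta_def by (intro infsum_nonneg) simp

lemma sum_supn_powr_le_lattice_zeta: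
  assumes "real CARD('d::finite) < 2 * s" "finite S"
  shows "(\<Sum>k\<in>S. (1 + supn (k::int^'d)) powr - (2 * s)) \<le> lattice_zeta TYPE('d) s"
  unfolding lattice_zeta_def
  using assms summable_on_supn_powr[OF assms(1)] by (intro finite_sum_le_infsum) auto

text \<open>Packing: cut Z^d into cubes of side N. Separation leaves at most one point of S in each
  cube, so the sum is compared with a sum over the cube labels \<open>q k\<close>. The hypothesis
  \<open>large\<close> takes care of the cubes around the origin, whose labels give no lower bound
  on the norm of the point.\<close>

lemma sum_separated_supn_powr_le:
  fixes S :: "(int^'d) set" and N :: int
  assumes s: "real CARD('d) < 2 * s" and N: "N \<ge> 1" and fin: "finite S"
    and large: "\<And>k. k \<in> S \<Longrightarrow> real_of_int N \<le> supn k"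
    and sep: "\<And>k k'. k \<in> S \<Longrightarrow> k' \<in> S \<Longrightarrow> k \<noteq> k' \<Longrightarrow> \<exists>i. N \<le> \<bar>k $ i - k' $ i\<bar>"
  shows "(\<Sum>k\<in>S. supn k powr - (2 * s))
    \<le> (3 / N) powr (2 * s) * lattice_zeta TYPE('d) s"
proof -
  define q where "q = (\<lambda>k::int^'d. (\<chi> i. k $ i div N) :: int^'d)"
  have s0: "s > 0" using s by (smt (verit) of_nat_0_le_iff)
  have inj: "inj_on q S"
  proof (rule inj_onI, rule ccontr)
    fix k k' assume k: "k \<in> S" "k' \<in> S" "q k = q k'" "k \<noteq> k'"
    obtain i where i: "N \<le> \<bar>k $ i - k' $ i\<bar>" using sep k by blast
    have "k $ i div N = k' $ i div N"
      using k(3) by (simp add: q_def vec_eq_iff)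
    then have "k $ i - k' $ i = k $ i mod N - k' $ i mod N"
      by (metis add_diff_cancel_left mult_div_mod_eq)
    moreover have "0 \<le> k $ i mod N" "k $ i mod N < N" "0 \<le> k' $ i mod N" "k' $ i mod N < N"
      using N by simp_all
    ultimately show False using i by linarith
  qed
  have le: "supn k powr - (2 * s) \<le> (3 / N) powr (2 * s) * (1 + supn (q k)) powr - (2 * s)"
    if k: "k \<in> S" for k
  proof -
    obtain i where i: "supn (q k) = \<bar>real_of_int (q k $ i)\<bar>"
      using supn_attained by blast
    define a where "a = q k $ i"
    have a: "supn (q k) = real_of_int \<bar>a\<bar>" by (simp add: i a_def)
    have "k $ i = N * a + k $ i mod N"
      by (simp add: a_def q_def)
    moreover have "0 \<le> k $ i mod N" "k $ i mod N < N"
      using N by simp_all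
    moreover have "N * \<bar>a\<bar> = \<bar>N * a\<bar>" using N by (simp add: abs_mult)
    ultimately have "N * \<bar>a\<bar> - N \<le> \<bar>k $ i\<bar>"
      by linarith
    then have "real_of_int (N * \<bar>a\<bar> - N) \<le> real_of_int \<bar>k $ i\<bar>"
      by (simp only: of_int_le_iff)
    also have "\<dots> \<le> supn k"
      using supn_ge[of k i] by simp
    finally have 1: "real_of_int N * supn (q k) - real_of_int N \<le> supn k"
      by (simp add: a)
    \<comment> \<open>Source of the 3: N + N|q| is at most |k| + 2N by the previous inequality, and
      N is at most |k| by \<open>large\<close>.\<close>
    have "real_of_int N * (1 + supn (q k)) \<le> 3 * supn k"
      using 1 large[OF k] by (simp add: algebra_simps)
    then have "real_of_int N / 3 * (1 + supn (q k)) \<le> supn k"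
      by simp
    moreover have "0 < real_of_int N / 3 * (1 + supn (q k))"
      using N supn_nonneg[of "q k"] by (intro mult_pos_pos) auto
    ultimately have "supn k powr - (2 * s) \<le> (real_of_int N / 3 * (1 + supn (q k))) powr - (2 * s)"
      using s0 by (intro powr_mono2') auto
    also have "\<dots> = (3 / N) powr (2 * s) * (1 + supn (q k)) powr - (2 * s)"
      using N supn_nonneg[of "q k"]
      by (subst powr_mult) (simp_all add: powr_minus powr_divide)
    finally show ?thesis .
  qed
  have "(\<Sum>k\<in>S. supn k powr - (2 * s))
      \<le> (\<Sum>k\<in>S. (3 / N) powr (2 * s) * (1 + supn (q k)) powr - (2 * s))"
    by (intro sum_mono le)
  also have "\<dots> = (3 / N) powr (2 * s) * (\<Sum>k\<in>q ` S. (1 + supn k) powr - (2 * s))"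
    by (simp add: sum.reindex[OF inj] sum_distrib_left)
  also have "\<dots> \<le> (3 / N) powr (2 * s) * lattice_zeta TYPE('d) s"
    using fin by (intro mult_left_mono sum_supn_powr_le_lattice_zeta[OF s]) auto
  finally show ?thesis .
qed

text \<open>Signed digits: modulo N only the lowest digit survives, and a multiple of N of modulus
  below N is 0. Dividing by N leaves the same situation with one digit less.\<close>

lemma sum_digits_eq_0:
  fixes a :: "nat \<Rightarrow> int" and N :: int
  assumes "(\<Sum>n<d. a n * N ^ n) = 0" "\<And>n. n < d \<Longrightarrow> \<bar>a n\<bar> < N"
  shows "\<forall>n<d. a n = 0"
  using assms
proof (induction d arbitrary: a)
  case (Suc d)
  have N: "N > 0" using Suc.prems(2)[of 0] by simp
  have eq: "a 0 + N * (\<Sum>n<d. a (Suc n) * N ^ n) = 0"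
    using Suc.prems(1)
    by (simp add: sum.lessThan_Suc_shift sum_distrib_left mult.left_commute del: sum.lessThan_Suc)
  then have "N dvd a 0"
    by (metis dvd_triv_left dvd_0_right dvd_add_left_iff)
  then have a0: "a 0 = 0"
    using Suc.prems(2)[of 0] by (metis abs_ge_zero dvd_imp_le_int linorder_not_le zero_less_Suc
        abs_of_nonneg abs_of_pos N)
  have "(\<Sum>n<d. a (Suc n) * N ^ n) = 0"
    using eq a0 N by simp
  then have "\<forall>n<d. a (Suc n) = 0"
    using Suc.IH[of "\<lambda>n. a (Suc n)"] Suc.prems(2) by simp
  then show ?case using a0 by (metis less_Suc_eq_0_disj)
qed simp

text \<open>An arbitrary enumeration of the coordinates: the exponents 0, ..., d-1 have to be
  distributed over an index type that carries no order.\<close>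

definition coord_index :: "'d::finite \<Rightarrow> nat" where
  "coord_index = (SOME f. bij_betw f UNIV {..<CARD('d)})"

lemma bij_betw_coord_index: "bij_betw (coord_index :: 'd::finite \<Rightarrow> nat) UNIV {..<CARD('d)}"
proof -
  have "\<exists>f. bij_betw f (UNIV::'d set) {..<CARD('d)}"
    by (metis ex_bij_betw_finite_nat finite atLeast0LessThan)
  then show ?thesis
    unfolding coord_index_def by (rule someI_ex)
qed

definition power_vec :: "int \<Rightarrow> int^'d" where
  "power_vec N = (\<chi> i. N ^ coord_index i)"

definition int_dot :: "int^'d \<Rightarrow> int^'d \<Rightarrow> int" where
  "int_dot k v = (\<Sum>i\<in>UNIV. k $ i * v $ i)"

lemma int_dot_diff: "int_dot (k - k') v = int_dot k v - int_dot k' v"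
  by (simp add: int_dot_def algebra_simps sum_subtractf)

lemma resonant_large:
  fixes k :: "int^'d"
  assumes "int_dot k (power_vec N) = 0" "k \<noteq> 0"
  shows "\<exists>i. N \<le> \<bar>k $ i\<bar>"
proof (rule ccontr)
  assume "\<not> ?thesis"
  then have less: "\<bar>k $ i\<bar> < N" for i
    by (simp add: not_le)
  \<comment> \<open>Digits are indexed by exponents and frequencies by coordinates;
    \<open>?c\<close> leads from the exponent back to the coordinate.\<close>
  let ?c = "inv_into UNIV (coord_index :: 'd \<Rightarrow> nat)"
  note bij = bij_betw_coord_index[where 'd='d]
  have "(\<Sum>n<CARD('d). k $ ?c n * N ^ n) = (\<Sum>i\<in>(UNIV::'d set). k $ ?c (coord_index i) * N ^ coord_index i)"
    using sum.reindex_bij_betw[OF bij, of "\<lambda>n. k $ ?c n * N ^ n"] by simp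
  also have "\<dots> = 0"
    using assms(1) bij by (simp add: int_dot_def power_vec_def bij_betw_def)
  finally have "\<forall>n<CARD('d). k $ ?c n = 0"
    by (rule sum_digits_eq_0) (rule less)
  then have "k $ ?c (coord_index i) = 0" for i :: 'd
    using bij_betwE[OF bij] by blast
  moreover have "?c (coord_index i) = i" for i :: 'd
    using bij_betw_inv_into_left[OF bij] by simp
  ultimately have "k $ i = 0" for i
    by metis
  then show False
    using assms(2) by (simp add: vec_eq_iff)
qed

text \<open>Nonzero frequencies to which the closed geodesic with direction \<^term>\<open>power_vec N\<close> is blind.\<close>

definition resonant :: "int \<Rightarrow> (int^'d) set" where
  "resonant N = {k. k \<noteq> 0 \<and> int_dot k (power_vec N) = 0}"

text \<open>Resonance is a linear condition, so the difference of two distinct resonant frequencies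
  is again resonant. Hence \<open>resonant_large\<close> supplies both the size and the separation
  that the packing argument asks for.\<close>

lemma sum_resonant_le:
  fixes S :: "(int^'d) set"
  assumes "real CARD('d) < 2 * s" "N \<ge> 1" "finite S" "S \<subseteq> resonant N"
  shows "(\<Sum>k\<in>S. supn k powr - (2 * s)) \<le> (3 / N) powr (2 * s) * lattice_zeta TYPE('d) s"
proof (rule sum_separated_supn_powr_le[OF assms(1-3)])
  fix k assume "k \<in> S"
  then have "k \<noteq> 0" "int_dot k (power_vec N) = 0"
    using assms(4) by (auto simp: resonant_def)
  then obtain i where "N \<le> \<bar>k $ i\<bar>"
    using resonant_large by blast
  then have "real_of_int N \<le> \<bar>real_of_int (k $ i)\<bar>"
    by linarith
  then show "real_of_int N \<le> supn k"
    using supn_ge[of k i] by linarith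
next
  fix k k' assume "k \<in> S" "k' \<in> S" "k \<noteq> k'"
  then have "int_dot (k - k') (power_vec N) = 0" "k - k' \<noteq> 0"
    using subsetD[OF assms(4), of k] subsetD[OF assms(4), of k'] by (simp_all add: resonant_def int_dot_diff)
  then show "\<exists>i. N \<le> \<bar>k $ i - k' $ i\<bar>"
    using resonant_large[of "k - k'" N] by simp
qed

section \<open>Weighted Cauchy-Schwarz and sums over resonant pairs of frequencies\<close>

lemma sum_weighted_Cauchy_Schwarz:
  assumes "\<And>i. i \<in> F \<Longrightarrow> 0 < w i"
    and "(\<Sum>i\<in>F. w i * (a i)\<^sup>2) \<le> A\<^sup>2" "(\<Sum>i\<in>F. 1 / w i) \<le> B\<^sup>2" "0 \<le> A" "0 \<le> B"
  shows "(\<Sum>i\<in>F. a i) \<le> A * (B :: real)"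
proof -
  have "(\<Sum>i\<in>F. a i)\<^sup>2 = (\<Sum>i\<in>F. (sqrt (w i) * a i) * (1 / sqrt (w i)))\<^sup>2"
    using assms(1) by (intro arg_cong[of _ _ "\<lambda>x. x\<^sup>2"] sum.cong) (auto simp: less_imp_neq[THEN not_sym])
  also have "\<dots> \<le> (\<Sum>i\<in>F. (sqrt (w i) * a i)\<^sup>2) * (\<Sum>i\<in>F. (1 / sqrt (w i))\<^sup>2)"
    by (rule Cauchy_Schwarz_ineq_sum)
  also have "(\<Sum>i\<in>F. (sqrt (w i) * a i)\<^sup>2) = (\<Sum>i\<in>F. w i * (a i)\<^sup>2)"
    using assms(1) by (intro sum.cong) (auto simp: power_mult_distrib less_imp_le)
  also have "(\<Sum>i\<in>F. (1 / sqrt (w i))\<^sup>2) = (\<Sum>i\<in>F. 1 / w i)"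
    using assms(1) by (intro sum.cong) (auto simp: power_divide less_imp_le)
  also have "(\<Sum>i\<in>F. w i * (a i)\<^sup>2) * (\<Sum>i\<in>F. 1 / w i) \<le> A\<^sup>2 * B\<^sup>2"
    using assms by (intro mult_mono sum_nonneg) (auto simp: less_imp_le)
  finally have "(\<Sum>i\<in>F. a i)\<^sup>2 \<le> (A * B)\<^sup>2"
    by (simp add: power_mult_distrib)
  then show ?thesis
    using assms(4,5) by (metis mult_nonneg_nonneg power2_le_imp_le)
qed

text \<open>Phrased through finite partial sums, so that the estimates work with finite sums only
  and carry no summability side conditions.\<close>

definition Hs_bounded :: "real \<Rightarrow> real \<Rightarrow> (int^'d \<Rightarrow> complex) \<Rightarrow> bool" where
  "Hs_bounded s A a \<longleftrightarrow> 0 \<le> A \<and>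
     (\<forall>F. finite F \<longrightarrow> (\<Sum>k\<in>F. sobolev_weight s k * (cmod (a k))\<^sup>2) \<le> A\<^sup>2)"

lemma inverse_sobolev_weight_le:
  assumes "0 \<le> s"
  shows "1 / sobolev_weight s k \<le> (1 + supn k) powr - (2 * s)"
proof -
  have "0 < (1 + supn k) powr (2 * s)"
    using supn_nonneg[of k] by simp
  then show ?thesis
    unfolding powr_minus inverse_eq_divide
    using sobolev_weight_ge[OF assms, of k] by (intro divide_left_mono mult_pos_pos sobolev_weight_pos) auto
qed

text \<open>The Sobolev embedding in its elementary form: for 2s > d the inverse weights are
  summable, and Cauchy-Schwarz turns the weighted square bound into an absolute one.\<close>

lemma Hs_bounded_sum_le:
  fixes a :: "int^'d \<Rightarrow> complex"
  assumes "real CARD('d) < 2 * s" "Hs_bounded s A a" "finite F"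
  shows "(\<Sum>k\<in>F. cmod (a k)) \<le> A * sqrt (lattice_zeta TYPE('d) s)"
proof (rule sum_weighted_Cauchy_Schwarz[where w = "sobolev_weight s"])
  have "0 \<le> s"
    using assms(1) by (smt (verit) of_nat_0_le_iff)
  then have "(\<Sum>k\<in>F. 1 / sobolev_weight s k) \<le> (\<Sum>k\<in>F. (1 + supn k) powr - (2 * s))"
    by (intro sum_mono inverse_sobolev_weight_le)
  also have "\<dots> \<le> lattice_zeta TYPE('d) s"
    by (rule sum_supn_powr_le_lattice_zeta[OF assms(1,3)])
  finally show "(\<Sum>k\<in>F. 1 / sobolev_weight s k) \<le> (sqrt (lattice_zeta TYPE('d) s))\<^sup>2"
    by (simp add: lattice_zeta_nonneg)
  show "(\<Sum>k\<in>F. sobolev_weight s k * (cmod (a k))\<^sup>2) \<le> A\<^sup>2" "0 \<le> A"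
    using assms(2,3) unfolding Hs_bounded_def by blast+
  show "0 \<le> sqrt (lattice_zeta TYPE('d) s)"
    by (simp add: lattice_zeta_nonneg)
qed (rule sobolev_weight_pos)

text \<open>For fixed l, the index j runs through a translate of resonant frequencies, and j is at
  least half as large as j + l; so the inverse weights of j are controlled by a resonant sum,
  uniformly in l. The other factor enters only through its absolute sum.\<close>

lemma sum_resonant_pairs_half:
  fixes a b :: "int^'d \<Rightarrow> complex"
  assumes s: "real CARD('d) < 2 * s" and N: "N \<ge> 1" and a: "Hs_bounded s A a"
    and b: "\<And>F. finite F \<Longrightarrow> (\<Sum>k\<in>F. cmod (b k)) \<le> B"
    and fin: "finite T"
    and T: "\<And>j l. (j, l) \<in> T \<Longrightarrow> j + l \<in> resonant N \<and> supn (j + l) \<le> 2 * supn j"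
  shows "(\<Sum>(j, l)\<in>T. cmod (a j) * cmod (b l))
    \<le> A * B * ((6 / N) powr s * sqrt (lattice_zeta TYPE('d) s))"
proof -
  let ?Z = "lattice_zeta TYPE('d) s"
  let ?D = "(6 / N) powr s * sqrt ?Z"
  have s0: "0 \<le> s"
    using s by (smt (verit) of_nat_0_le_iff)
  have A: "0 \<le> A"
    using a by (simp add: Hs_bounded_def)
  have D: "0 \<le> ?D"
    by (simp add: lattice_zeta_nonneg)
  have "(6 / N) powr (2 * s) = ((6 / N) powr s)\<^sup>2"
    by (simp add: power2_eq_square flip: powr_add)
  then have sqD: "(6 / N) powr (2 * s) * ?Z = ?D\<^sup>2"
    using lattice_zeta_nonneg[of s, where 'd='d] by (simp add: power_mult_distrib)
  have inner: "(\<Sum>j\<in>{j. (j, l) \<in> T}. cmod (a j)) \<le> A * ?D" for l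
  proof -
    define J where "J = {j. (j, l) \<in> T}"
    have "J \<subseteq> fst ` T"
      by (force simp: J_def)
    then have finJ: "finite J"
      using fin finite_subset by blast
    have inj: "inj_on (\<lambda>j. j + l) J"
      by (simp add: inj_on_def)
    have weight_le: "1 / sobolev_weight s j \<le> 2 powr (2 * s) * supn (j + l) powr - (2 * s)"
      if "j \<in> J" for j
    proof -
      have res: "j + l \<in> resonant N" and le: "supn (j + l) \<le> 2 * supn j"
        using that T by (auto simp: J_def)
      obtain i where "N \<le> \<bar>(j + l) $ i\<bar>"
        using res resonant_large[of "j + l" N] by (auto simp: resonant_def)
      then have pos: "0 < supn (j + l)"
        using supn_ge[of "j + l" i] N by linarith
      have "1 / sobolev_weight s j \<le> (1 + supn j) powr - (2 * s)"
        by (rule inverse_sobolev_weight_le[OF s0])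
      also have "\<dots> \<le> (supn (j + l) / 2) powr - (2 * s)"
        using pos le s0 by (intro powr_mono2') auto
      also have "\<dots> = 2 powr (2 * s) * supn (j + l) powr - (2 * s)"
        using pos by (subst powr_divide) (simp_all add: powr_minus field_simps)
      finally show ?thesis .
    qed
    have "(\<Sum>j\<in>J. 1 / sobolev_weight s j) \<le> (\<Sum>j\<in>J. 2 powr (2 * s) * supn (j + l) powr - (2 * s))"
      by (intro sum_mono weight_le)
    also have "\<dots> = 2 powr (2 * s) * (\<Sum>k\<in>(\<lambda>j. j + l) ` J. supn k powr - (2 * s))"
      by (simp add: sum.reindex[OF inj] sum_distrib_left)
    also have "\<dots> \<le> 2 powr (2 * s) * ((3 / N) powr (2 * s) * ?Z)"
      using finJ T by (intro mult_left_mono sum_resonant_le[OF s N]) (auto simp: J_def)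
    \<comment> \<open>6 is 2 times 3: the 2 stems from \<open>supn (j + l) \<le> 2 * supn j\<close>,
      the 3 from \<open>sum_resonant_le\<close>.\<close>
    also have "\<dots> = (6 / N) powr (2 * s) * ?Z"
      using N by (simp add: powr_mult[symmetric])
    finally have "(\<Sum>j\<in>J. 1 / sobolev_weight s j) \<le> ?D\<^sup>2"
      by (simp only: sqD)
    then have "(\<Sum>j\<in>J. cmod (a j)) \<le> A * ?D"
      using a finJ D
      by (intro sum_weighted_Cauchy_Schwarz[where w = "sobolev_weight s"])
        (simp_all add: Hs_bounded_def sobolev_weight_pos)
    then show ?thesis
      by (simp add: J_def)
  qed
  \<comment> \<open>Swapping the components lets T be written as a union of fibres over l, to each
    of which \<open>inner\<close> applies.\<close>
  have "(\<Sum>(j, l)\<in>T. cmod (a j) * cmod (b l)) = (\<Sum>(l, j)\<in>prod.swap ` T. cmod (a j) * cmod (b l))"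
    by (subst sum.reindex) (auto simp: case_prod_unfold inj_on_def)
  also have "prod.swap ` T = Sigma (snd ` T) (\<lambda>l. {j. (j, l) \<in> T})"
    by (auto simp: image_iff prod.swap_def) (metis snd_conv | metis fst_conv snd_conv)+
  also have "(\<Sum>(l, j)\<in>\<dots>. cmod (a j) * cmod (b l))
      = (\<Sum>l\<in>snd ` T. \<Sum>j\<in>{j. (j, l) \<in> T}. cmod (a j) * cmod (b l))"
  proof (rule sum.Sigma[symmetric])
    have "{j. (j, l) \<in> T} \<subseteq> fst ` T" for l
      by force
    then show "\<forall>l\<in>snd ` T. finite {j. (j, l) \<in> T}"
      using fin finite_subset by blast
  qed (use fin in auto)
  also have "\<dots> \<le> (\<Sum>l\<in>snd ` T. (A * ?D) * cmod (b l))"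
    by (subst sum_distrib_right[symmetric]) (intro sum_mono mult_right_mono inner norm_ge_zero)
  also have "\<dots> = A * ?D * (\<Sum>l\<in>snd ` T. cmod (b l))"
    by (simp add: sum_distrib_left)
  also have "\<dots> \<le> A * ?D * B"
    using fin A D by (intro mult_left_mono b mult_nonneg_nonneg) (auto simp: lattice_zeta_nonneg)
  finally show ?thesis
    by (simp add: mult_ac)
qed

lemma sum_resonant_pairs:
  fixes a b :: "int^'d \<Rightarrow> complex"
  assumes s: "real CARD('d) < 2 * s" and N: "N \<ge> 1"
    and a: "Hs_bounded s A a" and b: "Hs_bounded s B b"
    and fin: "finite T" and T: "T \<subseteq> {(j, l). j + l \<in> resonant N}"
  shows "(\<Sum>(j, l)\<in>T. cmod (a j) * cmod (b l))
    \<le> 2 * A * B * lattice_zeta TYPE('d) s * (6 / N) powr s"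
proof -
  let ?Z = "lattice_zeta TYPE('d) s"
  define T1 where "T1 = T \<inter> {(j, l). supn (j + l) \<le> 2 * supn j}"
  define T2 where "T2 = T - T1"
  have 1: "(\<Sum>(j, l)\<in>T1. cmod (a j) * cmod (b l)) \<le> A * (B * sqrt ?Z) * ((6 / N) powr s * sqrt ?Z)"
    using fin T by (intro sum_resonant_pairs_half[OF s N a] Hs_bounded_sum_le[OF s b]) (auto simp: T1_def)
  have "(\<Sum>(j, l)\<in>T2. cmod (a j) * cmod (b l)) = (\<Sum>(l, j)\<in>prod.swap ` T2. cmod (b l) * cmod (a j))"
    by (subst sum.reindex) (auto simp: case_prod_unfold inj_on_def mult.commute)
  also have "\<dots> \<le> B * (A * sqrt ?Z) * ((6 / N) powr s * sqrt ?Z)"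
  proof (intro sum_resonant_pairs_half[OF s N b] Hs_bounded_sum_le[OF s a])
    fix l j assume "(l, j) \<in> prod.swap ` T2"
    then have jl: "(j, l) \<in> T" "\<not> supn (j + l) \<le> 2 * supn j"
      by (auto simp: T1_def T2_def)
    \<comment> \<open>If |j + l| > 2|j|, then |l| \<ge> |j + l| - |j| exceeds half of |j + l|, so
      the roles of j and l are exchanged.\<close>
    then show "l + j \<in> resonant N \<and> supn (l + j) \<le> 2 * supn l"
      using T supn_add[of j l] by (auto simp: add.commute)
  qed (use fin in \<open>auto simp: T2_def\<close>)
  finally have 2: "(\<Sum>(j, l)\<in>T2. cmod (a j) * cmod (b l))
      \<le> B * (A * sqrt ?Z) * ((6 / N) powr s * sqrt ?Z)" .
  have "(\<Sum>(j, l)\<in>T. cmod (a j) * cmod (b l))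
      = (\<Sum>(j, l)\<in>T1. cmod (a j) * cmod (b l)) + (\<Sum>(j, l)\<in>T2. cmod (a j) * cmod (b l))"
    unfolding T2_def using fin by (subst sum.subset_diff[of T1 T]) (auto simp: T1_def add.commute)
  also have "\<dots> \<le> A * (B * sqrt ?Z) * ((6 / N) powr s * sqrt ?Z)
      + B * (A * sqrt ?Z) * ((6 / N) powr s * sqrt ?Z)"
    by (rule add_mono[OF 1 2])
  also have "\<dots> = 2 * A * B * (sqrt ?Z * sqrt ?Z) * (6 / N) powr s"
    by (simp only: mult_ac mult_2 distrib_left distrib_right)
  also have "sqrt ?Z * sqrt ?Z = ?Z"
    by (simp add: lattice_zeta_nonneg)
  finally show ?thesis .
qed

section \<open>The torus as a quotient\<close>

lemma int_vecs_add: "k \<in> int_vecs \<Longrightarrow> l \<in> int_vecs \<Longrightarrow> k + l \<in> int_vecs"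
  by (simp add: int_vecs_def)

lemma int_vecs_minus: "k \<in> int_vecs \<Longrightarrow> - k \<in> int_vecs"
  by (simp add: int_vecs_def)

lemma int_vecs_0: "0 \<in> int_vecs"
  by (simp add: int_vecs_def)

lemma torus_periodic_diff:
  assumes "torus_periodic f" "k \<in> int_vecs"
  shows "f (x - k) = f x"
  using assms int_vecs_minus[of k] by (metis diff_conv_add_uminus torus_periodic_def)

lemma torus_proj_eq: "\<exists>k\<in>int_vecs. torus_proj x = x - k"
  by (rule bexI[of _ "\<chi> i. of_int \<lfloor>x $ i\<rfloor>"])
    (auto simp: torus_proj_def vec_eq_iff frac_def int_vecs_def)

lemma mem_unit_cube: "x \<in> unit_cube \<longleftrightarrow> (\<forall>i. 0 \<le> x $ i \<and> x $ i \<le> 1)"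
proof -
  have "x \<in> unit_cube \<longleftrightarrow> (\<forall>b\<in>Basis. 0 \<le> x \<bullet> b \<and> x \<bullet> b \<le> 1)"
    by (simp add: unit_cube_def mem_box)
  then show ?thesis
    by (auto simp: Basis_vec_def inner_axis)
qed

lemma torus_proj_in_cube: "torus_proj x \<in> unit_cube"
  by (auto simp: mem_unit_cube torus_proj_def less_imp_le frac_lt_1)

lemma torus_periodic_proj: "torus_periodic f \<Longrightarrow> f (torus_proj x) = f x"
  by (metis torus_proj_eq torus_periodic_diff)

lemma compact_unit_cube: "compact unit_cube"
  by (simp add: unit_cube_def)

text \<open>Realises the torus as a product of unit circles, a compact subset of a normed space.
  Points known only modulo Z^d thereby become accessible to limits, Arzela-Ascoli and
  Stone-Weierstrass.\<close>

definition torus_embed :: "real^'d \<Rightarrow> complex^'d" where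
  "torus_embed x = (\<chi> i. cis (2 * pi * x $ i))"

lemma torus_periodic_embed: "torus_periodic torus_embed"
  unfolding torus_periodic_def
proof (intro allI ballI)
  fix x k :: "real^'d"
  assume k: "k \<in> int_vecs"
  have "cis (2 * pi * (x $ i + k $ i)) = cis (2 * pi * x $ i)" for i
  proof -
    obtain n where "k $ i = of_int n"
      using k by (auto simp: int_vecs_def elim: Ints_cases)
    then show ?thesis
      by (simp add: distrib_left flip: cis_mult)
  qed
  then show "torus_embed (x + k) = torus_embed x"
    by (simp add: torus_embed_def vec_eq_iff)
qed

lemma continuous_on_torus_embed: "continuous_on S torus_embed"
  unfolding torus_embed_def by (intro continuous_intros)

lemma compact_range_torus_embed: "compact (range (torus_embed :: real^'d \<Rightarrow> _))"
proof -
  have "range (torus_embed :: real^'d \<Rightarrow> _) = torus_embed ` unit_cube"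
    using torus_periodic_proj[OF torus_periodic_embed, symmetric] torus_proj_in_cube by blast
  then show ?thesis
    using compact_continuous_image[OF continuous_on_torus_embed compact_unit_cube] by simp
qed

text \<open>Subtracting the nearest integer to \<open>a n - b\<close> leaves a remainder of modulus
  at most 1/2; there 2 pi times its modulus lies in [0, pi], where \<open>arccos\<close> inverts
  \<open>cos\<close>, so convergence on the circle forces the remainder to 0.\<close>

lemma cis_tendsto_lift:
  assumes "(\<lambda>n. cis (2 * pi * a n)) \<longlonglongrightarrow> cis (2 * pi * b)"
  shows "(\<lambda>n. a n - of_int (round (a n - b))) \<longlonglongrightarrow> b"
proof -
  define c where "c = (\<lambda>n. a n - b - of_int (round (a n - b)))"
  have "(\<lambda>n. cis (2 * pi * a n) * cis (- (2 * pi * b))) \<longlonglongrightarrow> cis (2 * pi * b) * cis (- (2 * pi * b))"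
    by (intro tendsto_mult assms tendsto_const)
  moreover have "cis (2 * pi * a n) * cis (- (2 * pi * b)) = cis (2 * pi * c n)" for n
  proof -
    have "cis (2 * pi * c n) = cis (2 * pi * a n + - (2 * pi * b)) * cis (- (2 * pi * of_int (round (a n - b))))"
      unfolding cis_mult c_def by (simp add: algebra_simps)
    also have "cis (- (2 * pi * of_int (round (a n - b)))) = 1"
      by (simp flip: cis_cnj)
    finally show ?thesis
      by (simp add: cis_mult)
  qed
  ultimately have "(\<lambda>n. cis (2 * pi * c n)) \<longlonglongrightarrow> 1"
    by (simp add: cis_mult)
  then have "(\<lambda>n. Re (cis (2 * pi * c n))) \<longlonglongrightarrow> Re 1"
    by (rule tendsto_Re)
  then have "(\<lambda>n. arccos (cos (2 * pi * c n))) \<longlonglongrightarrow> arccos 1"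
    by (intro continuous_on_tendsto_compose[OF continuous_on_arccos']) auto
  moreover have "arccos (cos (2 * pi * c n)) = 2 * pi * \<bar>c n\<bar>" for n
  proof -
    have "\<bar>c n\<bar> \<le> 1 / 2"
      unfolding c_def using of_int_round_abs_le[of "a n - b"] by linarith
    then have "2 * pi * \<bar>c n\<bar> \<le> pi"
      by (simp add: mult_le_cancel_left2)
    then have "arccos (cos (2 * pi * \<bar>c n\<bar>)) = 2 * pi * \<bar>c n\<bar>"
      by (intro arccos_cos) auto
    moreover have "cos (2 * pi * \<bar>c n\<bar>) = cos (2 * pi * c n)"
      by (simp add: abs_if)
    ultimately show ?thesis by simp
  qed
  ultimately have "(\<lambda>n. 2 * pi * \<bar>c n\<bar>) \<longlonglongrightarrow> 0"
    by simp
  then have "(\<lambda>n. 2 * pi * \<bar>c n\<bar> / (2 * pi)) \<longlonglongrightarrow> 0 / (2 * pi)"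
    by (intro tendsto_divide tendsto_const) auto
  then have "c \<longlonglongrightarrow> 0"
    by (simp add: tendsto_rabs_zero_iff)
  then have "(\<lambda>n. c n + b) \<longlonglongrightarrow> 0 + b"
    by (intro tendsto_add tendsto_const)
  then show ?thesis
    by (simp add: c_def)
qed

lemma torus_embed_tendsto_lift:
  assumes "(\<lambda>n. torus_embed (x n)) \<longlonglongrightarrow> torus_embed y"
  obtains k where "\<And>n. k n \<in> int_vecs" "(\<lambda>n. x n - k n) \<longlonglongrightarrow> y"
proof
  define k :: "nat \<Rightarrow> real^'a" where "k = (\<lambda>n. \<chi> i. of_int (round (x n $ i - y $ i)))"
  show "k n \<in> int_vecs" for n
    by (simp add: k_def int_vecs_def)
  show "(\<lambda>n. x n - k n) \<longlonglongrightarrow> y"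
  proof (rule vec_tendstoI)
    fix i
    have "(\<lambda>n. torus_embed (x n) $ i) \<longlonglongrightarrow> torus_embed y $ i"
      by (intro tendsto_vec_nth assms)
    then have "(\<lambda>n. cis (2 * pi * x n $ i)) \<longlonglongrightarrow> cis (2 * pi * y $ i)"
      by (simp add: torus_embed_def)
    from cis_tendsto_lift[OF this] show "(\<lambda>n. (x n - k n) $ i) \<longlonglongrightarrow> y $ i"
      by (simp add: k_def)
  qed
qed

text \<open>Continuity on the quotient: the representatives \<open>x n\<close> may jump by lattice
  vectors, which the lift removes and periodicity ignores.\<close>

lemma torus_periodic_tendsto:
  assumes "torus_periodic f" "continuous_on UNIV f"
    and "(\<lambda>n. torus_embed (x n)) \<longlonglongrightarrow> torus_embed y"
  shows "(\<lambda>n. f (x n)) \<longlonglongrightarrow> f y"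
proof -
  obtain k where k: "\<And>n. k n \<in> int_vecs" "(\<lambda>n. x n - k n) \<longlonglongrightarrow> y"
    using torus_embed_tendsto_lift[OF assms(3)] by blast
  have "(\<lambda>n. f (x n - k n)) \<longlonglongrightarrow> f y"
    using continuous_on_tendsto_compose[OF assms(2) k(2)] by simp
  then show ?thesis
    by (simp add: torus_periodic_diff[OF assms(1) k(1)])
qed

lemma bounded_torus_periodic:
  fixes f :: "real^'d \<Rightarrow> 'b::real_normed_vector"
  assumes "torus_periodic f" "continuous_on UNIV f"
  shows "\<exists>B\<ge>0. \<forall>x. norm (f x) \<le> B"
proof -
  have "compact (f ` unit_cube)"
    by (rule compact_continuous_image) (auto intro: continuous_on_subset[OF assms(2)] compact_unit_cube)
  then obtain B where "\<And>x. x \<in> unit_cube \<Longrightarrow> norm (f x) \<le> B"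
    using compact_imp_bounded by (force simp: bounded_iff)
  then have "\<forall>x. norm (f x) \<le> B"
    by (metis torus_proj_in_cube torus_periodic_proj[OF assms(1)])
  then show ?thesis
    by (metis norm_ge_zero order_trans)
qed

section \<open>The quotient metric and its comparison with the embedding\<close>

lemma torus_dist_le: "k \<in> int_vecs \<Longrightarrow> torus_dist x y \<le> norm (x - y - k)"
  unfolding torus_dist_def by (rule cInf_lower) (auto intro!: bdd_belowI[of _ 0])

lemma torus_dist_geI:
  assumes "\<And>k. k \<in> int_vecs \<Longrightarrow> c \<le> norm (x - y - k)"
  shows "c \<le> torus_dist x y"
  unfolding torus_dist_def
  by (rule cInf_greatest) (use assms int_vecs_0 in auto)

lemma torus_dist_le_norm: "torus_dist x y \<le> norm (x - y)"
  using torus_dist_le[OF int_vecs_0, of x y] by simp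

text \<open>Two triangle inequalities at once, for representatives shifted by different lattice
  vectors: a competitor m for x', y' becomes the competitor \<open>m - k + l\<close> for x, y. Its
  use is to pass Lipschitz bounds to limits of curves.\<close>

lemma torus_dist_perturb:
  assumes "k \<in> int_vecs" "l \<in> int_vecs"
  shows "torus_dist x y \<le> norm (x' - k - x) + norm (y' - l - y) + torus_dist x' y'"
proof -
  have "torus_dist x y - norm (x' - k - x) - norm (y' - l - y) \<le> torus_dist x' y'"
  proof (rule torus_dist_geI)
    fix m :: "real^'a" assume "m \<in> int_vecs"
    then have "m - k + l \<in> int_vecs"
      by (metis assms diff_conv_add_uminus int_vecs_add int_vecs_minus)
    then have "torus_dist x y \<le> norm (x - y - (m - k + l))"
      by (rule torus_dist_le)
    also have "x - y - (m - k + l) = (x' - y' - m) - (x' - k - x) + (y' - l - y)"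
      by simp
    also have "norm \<dots> \<le> norm (x' - y' - m) + norm (x' - k - x) + norm (y' - l - y)"
      by (meson add_right_mono norm_triangle_ineq norm_triangle_ineq4 order_trans)
    finally show "torus_dist x y - norm (x' - k - x) - norm (y' - l - y) \<le> norm (x' - y' - m)"
      by simp
  qed
  then show ?thesis by simp
qed

lemma norm_cis_diff_le: "cmod (cis a - cis b) \<le> \<bar>a - b\<bar>"
proof -
  have "cis a - cis b = cis b * (exp (\<i> * of_real (a - b)) - 1)"
    by (simp only: right_diff_distrib cis_mult flip: cis_conv_exp) simp
  then have "cmod (cis a - cis b) = 2 * \<bar>sin ((a - b) / 2)\<bar>"
    by (simp only: norm_mult norm_cis dist_exp_i_1 mult_1)
  then show ?thesis
    using abs_sin_x_le_abs_x[of "(a - b) / 2"] by simp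
qed

text \<open>In each coordinate a chord is no longer than its arc; as the embedding does not see the
  shift k, the bound survives the infimum over all shifts.\<close>

lemma norm_torus_embed_diff_le: "norm (torus_embed x - torus_embed y) \<le> 2 * pi * torus_dist x y"
proof -
  have "norm (torus_embed x - torus_embed y) / (2 * pi) \<le> torus_dist x y"
  proof (rule torus_dist_geI)
    fix k :: "real^'a" assume k: "k \<in> int_vecs"
    have "norm (torus_embed x - torus_embed y) = norm (torus_embed (x - k) - torus_embed y)"
      by (simp add: torus_periodic_diff[OF torus_periodic_embed k])
    also have "\<dots> \<le> norm ((2 * pi) *\<^sub>R (x - y - k))"
    proof (rule norm_le_componentwise_cart)
      fix i
      have "norm ((torus_embed (x - k) - torus_embed y) $ i) \<le> \<bar>2 * pi * (x - k) $ i - 2 * pi * y $ i\<bar>"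
        by (simp add: torus_embed_def norm_cis_diff_le)
      also have "2 * pi * (x - k) $ i - 2 * pi * y $ i = 2 * pi * (x - y - k) $ i"
        by (simp add: algebra_simps)
      finally show "norm ((torus_embed (x - k) - torus_embed y) $ i)
          \<le> norm (((2 * pi) *\<^sub>R (x - y - k)) $ i)"
        by (simp add: abs_mult)
    qed
    finally show "norm (torus_embed x - torus_embed y) / (2 * pi) \<le> norm (x - y - k)"
      by (simp only: norm_scaleR) (simp add: field_simps)
  qed
  then show ?thesis
    by (simp add: field_simps)
qed

section \<open>Kernels and the discrepancy\<close>

lemma lebesgue_on_unit_interval: "emeasure (lebesgue_on {0..1::real}) (space (lebesgue_on {0..1})) = 1"
  by (simp add: emeasure_restrict_space)

text \<open>Integrability is not assumed: a function that is not integrable has integral 0 by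
  convention, and B is nonnegative because it bounds an absolute value.\<close>

lemma integral_bound_of_unit_mass:
  fixes f :: "'a \<Rightarrow> real"
  assumes "emeasure M (space M) = 1" "\<And>x. \<bar>f x\<bar> \<le> B"
  shows "\<bar>integral\<^sup>L M f\<bar> \<le> B"
proof (cases "integrable M f")
  case True
  interpret finite_measure M
    by standard (simp add: assms(1))
  have "\<bar>integral\<^sup>L M f\<bar> \<le> (\<integral>x. \<bar>f x\<bar> \<partial>M)"
    by (rule integral_abs_bound)
  also have "\<dots> \<le> (\<integral>x. B \<partial>M)"
    using True assms(2) by (intro integral_mono) auto
  also have "\<dots> = B"
    using assms(1) by (simp add: measure_def)
  finally show ?thesis .
next
  case False
  then show ?thesis
    using assms(2)[of undefined] by (simp add: not_integrable_integral_eq)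
qed

text \<open>Homogeneity: rescale the coefficients until their quadratic form is at most 1. When the
  form is 0 every rescaling is allowed, so the value has to vanish.\<close>

lemma rkhs_vals_le:
  fixes n :: nat and a :: "nat \<Rightarrow> real" and x :: "nat \<Rightarrow> 'a"
  assumes K: "psd_kernel K" and f: "in_rkhs K f" "rkhs_norm K f \<le> 1"
  shows "\<bar>\<Sum>i<n. a i * f (x i)\<bar> \<le> sqrt (\<Sum>i<n. \<Sum>j<n. a i * a j * K (x i) (x j))"
proof -
  define v where "v = (\<Sum>i<n. a i * f (x i))"
  define Q where "Q = (\<Sum>i<n. \<Sum>j<n. a i * a j * K (x i) (x j))"
  have Q0: "0 \<le> Q"
    using K unfolding psd_kernel_def Q_def by blast
  have scaled: "t * \<bar>v\<bar> \<le> 1" if t: "0 \<le> t" "t\<^sup>2 * Q \<le> 1" for t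
  proof -
    have "(\<Sum>i<n. \<Sum>j<n. (t * a i) * (t * a j) * K (x i) (x j)) = t\<^sup>2 * Q"
      by (simp add: Q_def sum_distrib_left power2_eq_square mult_ac)
    then have "\<bar>\<Sum>i<n. (t * a i) * f (x i)\<bar> \<in> rkhs_vals K f"
      unfolding rkhs_vals_def mem_Collect_eq using t(2)
      by (intro exI[of _ n] exI[of _ "\<lambda>i. t * a i"] exI[of _ x]) simp
    then have "\<bar>\<Sum>i<n. (t * a i) * f (x i)\<bar> \<le> rkhs_norm K f"
      using f(1) unfolding in_rkhs_def rkhs_norm_def by (intro cSup_upper)
    moreover have "(\<Sum>i<n. (t * a i) * f (x i)) = t * v"
      by (simp add: v_def sum_distrib_left mult_ac)
    ultimately show ?thesis
      using f(2) t(1) by (simp add: abs_mult)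
  qed
  have "\<bar>v\<bar> \<le> sqrt Q"
  proof (cases "Q = 0")
    case True
    have "\<bar>v\<bar> = 0"
    proof (rule ccontr)
      assume "\<bar>v\<bar> \<noteq> 0"
      then show False
        using scaled[of "2 / \<bar>v\<bar>"] True by simp
    qed
    then show ?thesis
      using True by simp
  next
    case False
    then show ?thesis
      using scaled[of "1 / sqrt Q"] Q0 by (simp add: power_divide)
  qed
  then show ?thesis
    by (simp add: v_def Q_def)
qed

lemma rkhs_ball_bound:
  assumes "psd_kernel K" "in_rkhs K f" "rkhs_norm K f \<le> 1"
  shows "\<bar>f x\<bar> \<le> sqrt (K x x)"
  using rkhs_vals_le[OF assms, where n = 1 and a = "\<lambda>_. 1" and x = "\<lambda>_. x"] by simp

text \<open>The right-hand side is the dual norm of the difference of two point evaluations. It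
  tends to 0 as y tends to x, which gives continuity, and it vanishes when x and y differ by a
  lattice vector, which gives periodicity.\<close>

lemma rkhs_ball_diff_bound:
  assumes "psd_kernel K" "in_rkhs K f" "rkhs_norm K f \<le> 1"
  shows "\<bar>f x - f y\<bar> \<le> sqrt (K x x - 2 * K x y + K y y)"
proof -
  have "K y x = K x y"
    using assms(1) by (simp add: psd_kernel_def)
  then show ?thesis
    using rkhs_vals_le[OF assms, where n = 2 and a = "\<lambda>i. if i = 0 then 1 else -1"
        and x = "\<lambda>i. if i = 0 then x else y"]
    by (simp add: numeral_2_eq_2 algebra_simps)
qed

lemma torus_kernel_psd: "torus_kernel K \<Longrightarrow> psd_kernel K"
  by (simp add: torus_kernel_def)

lemma torus_kernel_continuous:
  assumes "torus_kernel K" "continuous_on S f" "continuous_on S g"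
  shows "continuous_on S (\<lambda>x. K (f x) (g x))"
proof -
  have "continuous_on UNIV (\<lambda>p. K (fst p) (snd p))"
    using assms(1) by (simp add: torus_kernel_def case_prod_unfold)
  from continuous_on_compose2[OF this, of S "\<lambda>x. (f x, g x)"] show ?thesis
    using assms(2,3) by (simp add: continuous_on_Pair)
qed

lemma torus_kernel_shift:
  assumes "torus_kernel K" "k \<in> int_vecs"
  shows "K (x + k) y = K x y" "K x (y + k) = K x y"
proof -
  show *: "K (x + k) y = K x y" for x y
    using assms by (auto simp: torus_kernel_def torus_periodic_def)
  show "K x (y + k) = K x y"
    using *[of y x] torus_kernel_psd[OF assms(1)] by (simp add: psd_kernel_def)
qed

text \<open>The comparison of \<open>rkhs_norm\<close> with \<open>Hs_norm\<close> is assumed for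
  continuous periodic functions; this lemma and the periodicity lemma make it available for every
  test function in the discrepancy.\<close>

lemma rkhs_ball_continuous:
  assumes K: "torus_kernel K" and f: "in_rkhs K f" "rkhs_norm K f \<le> 1"
  shows "continuous_on UNIV (f :: real^'a \<Rightarrow> real)"
proof (rule continuous_at_imp_continuous_on, rule ballI)
  fix x :: "real^'a"
  let ?b = "\<lambda>y. sqrt (K x x - 2 * K x y + K y y)"
  have "continuous_on UNIV (\<lambda>y. K x y)" "continuous_on UNIV (\<lambda>y. K y y)"
    using torus_kernel_continuous[OF K, of UNIV "\<lambda>_. x" "\<lambda>y. y"]
      torus_kernel_continuous[OF K, of UNIV "\<lambda>y. y" "\<lambda>y. y"] by simp_all
  then have "continuous_on UNIV ?b"
    by (intro continuous_on_real_sqrt continuous_on_add continuous_on_diff continuous_on_mult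
        continuous_on_const)
  then have "?b \<midarrow>x\<rightarrow> ?b x"
    unfolding continuous_on_def by blast
  then have "?b \<midarrow>x\<rightarrow> 0"
    by simp
  then have "(\<lambda>y. f y - f x) \<midarrow>x\<rightarrow> 0"
  proof (rule Lim_null_comparison[rotated])
    have "norm (f y - f x) \<le> ?b y" for y
      unfolding real_norm_def
      by (subst abs_minus_commute) (rule rkhs_ball_diff_bound[OF torus_kernel_psd[OF K] f])
    then show "\<forall>\<^sub>F y in at x. norm (f y - f x) \<le> ?b y"
      by simp
  qed
  then show "isCont f x"
    by (simp add: isCont_def LIM_zero_iff)
qed

lemma rkhs_ball_periodic:
  assumes K: "torus_kernel K" and f: "in_rkhs K f" "rkhs_norm K f \<le> 1"
  shows "torus_periodic f"
  unfolding torus_periodic_def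
proof (intro allI ballI)
  fix x k :: "real^'a" assume k: "k \<in> int_vecs"
  show "f (x + k) = f x"
    using rkhs_ball_diff_bound[OF torus_kernel_psd[OF K] f, of "x + k" x]
    by (simp add: torus_kernel_shift[OF K k])
qed

lemma rkhs_ball_uniform_bound:
  assumes "torus_kernel K"
  obtains B where "0 \<le> B" "\<And>f x. in_rkhs K f \<Longrightarrow> rkhs_norm K f \<le> 1 \<Longrightarrow> \<bar>f x\<bar> \<le> B"
proof -
  have "torus_periodic (\<lambda>x. K x x)"
    by (simp add: torus_periodic_def torus_kernel_shift[OF assms])
  then obtain B where B: "0 \<le> B" "\<And>x. \<bar>K x x\<bar> \<le> B"
    using bounded_torus_periodic[of "\<lambda>x. K x x"] torus_kernel_continuous[OF assms, of UNIV "\<lambda>x. x" "\<lambda>x. x"]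
    by auto
  show ?thesis
  proof (rule that[of "sqrt B"])
    show "\<bar>f x\<bar> \<le> sqrt B" if "in_rkhs K f" "rkhs_norm K f \<le> 1" for f x
      using rkhs_ball_bound[OF torus_kernel_psd[OF assms] that, of x] B(2)[of x]
      by (meson abs_le_D1 order_trans real_sqrt_le_iff)
  qed (use B in simp)
qed

text \<open>Keeps the set of values behind \<open>discrepancy\<close> nonempty, so that its
  \<open>Sup\<close> is a genuine supremum once the set is bounded.\<close>

lemma zero_in_rkhs_ball: "in_rkhs K (\<lambda>_. 0)" "rkhs_norm K (\<lambda>_. 0) \<le> 1"
proof -
  have "rkhs_vals K (\<lambda>_. 0) = {0}"
    unfolding rkhs_vals_def by (auto intro: exI[of _ 0])
  then show "in_rkhs K (\<lambda>_. 0)" "rkhs_norm K (\<lambda>_. 0) \<le> 1"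
    by (simp_all add: in_rkhs_def rkhs_norm_def)
qed

lemma discrepancy_leI:
  assumes "\<And>\<phi>. in_rkhs K \<phi> \<Longrightarrow> rkhs_norm K \<phi> \<le> 1 \<Longrightarrow> \<bar>integral\<^sup>L \<mu> \<phi> - integral\<^sup>L \<nu> \<phi>\<bar> \<le> c"
  shows "discrepancy K \<mu> \<nu> \<le> c"
  unfolding discrepancy_def
  by (rule cSup_least) (use assms zero_in_rkhs_ball[of K] in auto)

text \<open>The supremum is finite because the unit ball is uniformly bounded by some B, so that two
  unit masses differ by at most 2B on each of its members.\<close>

lemma discrepancy_upper:
  assumes "torus_kernel K" "emeasure \<mu> (space \<mu>) = 1" "emeasure \<nu> (space \<nu>) = 1"
    and "in_rkhs K \<phi>" "rkhs_norm K \<phi> \<le> 1"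
  shows "\<bar>integral\<^sup>L \<mu> \<phi> - integral\<^sup>L \<nu> \<phi>\<bar> \<le> discrepancy K \<mu> \<nu>"
proof -
  obtain B where B: "\<And>f x. in_rkhs K f \<Longrightarrow> rkhs_norm K f \<le> 1 \<Longrightarrow> \<bar>f x\<bar> \<le> B"
    using rkhs_ball_uniform_bound[OF assms(1)] by metis
  have "\<bar>integral\<^sup>L \<mu> f - integral\<^sup>L \<nu> f\<bar> \<le> 2 * B" if "in_rkhs K f" "rkhs_norm K f \<le> 1" for f
    using integral_bound_of_unit_mass[OF assms(2), of f B, OF B[OF that]]
      integral_bound_of_unit_mass[OF assms(3), of f B, OF B[OF that]] by linarith
  then show ?thesis
    unfolding discrepancy_def
    using assms(4,5) by (intro cSup_upper bdd_aboveI[of _ "2 * B"]) blast+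
qed

lemma discrepancy_nonneg:
  assumes "torus_kernel K" "emeasure \<mu> (space \<mu>) = 1" "emeasure \<nu> (space \<nu>) = 1"
  shows "0 \<le> discrepancy K \<mu> \<nu>"
  using discrepancy_upper[OF assms zero_in_rkhs_ball] by simp

section \<open>Curve measures and existence of minimisers\<close>

lemma torus_lip_curve_const: "0 \<le> L \<Longrightarrow> torus_lip_curve L (\<lambda>_. x)"
  using torus_dist_le_norm[of x x] by (auto simp: torus_lip_curve_def intro: order_trans)

lemma torus_lip_curve_embed:
  assumes "torus_lip_curve L \<gamma>" "s \<in> {0..1}" "t \<in> {0..1}"
  shows "norm (torus_embed (\<gamma> s) - torus_embed (\<gamma> t)) \<le> 2 * pi * L * \<bar>s - t\<bar>"
proof -
  have "torus_dist (\<gamma> s) (\<gamma> t) \<le> L * \<bar>s - t\<bar>"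
    using assms by (simp add: torus_lip_curve_def)
  then have "2 * pi * torus_dist (\<gamma> s) (\<gamma> t) \<le> 2 * pi * (L * \<bar>s - t\<bar>)"
    by (intro mult_left_mono) auto
  with norm_torus_embed_diff_le[of "\<gamma> s" "\<gamma> t"]
  have "norm (torus_embed (\<gamma> s) - torus_embed (\<gamma> t)) \<le> 2 * pi * (L * \<bar>s - t\<bar>)"
    by (rule order_trans)
  then show ?thesis
    by (simp only: mult.assoc)
qed

text \<open>The representative \<open>\<gamma>\<close> itself may be discontinuous; continuity holds
  only after the embedding has forgotten the lattice.\<close>

lemma torus_lip_curve_embed_continuous:
  assumes "torus_lip_curve L \<gamma>"
  shows "continuous_on {0..1} (\<lambda>t. torus_embed (\<gamma> t))"
proof (rule continuous_on_sequentiallyI)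
  fix u :: "nat \<Rightarrow> real" and a :: real
  assume u: "\<forall>n. u n \<in> {0..1}" and a: "a \<in> {0..1}" and lim: "u \<longlonglongrightarrow> a"
  have "(\<lambda>n. 2 * pi * L * \<bar>u n - a\<bar>) \<longlonglongrightarrow> 2 * pi * L * \<bar>a - a\<bar>"
    by (intro tendsto_intros lim)
  then have "(\<lambda>n. 2 * pi * L * \<bar>u n - a\<bar>) \<longlonglongrightarrow> 0"
    by simp
  then have "(\<lambda>n. torus_embed (\<gamma> (u n)) - torus_embed (\<gamma> a)) \<longlonglongrightarrow> 0"
    by (rule Lim_null_comparison[rotated])
      (use torus_lip_curve_embed[OF assms _ a] u in auto)
  then show "(\<lambda>n. torus_embed (\<gamma> (u n))) \<longlonglongrightarrow> torus_embed (\<gamma> a)"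
    by (simp add: LIM_zero_iff)
qed

lemma torus_lip_curve_compose_continuous:
  fixes f :: "real^'d \<Rightarrow> 'b::metric_space"
  assumes "torus_lip_curve L \<gamma>" "torus_periodic f" "continuous_on UNIV f"
  shows "continuous_on {0..1} (\<lambda>t. f (\<gamma> t))"
proof (rule continuous_on_sequentiallyI)
  fix u :: "nat \<Rightarrow> real" and a :: real
  assume u: "\<forall>n. u n \<in> {0..1}" "a \<in> {0..1}" "u \<longlonglongrightarrow> a"
  have "(\<lambda>n. torus_embed (\<gamma> (u n))) \<longlonglongrightarrow> torus_embed (\<gamma> a)"
    using continuous_on_tendsto_compose[OF torus_lip_curve_embed_continuous[OF assms(1)] u(3,2)] u(1)
    by simp
  then show "(\<lambda>n. f (\<gamma> (u n))) \<longlonglongrightarrow> f (\<gamma> a)"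
    by (rule torus_periodic_tendsto[OF assms(2,3)])
qed

text \<open>Recovers the representative in [0,1) from the point on the circle by a Borel formula.
  This makes the projected curve measurable although \<open>\<gamma>\<close> need not be, and it
  shows that equal embeddings have equal projections.\<close>

lemma frac_eq_arccos:
  "frac x = (if 0 \<le> sin (2 * pi * x) then arccos (cos (2 * pi * x)) / (2 * pi)
     else 1 - arccos (cos (2 * pi * x)) / (2 * pi))"
proof -
  define y where "y = frac x"
  have y: "0 \<le> y" "y < 1"
    by (simp_all add: y_def frac_lt_1)
  have x: "2 * pi * x = 2 * pi * y + 2 * pi * of_int \<lfloor>x\<rfloor>"
    by (simp add: y_def frac_def algebra_simps)
  have sc: "sin (2 * pi * x) = sin (2 * pi * y)" "cos (2 * pi * x) = cos (2 * pi * y)"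
    unfolding x by (simp_all add: sin_add cos_add)
  show ?thesis
  proof (cases "y \<le> 1 / 2")
    case True
    then have le: "2 * pi * y \<le> pi"
      by simp
    then have "0 \<le> sin (2 * pi * y)"
      using y by (intro sin_ge_zero) auto
    moreover have "arccos (cos (2 * pi * y)) = 2 * pi * y"
      using y le by (intro arccos_cos) auto
    ultimately show ?thesis
      by (simp add: sc flip: y_def)
  next
    case False
    then have gt: "pi < 2 * pi * y"
      by simp
    have lt: "2 * pi * y < 2 * pi"
      using y by simp
    have "sin (2 * pi * y) < 0"
      using gt lt by (rule sin_lt_zero)
    moreover have "arccos (cos (2 * pi - 2 * pi * y)) = 2 * pi - 2 * pi * y"
      using gt lt by (intro arccos_cos) auto
    moreover have "cos (2 * pi - 2 * pi * y) = cos (2 * pi * y)"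
      by (simp add: cos_diff)
    ultimately show ?thesis
      by (simp add: sc diff_divide_distrib flip: y_def)
  qed
qed

lemma torus_lip_curve_proj_measurable:
  fixes \<gamma> :: "real \<Rightarrow> real^'d"
  assumes "torus_lip_curve L \<gamma>"
  shows "torus_proj \<circ> \<gamma> \<in> borel_measurable (lebesgue_on {0..1})"
proof -
  have meas: "g \<in> borel_measurable (lebesgue_on {0..1})" if "continuous_on {0..1} g" for g :: "real \<Rightarrow> real"
    by (rule continuous_imp_measurable_on_sets_lebesgue[OF that]) simp
  have coord: "(\<lambda>t. torus_proj (\<gamma> t) $ i) \<in> borel_measurable (lebesgue_on {0..1})" for i
  proof -
    have e: "continuous_on {0..1} (\<lambda>t. torus_embed (\<gamma> t) $ i)"
      by (intro continuous_intros torus_lip_curve_embed_continuous[OF assms])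
    have "continuous_on {0..1} (\<lambda>t. Im (torus_embed (\<gamma> t) $ i))"
      by (intro continuous_intros e)
    then have [measurable]: "(\<lambda>t. sin (2 * pi * \<gamma> t $ i)) \<in> borel_measurable (lebesgue_on {0..1})"
      by (intro meas) (simp add: torus_embed_def)
    have "continuous_on {0..1} (\<lambda>t. Re (torus_embed (\<gamma> t) $ i))"
      by (intro continuous_intros e)
    then have [measurable]: "(\<lambda>t. arccos (cos (2 * pi * \<gamma> t $ i))) \<in> borel_measurable (lebesgue_on {0..1})"
      by (intro meas continuous_on_arccos) (simp_all add: torus_embed_def)
    show ?thesis
      unfolding torus_proj_def by (simp add: frac_eq_arccos)
  qed
  show ?thesis
    unfolding borel_measurable_euclidean_space[of "torus_proj \<circ> \<gamma>"]
    using coord by (auto simp: Basis_vec_def inner_axis)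
qed

section \<open>Measures carried by weighted curves, and their limits\<close>

definition curve_measure :: "(real \<Rightarrow> real^'d) \<Rightarrow> (real \<Rightarrow> real) \<Rightarrow> (real^'d) measure" where
  "curve_measure \<gamma> w = distr (density (lebesgue_on {0..1}) (\<lambda>t. ennreal (w t))) borel (torus_proj \<circ> \<gamma>)"

text \<open>The L-curves are the case of constant weight 1, so that one compactness argument serves
  both families.\<close>

lemma Lcurve_measures_eq: "Lcurve_measures L = {curve_measure \<gamma> (\<lambda>_. 1) | \<gamma>. torus_lip_curve L \<gamma>}"
  by (simp add: Lcurve_measures_def curve_measure_def density_1)

definition curve_weight :: "real \<Rightarrow> (real \<Rightarrow> real) \<Rightarrow> bool" where
  "curve_weight L w \<longleftrightarrow> (\<forall>t\<in>{0..1}. 0 \<le> w t)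
      \<and> integral\<^sup>L (lebesgue_on {0..1}) w = 1 \<and> L-lipschitz_on {0..1} w"

lemma Acurve_measures_eq:
  "Acurve_measures L = {curve_measure \<gamma> w | \<gamma> w. torus_lip_curve L \<gamma> \<and> curve_weight L w}"
  unfolding Acurve_measures_def curve_measure_def curve_weight_def by blast

lemma curve_weight_one: "0 \<le> L \<Longrightarrow> curve_weight L (\<lambda>_. 1)"
  using lebesgue_on_unit_interval
  by (auto simp: curve_weight_def lipschitz_on_def measure_def)

lemma curve_weight_measurable:
  assumes "curve_weight L w"
  shows "w \<in> borel_measurable (lebesgue_on {0..1})"
  using assms unfolding curve_weight_def
  by (intro continuous_imp_measurable_on_sets_lebesgue lipschitz_on_continuous_on) auto

lemma integrable_continuous_unit_interval:
  fixes f :: "real \<Rightarrow> 'b::euclidean_space"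
  assumes "continuous_on {0..1} f"
  shows "integrable (lebesgue_on {0..1}) f"
  using absolutely_integrable_continuous_real[OF assms]
  by (simp add: integrable_restrict_space set_integrable_def)

lemma emeasure_curve_measure:
  assumes "torus_lip_curve L \<gamma>" "curve_weight L w"
  shows "emeasure (curve_measure \<gamma> w) (space (curve_measure \<gamma> w)) = 1"
proof -
  have [measurable]: "w \<in> borel_measurable (lebesgue_on {0..1})"
    "torus_proj \<circ> \<gamma> \<in> borel_measurable (lebesgue_on {0..1})"
    by (rule curve_weight_measurable[OF assms(2)] torus_lip_curve_proj_measurable[OF assms(1)])+
  have int: "integrable (lebesgue_on {0..1}) w"
    using assms(2) unfolding curve_weight_def
    by (intro integrable_continuous_unit_interval lipschitz_on_continuous_on) auto
  have "emeasure (curve_measure \<gamma> w) (space (curve_measure \<gamma> w))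
      = emeasure (density (lebesgue_on {0..1}) (\<lambda>t. ennreal (w t))) {0..1}"
    unfolding curve_measure_def by (subst emeasure_distr) auto
  also have "\<dots> = (\<integral>\<^sup>+t. ennreal (w t) \<partial>lebesgue_on {0..1})"
    by (subst emeasure_density) (auto intro!: nn_integral_cong simp: sets_restrict_space)
  also have "\<dots> = ennreal (integral\<^sup>L (lebesgue_on {0..1}) w)"
    using assms(2) by (intro nn_integral_eq_integral int AE_I2) (auto simp: curve_weight_def)
  also have "\<dots> = 1"
    using assms(2) by (simp add: curve_weight_def)
  finally show ?thesis .
qed

lemma integral_curve_measure:
  fixes f :: "real^'d \<Rightarrow> real"
  assumes "torus_lip_curve L \<gamma>" "curve_weight L w" "torus_periodic f" "continuous_on UNIV f"
  shows "integral\<^sup>L (curve_measure \<gamma> w) f = (\<integral>t. w t * f (\<gamma> t) \<partial>lebesgue_on {0..1})"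
proof -
  have [measurable]: "w \<in> borel_measurable (lebesgue_on {0..1})"
    "torus_proj \<circ> \<gamma> \<in> borel_measurable (lebesgue_on {0..1})"
    "f \<in> borel_measurable borel"
    by (rule curve_weight_measurable[OF assms(2)] torus_lip_curve_proj_measurable[OF assms(1)]
        borel_measurable_continuous_onI[OF assms(4)])+
  have f\<gamma>: "(\<lambda>t. f (\<gamma> t)) \<in> borel_measurable (lebesgue_on {0..1})"
    by (intro continuous_imp_measurable_on_sets_lebesgue
        torus_lip_curve_compose_continuous[OF assms(1,3,4)]) auto
  have "integral\<^sup>L (curve_measure \<gamma> w) f
      = (\<integral>t. f (\<gamma> t) \<partial>density (lebesgue_on {0..1}) (\<lambda>t. ennreal (w t)))"
    unfolding curve_measure_def
    by (subst integral_distr) (auto simp: torus_periodic_proj[OF assms(3)])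
  also have "\<dots> = (\<integral>t. w t *\<^sub>R f (\<gamma> t) \<partial>lebesgue_on {0..1})"
    using assms(2) f\<gamma> by (intro integral_density AE_I2) (auto simp: curve_weight_def)
  finally show ?thesis by simp
qed

text \<open>A function of mean 1 that oscillates by at most L on the unit interval stays below 1 +
  L. This is the uniform bound for Arzela-Ascoli and for dominated convergence.\<close>

lemma curve_weight_le:
  assumes "curve_weight L w" "t \<in> {0..1}"
  shows "w t \<le> 1 + L"
proof -
  have L0: "0 \<le> L" and lip: "L-lipschitz_on {0..1} w"
    using assms(1) by (auto simp: curve_weight_def lipschitz_on_def)
  have "w t - L = (\<integral>u. w t - L \<partial>lebesgue_on {0..1::real})"
    using lebesgue_on_unit_interval by (simp add: measure_def)
  also have "\<dots> \<le> integral\<^sup>L (lebesgue_on {0..1}) w"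
  proof (rule integral_mono)
    fix u :: real assume "u \<in> space (lebesgue_on {0..1})"
    then have u: "u \<in> {0..1}" by simp
    have "\<bar>w t - w u\<bar> \<le> L * \<bar>t - u\<bar>"
      using lipschitz_onD[OF lip assms(2) u] by (simp add: dist_real_def)
    also have "\<dots> \<le> L * 1"
      using L0 u assms(2) by (intro mult_left_mono) auto
    finally show "w t - L \<le> w u" by simp
  next
    show "integrable (lebesgue_on {0..1}) w"
      by (intro integrable_continuous_unit_interval lipschitz_on_continuous_on[OF lip])
  qed (intro integrable_continuous_unit_interval continuous_on_const)
  also have "\<dots> = 1"
    using assms(1) by (simp add: curve_weight_def)
  finally show ?thesis by simp
qed

lemma torus_dist_tendsto_le:
  assumes "(\<lambda>n. torus_embed (x n)) \<longlonglongrightarrow> torus_embed x'" "(\<lambda>n. torus_embed (y n)) \<longlonglongrightarrow> torus_embed y'"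
    and "\<And>n. torus_dist (x n) (y n) \<le> c"
  shows "torus_dist x' y' \<le> c"
proof -
  obtain k where k: "\<And>n. k n \<in> int_vecs" "(\<lambda>n. x n - k n) \<longlonglongrightarrow> x'"
    using torus_embed_tendsto_lift[OF assms(1)] by blast
  obtain l where l: "\<And>n. l n \<in> int_vecs" "(\<lambda>n. y n - l n) \<longlonglongrightarrow> y'"
    using torus_embed_tendsto_lift[OF assms(2)] by blast
  have "(\<lambda>n. norm (x n - k n - x') + norm (y n - l n - y') + c) \<longlonglongrightarrow> norm (x' - x') + norm (y' - y') + c"
    by (intro tendsto_intros k l)
  moreover have "torus_dist x' y' \<le> norm (x n - k n - x') + norm (y n - l n - y') + c" for n
    using torus_dist_perturb[OF k(1) l(1), of x' y' "x n" n "y n" n] assms(3)[of n] by linarith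
  ultimately show ?thesis
    using LIMSEQ_le_const by fastforce
qed

text \<open>Arzela-Ascoli is applied to the pair of embedded curve and weight, so that one
  subsequence serves both.\<close>

lemma curve_compactness:
  fixes \<gamma> :: "nat \<Rightarrow> real \<Rightarrow> real^'d"
  assumes \<gamma>: "\<And>n. torus_lip_curve L (\<gamma> n)" and w: "\<And>n. curve_weight L (w n)" and L: "0 \<le> L"
  obtains r \<gamma>' w' where "strict_mono r" "torus_lip_curve L \<gamma>'" "curve_weight L w'"
    "\<And>t. t \<in> {0..1} \<Longrightarrow> (\<lambda>n. torus_embed (\<gamma> (r n) t)) \<longlonglongrightarrow> torus_embed (\<gamma>' t)"
    "\<And>t. t \<in> {0..1} \<Longrightarrow> (\<lambda>n. w (r n) t) \<longlonglongrightarrow> w' t"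
proof -
  define F where "F = (\<lambda>n t. (torus_embed (\<gamma> n t), w n t))"
  have lipw: "\<bar>w n x - w n y\<bar> \<le> L * \<bar>x - y\<bar>" if "x \<in> {0..1}" "y \<in> {0..1}" for n x y
    using w[of n] lipschitz_onD[of L "{0..1}" "w n"] that by (simp add: curve_weight_def dist_real_def)
  \<comment> \<open>A common Lipschitz constant for both components; the added 1 keeps it positive
    for L = 0, so that \<open>e / C\<close> is a valid modulus.\<close>
  define C where "C = 2 * pi * L + L + 1"
  have C: "C > 0"
    using L by (simp add: C_def add_nonneg_pos)
  have lipF: "norm (F n x - F n y) \<le> C * \<bar>x - y\<bar>" if "x \<in> {0..1}" "y \<in> {0..1}" for n x y
  proof -
    have "norm (F n x - F n y) \<le> norm (torus_embed (\<gamma> n x) - torus_embed (\<gamma> n y)) + norm (w n x - w n y)"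
      unfolding F_def diff_Pair by (rule norm_Pair_le)
    also have "\<dots> \<le> 2 * pi * L * \<bar>x - y\<bar> + L * \<bar>x - y\<bar>"
      using torus_lip_curve_embed[OF \<gamma> that] lipw[OF that] by (intro add_mono) auto
    also have "\<dots> \<le> C * \<bar>x - y\<bar>"
      by (simp add: C_def algebra_simps)
    finally show ?thesis .
  qed
  obtain B where B: "\<And>x::real^'d. norm (torus_embed x) \<le> B"
    using bounded_torus_periodic[OF torus_periodic_embed continuous_on_torus_embed] by blast
  obtain g r where g: "continuous_on {0..1::real} g" and r: "strict_mono (r :: nat \<Rightarrow> nat)"
    and lim: "\<And>e. 0 < e \<Longrightarrow> \<exists>N. \<forall>n x. n \<ge> N \<and> x \<in> {0..1} \<longrightarrow> norm (F (r n) x - g x) < e"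
  proof (rule Arzela_Ascoli[of "{0..1::real}" F "B + (1 + L)"])
    show "norm (F n x) \<le> B + (1 + L)" if "x \<in> {0..1}" for n x
    proof -
      have "norm (F n x) \<le> norm (torus_embed (\<gamma> n x)) + norm (w n x)"
        unfolding F_def by (rule norm_Pair_le)
      also have "\<dots> \<le> B + (1 + L)"
        using B curve_weight_le[OF w that] w[of n] that
        by (intro add_mono) (auto simp: curve_weight_def)
      finally show ?thesis .
    qed
    show "\<exists>d>0. \<forall>n y. y \<in> {0..1} \<and> norm (x - y) < d \<longrightarrow> norm (F n x - F n y) < e"
      if "x \<in> {0..1}" "0 < e" for x e
    proof (intro exI[of _ "e / C"] conjI allI impI)
      fix n y assume "y \<in> {0..1} \<and> norm (x - y) < e / C"
      then show "norm (F n x - F n y) < e"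
        using lipF[OF that(1), of y n] C by (auto simp: field_simps intro: le_less_trans)
    qed (use C that in auto)
  qed auto
  have limF: "(\<lambda>n. F (r n) t) \<longlonglongrightarrow> g t" if "t \<in> {0..1}" for t
    unfolding LIMSEQ_iff using lim that by meson
  have limg1: "(\<lambda>n. torus_embed (\<gamma> (r n) t)) \<longlonglongrightarrow> fst (g t)" if "t \<in> {0..1}" for t
    using tendsto_fst[OF limF[OF that]] by (simp add: F_def)
  define w' where "w' = (\<lambda>t. snd (g t))"
  have limw: "(\<lambda>n. w (r n) t) \<longlonglongrightarrow> w' t" if "t \<in> {0..1}" for t
    using tendsto_snd[OF limF[OF that]] by (simp add: F_def w'_def)
  have "\<exists>y. fst (g t) = torus_embed y" if "t \<in> {0..1}" for t
  proof -
    have "closed (range (torus_embed :: real^'d \<Rightarrow> _))"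
      by (intro compact_imp_closed compact_range_torus_embed)
    then have "fst (g t) \<in> range (torus_embed :: real^'d \<Rightarrow> _)"
      by (rule closed_sequentially) (use limg1[OF that] in auto)
    then show ?thesis by auto
  qed
  \<comment> \<open>The range of the embedding is closed, so every limit point has a representative.
    These are chosen independently for each t; the definition of a curve tolerates the resulting
    jumps.\<close>
  then obtain \<gamma>' where \<gamma>': "\<And>t. t \<in> {0..1} \<Longrightarrow> fst (g t) = torus_embed (\<gamma>' t)"
    by metis
  have lim\<gamma>: "(\<lambda>n. torus_embed (\<gamma> (r n) t)) \<longlonglongrightarrow> torus_embed (\<gamma>' t)" if "t \<in> {0..1}" for t
    using limg1[OF that] \<gamma>'[OF that] by simp
  have curve: "torus_lip_curve L \<gamma>'"
    unfolding torus_lip_curve_def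
  proof (intro conjI ballI)
    have eq: "torus_embed (\<gamma> n 0) = torus_embed (\<gamma> n 1)" for n
      using \<gamma>[of n] torus_periodic_proj[OF torus_periodic_embed] unfolding torus_lip_curve_def by metis
    then have embed_eq: "torus_embed (\<gamma>' 0) = torus_embed (\<gamma>' 1)"
      using LIMSEQ_unique[OF lim\<gamma>[of 0]] lim\<gamma>[of 1] by simp
    show "torus_proj (\<gamma>' 0) = torus_proj (\<gamma>' 1)"
      unfolding torus_proj_def vec_eq_iff
    proof
      fix i
      have "cis (2 * pi * \<gamma>' 0 $ i) = cis (2 * pi * \<gamma>' 1 $ i)"
        using embed_eq by (simp add: torus_embed_def vec_eq_iff)
      then have "cos (2 * pi * \<gamma>' 0 $ i) = cos (2 * pi * \<gamma>' 1 $ i)" "sin (2 * pi * \<gamma>' 0 $ i) = sin (2 * pi * \<gamma>' 1 $ i)"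
        by (metis cis.sel)+
      then show "(\<chi> i. frac (\<gamma>' 0 $ i)) $ i = (\<chi> i. frac (\<gamma>' 1 $ i)) $ i"
        by (simp add: frac_eq_arccos)
    qed
  next
    fix s t :: real assume st: "s \<in> {0..1}" "t \<in> {0..1}"
    show "torus_dist (\<gamma>' s) (\<gamma>' t) \<le> L * \<bar>s - t\<bar>"
      using \<gamma> st by (intro torus_dist_tendsto_le[OF lim\<gamma>[OF st(1)] lim\<gamma>[OF st(2)]])
        (simp add: torus_lip_curve_def)
  qed
  have "curve_weight L w'"
    unfolding curve_weight_def
  proof (intro conjI ballI)
    fix t :: real assume t: "t \<in> {0..1}"
    show "0 \<le> w' t"
      using w t by (intro LIMSEQ_le_const[OF limw[OF t]]) (auto simp: curve_weight_def)
  next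
    have "(\<lambda>n. integral\<^sup>L (lebesgue_on {0..1}) (w (r n))) \<longlonglongrightarrow> integral\<^sup>L (lebesgue_on {0..1}) w'"
    proof (rule integral_dominated_convergence[where w = "\<lambda>_. 1 + L"])
      show "w' \<in> borel_measurable (lebesgue_on {0..1})"
        using g by (intro continuous_imp_measurable_on_sets_lebesgue) (auto simp: w'_def intro: continuous_on_snd)
      show "w (r n) \<in> borel_measurable (lebesgue_on {0..1})" for n
        by (rule curve_weight_measurable[OF w])
      show "integrable (lebesgue_on {0..1::real}) (\<lambda>_. 1 + L)"
        by (intro integrable_continuous_unit_interval continuous_on_const)
      show "AE x in lebesgue_on {0..1}. (\<lambda>n. w (r n) x) \<longlonglongrightarrow> w' x"
        by (intro AE_I2 limw) simp
      show "AE x in lebesgue_on {0..1}. norm (w (r n) x) \<le> 1 + L" for n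
        using curve_weight_le[OF w[of "r n"]] w[of "r n"]
        by (intro AE_I2) (auto simp: curve_weight_def)
    qed
    moreover have "integral\<^sup>L (lebesgue_on {0..1}) (w (r n)) = 1" for n
      using w by (simp add: curve_weight_def)
    ultimately show "integral\<^sup>L (lebesgue_on {0..1}) w' = 1"
      by (simp add: LIMSEQ_const_iff)
  next
    show "L-lipschitz_on {0..1} w'"
    proof (rule lipschitz_onI[OF _ L])
      fix x y :: real assume xy: "x \<in> {0..1}" "y \<in> {0..1}"
      have "(\<lambda>n. \<bar>w (r n) x - w (r n) y\<bar>) \<longlonglongrightarrow> \<bar>w' x - w' y\<bar>"
        by (intro tendsto_intros limw xy)
      then show "dist (w' x) (w' y) \<le> L * dist x y"
        unfolding dist_real_def by (rule LIMSEQ_le_const2) (use lipw[OF xy] in auto)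
    qed
  qed
  then show thesis
    using that[OF r curve _ lim\<gamma> limw] by blast
qed

lemma integral_curve_measure_tendsto:
  fixes f :: "real^'d \<Rightarrow> real"
  assumes "\<And>n. torus_lip_curve L (\<gamma> n)" "\<And>n. curve_weight L (w n)"
    and "torus_lip_curve L \<gamma>'" "curve_weight L w'"
    and lim\<gamma>: "\<And>t. t \<in> {0..1} \<Longrightarrow> (\<lambda>n. torus_embed (\<gamma> n t)) \<longlonglongrightarrow> torus_embed (\<gamma>' t)"
    and limw: "\<And>t. t \<in> {0..1} \<Longrightarrow> (\<lambda>n. w n t) \<longlonglongrightarrow> w' t"
    and f: "torus_periodic f" "continuous_on UNIV f"
  shows "(\<lambda>n. integral\<^sup>L (curve_measure (\<gamma> n) (w n)) f) \<longlonglongrightarrow> integral\<^sup>L (curve_measure \<gamma>' w') f"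
proof -
  obtain B where B: "0 \<le> B" "\<And>x. \<bar>f x\<bar> \<le> B"
    using bounded_torus_periodic[OF f] by auto
  have meas: "(\<lambda>t. v t * f (\<delta> t)) \<in> borel_measurable (lebesgue_on {0..1})"
    if "torus_lip_curve L \<delta>" "curve_weight L v" for \<delta> v
    using that(2) unfolding curve_weight_def
    by (intro continuous_imp_measurable_on_sets_lebesgue continuous_on_mult lipschitz_on_continuous_on
        torus_lip_curve_compose_continuous[OF that(1) f]) auto
  have "(\<lambda>n. \<integral>t. w n t * f (\<gamma> n t) \<partial>lebesgue_on {0..1}) \<longlonglongrightarrow> (\<integral>t. w' t * f (\<gamma>' t) \<partial>lebesgue_on {0..1})"
  proof (rule integral_dominated_convergence[where w = "\<lambda>_. (1 + L) * B"])
    show "integrable (lebesgue_on {0..1::real}) (\<lambda>_. (1 + L) * B)"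
      by (intro integrable_continuous_unit_interval continuous_on_const)
    show "AE t in lebesgue_on {0..1}. (\<lambda>n. w n t * f (\<gamma> n t)) \<longlonglongrightarrow> w' t * f (\<gamma>' t)"
      by (intro AE_I2 tendsto_mult limw torus_periodic_tendsto[OF f] lim\<gamma>) auto
    show "AE t in lebesgue_on {0..1}. norm (w n t * f (\<gamma> n t)) \<le> (1 + L) * B" for n
    proof (rule AE_I2)
      fix t :: real assume "t \<in> space (lebesgue_on {0..1})"
      then have "0 \<le> w n t" "w n t \<le> 1 + L"
        using assms(2)[of n] curve_weight_le[OF assms(2), of t n] by (auto simp: curve_weight_def)
      then show "norm (w n t * f (\<gamma> n t)) \<le> (1 + L) * B"
        using B by (simp add: abs_mult mult_mono)
    qed
  qed (use meas assms in auto)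
  then show ?thesis
    by (simp only: integral_curve_measure[OF assms(1,2) f] integral_curve_measure[OF assms(3,4) f])
qed

text \<open>The set \<^term>\<open>W\<close> of admissible weights is all of \<^term>\<open>curve_weight L\<close> for the A-curves and
  the constant weight for the L-curves.\<close>

lemma discrepancy_minimizer_exists:
  fixes K :: "real^'d \<Rightarrow> real^'d \<Rightarrow> real" and W :: "(real \<Rightarrow> real) set"
  assumes K: "torus_kernel K" and \<mu>: "emeasure \<mu> (space \<mu>) = 1" and L: "0 \<le> L"
    and W: "\<And>w. w \<in> W \<Longrightarrow> curve_weight L w" and ne: "W \<noteq> {}"
    and closed: "\<And>w w'. (\<And>n. w n \<in> W) \<Longrightarrow> curve_weight L w' \<Longrightarrow>
      (\<And>t. t \<in> {0..1} \<Longrightarrow> (\<lambda>n::nat. w n t) \<longlonglongrightarrow> w' t) \<Longrightarrow> \<exists>w''\<in>W. \<forall>t\<in>{0..1}. w'' t = w' t"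
  defines "A \<equiv> {curve_measure \<gamma> w | \<gamma> w. torus_lip_curve L \<gamma> \<and> w \<in> W}"
  shows "\<exists>\<nu>\<in>A. discrepancy K \<mu> \<nu> = (INF \<nu>'\<in>A. discrepancy K \<mu> \<nu>')"
proof -
  define D where "D = (INF \<nu>\<in>A. discrepancy K \<mu> \<nu>)"
  have mass: "emeasure \<nu> (space \<nu>) = 1" if "\<nu> \<in> A" for \<nu>
    using that W emeasure_curve_measure by (auto simp: A_def)
  have bdd: "bdd_below (discrepancy K \<mu> ` A)"
    by (rule bdd_belowI2[of _ 0]) (rule discrepancy_nonneg[OF K \<mu> mass])
  obtain w0 where "w0 \<in> W"
    using ne by blast
  moreover have "torus_lip_curve L (\<lambda>_. 0 :: real^'d)"
    by (rule torus_lip_curve_const[OF L])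
  ultimately have neA: "A \<noteq> {}"
    by (auto simp: A_def)
  have "\<exists>\<gamma> w. torus_lip_curve L \<gamma> \<and> w \<in> W \<and> discrepancy K \<mu> (curve_measure \<gamma> w) < D + inverse (real (Suc n))" for n
  proof -
    have "\<exists>\<nu>\<in>A. discrepancy K \<mu> \<nu> < D + inverse (real (Suc n))"
      using cINF_less_iff[OF neA bdd, of "D + inverse (real (Suc n))"] by (simp add: D_def)
    then show ?thesis
      by (auto simp: A_def)
  qed
  then obtain \<gamma> w where \<gamma>: "\<And>n. torus_lip_curve L (\<gamma> n)" and w: "\<And>n. w n \<in> W"
    and disc: "\<And>n. discrepancy K \<mu> (curve_measure (\<gamma> n) (w n)) < D + inverse (real (Suc n))"
    by metis
  obtain r \<gamma>' w' where r: "strict_mono r" and \<gamma>': "torus_lip_curve L \<gamma>'" and w': "curve_weight L w'"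
    and lim\<gamma>: "\<And>t. t \<in> {0..1} \<Longrightarrow> (\<lambda>n. torus_embed (\<gamma> (r n) t)) \<longlonglongrightarrow> torus_embed (\<gamma>' t)"
    and limw: "\<And>t. t \<in> {0..1} \<Longrightarrow> (\<lambda>n. w (r n) t) \<longlonglongrightarrow> w' t"
    by (rule curve_compactness[OF \<gamma> W[OF w] L]) (rule that, assumption+)
  \<comment> \<open>Convergence is known on [0,1] only, hence \<open>w'\<close> need not lie in W
    itself; a member of W agreeing with it there gives the same integrals.\<close>
  obtain w'' where w'': "w'' \<in> W" and eq: "\<And>t. t \<in> {0..1} \<Longrightarrow> w'' t = w' t"
    by (rule bexE[OF closed[of "\<lambda>n. w (r n)" w', OF w w' limw]]) (auto intro: that)
  let ?\<nu> = "curve_measure \<gamma>' w''"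
  have \<nu>: "?\<nu> \<in> A"
    using \<gamma>' w'' by (auto simp: A_def)
  have "discrepancy K \<mu> ?\<nu> \<le> D"
  proof (rule discrepancy_leI)
    fix \<phi> assume \<phi>: "in_rkhs K \<phi>" "rkhs_norm K \<phi> \<le> 1"
    have "(\<lambda>n. integral\<^sup>L (curve_measure (\<gamma> (r n)) (w (r n))) \<phi>) \<longlonglongrightarrow> integral\<^sup>L ?\<nu> \<phi>"
      using limw eq
      by (intro integral_curve_measure_tendsto[OF \<gamma> W[OF w] \<gamma>' W[OF w''] lim\<gamma>]
          rkhs_ball_periodic[OF K \<phi>] rkhs_ball_continuous[OF K \<phi>]) auto
    then have lim1: "(\<lambda>n. \<bar>integral\<^sup>L \<mu> \<phi> - integral\<^sup>L (curve_measure (\<gamma> (r n)) (w (r n))) \<phi>\<bar>)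
        \<longlonglongrightarrow> \<bar>integral\<^sup>L \<mu> \<phi> - integral\<^sup>L ?\<nu> \<phi>\<bar>"
      by (intro tendsto_intros)
    have "(\<lambda>n. inverse (real (Suc (r n)))) \<longlonglongrightarrow> 0"
      using LIMSEQ_subseq_LIMSEQ[OF LIMSEQ_inverse_real_of_nat r] by (simp add: o_def)
    then have lim2: "(\<lambda>n. D + inverse (real (Suc (r n)))) \<longlonglongrightarrow> D + 0"
      by (intro tendsto_intros)
    have "\<bar>integral\<^sup>L \<mu> \<phi> - integral\<^sup>L (curve_measure (\<gamma> (r n)) (w (r n))) \<phi>\<bar>
        \<le> D + inverse (real (Suc (r n)))" for n
      using discrepancy_upper[OF K \<mu> emeasure_curve_measure[OF \<gamma> W[OF w]] \<phi>, of "r n" "r n"] disc[of "r n"]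
      by linarith
    then show "\<bar>integral\<^sup>L \<mu> \<phi> - integral\<^sup>L ?\<nu> \<phi>\<bar> \<le> D"
      using LIMSEQ_le[OF lim1 lim2] by auto
  qed
  moreover have "D \<le> discrepancy K \<mu> ?\<nu>"
    unfolding D_def by (rule cINF_lower[OF bdd \<nu>])
  ultimately have "discrepancy K \<mu> ?\<nu> = D"
    by (rule antisym)
  then show ?thesis
    using \<nu> unfolding D_def by blast
qed

section \<open>Fourier expansion on the torus\<close>

definition torus_char :: "int^'d \<Rightarrow> real^'d \<Rightarrow> complex" where
  "torus_char k x = cis (2 * pi * (\<Sum>i\<in>UNIV. real_of_int (k $ i) * x $ i))"

lemma torus_char_add: "torus_char (j + l) x = torus_char j x * torus_char l x"
  by (simp add: torus_char_def cis_mult sum.distrib distrib_left distrib_right)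

lemma torus_char_0 [simp]: "torus_char 0 x = 1"
  by (simp add: torus_char_def)

lemma norm_torus_char [simp]: "cmod (torus_char k x) = 1"
  by (simp add: torus_char_def)

lemma continuous_on_torus_char [continuous_intros]: "continuous_on S (torus_char k)"
  unfolding torus_char_def by (intro continuous_intros)

lemma torus_periodic_char: "torus_periodic (torus_char k)"
  unfolding torus_periodic_def
proof (intro allI ballI)
  fix x m :: "real^'a" assume m: "m \<in> int_vecs"
  have "(\<Sum>i\<in>UNIV. real_of_int (k $ i) * m $ i) \<in> \<int>"
    using m by (intro Ints_sum Ints_mult) (auto simp: int_vecs_def)
  then obtain n where n: "(\<Sum>i\<in>UNIV. real_of_int (k $ i) * m $ i) = of_int n"
    by (auto elim: Ints_cases)
  have "torus_char k (x + m) = torus_char k x * cis (2 * pi * of_int n)"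
    by (simp add: torus_char_def cis_mult sum.distrib distrib_left flip: n)
  then show "torus_char k (x + m) = torus_char k x"
    by simp
qed

lemma fourier_coeff_eq:
  "fourier_coeff f k = (\<integral>x. complex_of_real (f x) * torus_char (- k) x \<partial>torus_lebesgue)"
  by (simp add: fourier_coeff_def torus_char_def sum_negf)

lemma integral_cis_unit_interval:
  "(\<integral>t. cis (2 * pi * (of_int n * t)) \<partial>lebesgue_on {0..1}) = (if n = 0 then 1 else 0)"
proof (cases "n = 0")
  case True
  then show ?thesis
    using lebesgue_on_unit_interval by (simp add: measure_def)
next
  case False
  define c where "c = \<i> * complex_of_real (2 * pi * of_int n)"
  have c: "c \<noteq> 0"
    using False by (simp add: c_def)
  have eq: "exp (c * of_real t) = cis (2 * pi * (of_int n * t))" for t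
    by (simp add: c_def cis_conv_exp mult_ac)
  have "((\<lambda>t. exp (c * of_real t)) has_integral (exp (c * of_real 1) / c - exp (c * of_real 0) / c)) {0..1}"
  proof (rule fundamental_theorem_of_calculus)
    fix t :: real
    have "((\<lambda>z. exp (c * z) / c) has_field_derivative exp (c * of_real t)) (at (of_real t))"
      using c by (auto intro!: derivative_eq_intros)
    from has_vector_derivative_real_field[OF this]
    show "((\<lambda>t. exp (c * of_real t) / c) has_vector_derivative exp (c * of_real t)) (at t within {0..1})"
      by simp
  qed simp
  moreover have "exp (c * of_real 1) = 1"
    unfolding eq by simp
  ultimately have "((\<lambda>t. cis (2 * pi * (of_int n * t))) has_integral 0) {0..1}"
    by (simp add: eq)
  then have "integral {0..1} (\<lambda>t. cis (2 * pi * (of_int n * t))) = 0"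
    by (rule integral_unique)
  moreover have "integral\<^sup>L (lebesgue_on {0..1}) (\<lambda>t. cis (2 * pi * (of_int n * t)))
      = integral {0..1} (\<lambda>t. cis (2 * pi * (of_int n * t)))"
    by (intro lebesgue_integral_eq_integral integrable_continuous_unit_interval continuous_intros) auto
  ultimately show ?thesis
    using False by simp
qed

lemma integral_lborel_cis_unit_interval:
  "(\<integral>t. indicat_real {0..1} t *\<^sub>R cis (2 * pi * (of_int n * t)) \<partial>lborel) = (if n = 0 then 1 else 0)"
proof -
  have [measurable]: "(\<lambda>t. cis (2 * pi * (of_int n * t))) \<in> borel_measurable borel"
    by (intro borel_measurable_continuous_onI continuous_intros)
  have "(\<integral>t. indicat_real {0..1} t *\<^sub>R cis (2 * pi * (of_int n * t)) \<partial>lborel)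
      = (\<integral>t. indicat_real {0..1} t *\<^sub>R cis (2 * pi * (of_int n * t)) \<partial>lebesgue)"
    by (rule integral_completion[symmetric]) simp
  also have "\<dots> = (\<integral>t. cis (2 * pi * (of_int n * t)) \<partial>lebesgue_on {0..1})"
    by (simp add: integral_restrict_space)
  finally show ?thesis
    by (simp only: integral_cis_unit_interval)
qed

lemma cis_sum: "finite A \<Longrightarrow> cis (\<Sum>i\<in>A. f i) = (\<Prod>i\<in>A. cis (f i))"
  by (induction A rule: finite_induct) (simp_all flip: cis_mult)

lemma Basis_vec_real: "(Basis :: (real^'d) set) = range (\<lambda>i. axis i 1)"
  by (auto simp: Basis_vec_def)

text \<open>Fubini: both the character and the indicator of the cube factor over the coordinates,
  and a factor with nonzero frequency integrates to 0.\<close>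

lemma integral_torus_char:
  "integral\<^sup>L torus_lebesgue (torus_char k) = (if k = 0 then 1 else 0)" for k :: "int^'d"
proof -
  \<comment> \<open>The product measure behind \<open>lborel\<close> is indexed by basis vectors, so
    the frequency is re-indexed by them; on \<open>Basis\<close> the floor acts on an integer and
    only changes its type.\<close>
  define n where "n = (\<lambda>b::real^'d. \<lfloor>\<Sum>i\<in>UNIV. real_of_int (k $ i) * b $ i\<rfloor>)"
  have n_axis: "n (axis i 1) = k $ i" for i
    by (simp add: n_def axis_def if_distrib cong: if_cong)
  have n: "(\<Sum>i\<in>UNIV. real_of_int (k $ i) * b $ i) = of_int (n b)" if "b \<in> Basis" for b :: "real^'d"
    using that by (auto simp: Basis_vec_real n_def axis_def if_distrib cong: if_cong)
  define g where "g = (\<lambda>b t. indicat_real {0..1} t *\<^sub>R cis (2 * pi * (of_int (n b) * t)))"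
  have [measurable]: "torus_char k \<in> borel_measurable borel"
    by (intro borel_measurable_continuous_onI continuous_intros)
  have [measurable]: "unit_cube \<in> sets (borel :: (real^'d) measure)"
    by (simp add: unit_cube_def)
  have g_int: "integrable lborel (g b)" for b
  proof -
    have "set_integrable lborel {0..1} (\<lambda>t. cis (2 * pi * (of_int (n b) * t)))"
      by (intro borel_integrable_atLeastAtMost' continuous_intros)
    then show ?thesis
      by (simp add: set_integrable_def g_def)
  qed
  have prod: "indicat_real unit_cube (\<Sum>b\<in>Basis. f b *\<^sub>R b) *\<^sub>R torus_char k (\<Sum>b\<in>Basis. f b *\<^sub>R b)
      = (\<Prod>b\<in>Basis. g b (f b))" for f :: "real^'d \<Rightarrow> real"
  proof -
    have "(\<Sum>i\<in>UNIV. real_of_int (k $ i) * (\<Sum>b\<in>Basis. f b *\<^sub>R b) $ i)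
        = (\<Sum>i\<in>UNIV. \<Sum>b\<in>Basis. f b * (real_of_int (k $ i) * b $ i))"
      by (simp add: sum_distrib_left mult_ac)
    also have "\<dots> = (\<Sum>b\<in>Basis. \<Sum>i\<in>UNIV. f b * (real_of_int (k $ i) * b $ i))"
      by (rule sum.swap)
    also have "\<dots> = (\<Sum>b\<in>Basis. of_int (n b) * f b)"
      using n by (intro sum.cong refl) (simp only: sum_distrib_left[symmetric] mult.commute)
    finally have "torus_char k (\<Sum>b\<in>Basis. f b *\<^sub>R b) = (\<Prod>b\<in>Basis. cis (2 * pi * (of_int (n b) * f b)))"
      by (simp add: torus_char_def sum_distrib_left flip: cis_sum)
    moreover have "indicat_real unit_cube (\<Sum>b\<in>Basis. f b *\<^sub>R b :: real^'d) = (\<Prod>b\<in>Basis. indicat_real {0..1} (f b))"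
    proof -
      have "(\<Sum>b\<in>Basis. f b *\<^sub>R b :: real^'d) \<in> unit_cube \<longleftrightarrow> (\<forall>b\<in>Basis. f b \<in> {0..1})"
        by (simp add: unit_cube_def mem_box)
      then show ?thesis
        by (auto simp: indicator_def)
    qed
    ultimately show ?thesis
      by (simp add: g_def scaleR_conv_of_real prod.distrib)
  qed
  interpret product_sigma_finite "\<lambda>b::real^'d. lborel :: real measure"
    by standard
  have "integral\<^sup>L torus_lebesgue (torus_char k)
      = (\<integral>x. indicat_real unit_cube x *\<^sub>R torus_char k x \<partial>lebesgue)"
    unfolding torus_lebesgue_def by (subst integral_restrict_space) auto
  also have "\<dots> = (\<integral>x. indicat_real unit_cube x *\<^sub>R torus_char k x \<partial>lborel)"
    by (rule integral_completion) simp
  also have "\<dots> = (\<integral>f. (\<Prod>b\<in>Basis. g b (f b)) \<partial>(\<Pi>\<^sub>M b\<in>(Basis :: (real^'d) set). lborel))"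
    by (subst lborel_eq, subst integral_distr) (simp_all add: prod)
  also have "\<dots> = (\<Prod>b\<in>(Basis :: (real^'d) set). integral\<^sup>L lborel (g b))"
    by (rule product_integral_prod) (auto simp: g_int)
  also have "\<dots> = (\<Prod>b\<in>(Basis :: (real^'d) set). if n b = 0 then 1 else 0)"
    unfolding g_def integral_lborel_cis_unit_interval by simp
  also have "\<dots> = (if k = 0 then 1 else 0)"
  proof (cases "k = 0")
    case True
    then show ?thesis by (simp add: n_def)
  next
    case False
    then obtain i where i: "k $ i \<noteq> 0"
      by (auto simp: vec_eq_iff)
    then have "\<exists>b\<in>(Basis :: (real^'d) set). n b \<noteq> 0"
      by (intro bexI[of _ "axis i 1"]) (auto simp: n_axis Basis_vec_real)
    then show ?thesis
      using False by (simp add: prod_zero_iff)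
  qed
  finally show ?thesis .
qed

lemma emeasure_torus_lebesgue: "emeasure (torus_lebesgue :: (real^'d) measure) (space torus_lebesgue) = 1"
proof -
  have "emeasure lebesgue (unit_cube :: (real^'d) set) = 1"
    by (simp add: unit_cube_def emeasure_lborel_cbox_eq)
  then show ?thesis
    by (simp add: torus_lebesgue_def emeasure_restrict_space unit_cube_def)
qed

lemma integrable_torus_lebesgue:
  fixes f :: "real^'d \<Rightarrow> 'b::euclidean_space"
  assumes "continuous_on unit_cube f"
  shows "integrable torus_lebesgue f"
  using absolutely_integrable_continuous[of 0 One f] assms
  by (simp add: torus_lebesgue_def unit_cube_def integrable_restrict_space set_integrable_def)

section \<open>Trigonometric polynomials and uniqueness of Fourier coefficients\<close>

inductive trig_poly :: "(real^'d \<Rightarrow> complex) \<Rightarrow> bool" where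
  char: "trig_poly (torus_char k)"
| scale: "trig_poly p \<Longrightarrow> trig_poly (\<lambda>x. c * p x)"
| add: "trig_poly p \<Longrightarrow> trig_poly q \<Longrightarrow> trig_poly (\<lambda>x. p x + q x)"

lemma trig_poly_const: "trig_poly (\<lambda>_. c)"
  using trig_poly.scale[OF trig_poly.char[of 0], of c] by simp

lemma trig_poly_sum: "(\<And>b. b \<in> B \<Longrightarrow> trig_poly (p b)) \<Longrightarrow> trig_poly (\<lambda>x. \<Sum>b\<in>B. p b x)"
  by (induction B rule: infinite_finite_induct) (auto intro: trig_poly_const trig_poly.add)

lemma trig_poly_mult_char: "trig_poly p \<Longrightarrow> trig_poly (\<lambda>x. torus_char k x * p x)"
proof (induction rule: trig_poly.induct)
  case (char j)
  then show ?case
    using trig_poly.char[of "k + j"] by (simp add: torus_char_add[abs_def])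
next
  case (scale p c)
  then show ?case
    using trig_poly.scale[of _ c] by (simp add: mult.left_commute)
next
  case (add p q)
  then show ?case
    by (simp add: distrib_left trig_poly.add)
qed

lemma trig_poly_mult: "trig_poly p \<Longrightarrow> trig_poly q \<Longrightarrow> trig_poly (\<lambda>x. p x * q x)"
proof (induction rule: trig_poly.induct)
  case (char j)
  then show ?case by (rule trig_poly_mult_char)
next
  case (scale p c)
  then show ?case
    using trig_poly.scale[of _ c] by (simp add: mult.assoc)
next
  case (add p q)
  then show ?case
    by (simp add: distrib_right trig_poly.add)
qed

lemma trig_poly_cos_sin:
  "trig_poly (\<lambda>x. complex_of_real (cos (2 * pi * x $ i)))"
  "trig_poly (\<lambda>x. complex_of_real (sin (2 * pi * x $ i)))"
proof -
  have p: "torus_char (axis i 1) x = cis (2 * pi * x $ i)" for x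
    by (simp add: torus_char_def axis_def if_distrib[of real_of_int] if_distrib[of "\<lambda>a. a * _"] cong: if_cong)
  have m: "torus_char (- axis i 1) x = cis (- (2 * pi * x $ i))" for x
    by (simp add: torus_char_def axis_def if_distrib[of real_of_int] if_distrib[of "\<lambda>a. a * _"] sum_negf cong: if_cong)
  have "complex_of_real (cos (2 * pi * x $ i)) = 1 / 2 * torus_char (axis i 1) x + 1 / 2 * torus_char (- axis i 1) x"
    for x by (simp add: p m complex_eq_iff)
  then show "trig_poly (\<lambda>x. complex_of_real (cos (2 * pi * x $ i)))"
    by (simp only:) (intro trig_poly.intros)
  have "complex_of_real (sin (2 * pi * x $ i)) = - \<i> / 2 * torus_char (axis i 1) x + \<i> / 2 * torus_char (- axis i 1) x"
    for x by (simp add: p m complex_eq_iff)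
  then show "trig_poly (\<lambda>x. complex_of_real (sin (2 * pi * x $ i)))"
    by (simp only:) (intro trig_poly.intros)
qed

text \<open>Real linear forms of the embedded point are combinations of cos(2 pi x_i) and sin(2 pi
  x_i), each a combination of two characters; products of characters are characters.\<close>

lemma trig_poly_real_polynomial:
  "real_polynomial_function q \<Longrightarrow> trig_poly (\<lambda>x. complex_of_real (q (torus_embed x)))"
proof (induction rule: real_polynomial_function.induct)
  case (linear h)
  have coord: "trig_poly (\<lambda>x. complex_of_real (torus_embed x \<bullet> b))" if b: "b \<in> Basis" for b :: "complex^'a"
  proof -
    obtain i c where "b = axis i c" "c = 1 \<or> c = \<i>"
      using b by (auto simp: Basis_vec_def Basis_complex_def)
    then show ?thesis
      using trig_poly_cos_sin[of i] by (auto simp: inner_axis torus_embed_def inner_complex_def)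
  qed
  have h: "h (torus_embed x) = (\<Sum>b\<in>Basis. (torus_embed x \<bullet> b) * h b)" for x :: "real^'a"
  proof -
    have "h (torus_embed x) = h (\<Sum>b\<in>Basis. (torus_embed x \<bullet> b) *\<^sub>R b)"
      by (simp add: euclidean_representation)
    then show ?thesis
      using linear by (simp add: linear_sum[OF bounded_linear.linear] linear_cmul[OF bounded_linear.linear])
  qed
  have "trig_poly (\<lambda>x. \<Sum>b\<in>Basis. complex_of_real (h b) * complex_of_real (torus_embed x \<bullet> b))"
    by (intro trig_poly_sum trig_poly.scale coord)
  then show ?case
    by (simp add: h mult.commute)
qed (auto intro: trig_poly_const trig_poly.add trig_poly_mult)

text \<open>A continuous periodic function factors through the embedding as a continuous function on
  a compact set, where polynomials are dense by Stone-Weierstrass.\<close>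

lemma trig_poly_approx:
  fixes u :: "real^'d \<Rightarrow> real"
  assumes u: "torus_periodic u" "continuous_on UNIV u" and e: "0 < e"
  obtains p where "trig_poly p" "\<And>x. cmod (complex_of_real (u x) - p x) < e"
proof -
  define U where "U = (\<lambda>z. u (SOME x. torus_embed x = z))"
  have U: "U (torus_embed x) = u x" for x
  proof -
    have "torus_embed (SOME y. torus_embed y = torus_embed x) = torus_embed x"
      by (rule someI[of _ x]) simp
    \<comment> \<open>On a constant sequence the limit lemma says that points with equal embeddings
      have equal values of u, so the choice of representative is harmless.\<close>
    then have "(\<lambda>n::nat. u x) \<longlonglongrightarrow> U (torus_embed x)"
      unfolding U_def by (intro torus_periodic_tendsto[OF u]) simp
    then show ?thesis
      by (simp add: LIMSEQ_const_iff)
  qed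
  have "continuous_on (range torus_embed) U"
  proof (rule continuous_on_sequentiallyI)
    fix z :: "nat \<Rightarrow> complex^'d" and y
    assume z: "\<forall>n. z n \<in> range torus_embed" and y: "y \<in> range torus_embed" and lim: "z \<longlonglongrightarrow> y"
    have "\<forall>n. \<exists>x. z n = torus_embed x"
      using z by blast
    then obtain a where a: "\<And>n. z n = torus_embed (a n)"
      by metis
    obtain b where b: "y = torus_embed b"
      using y by blast
    have "(\<lambda>n. u (a n)) \<longlonglongrightarrow> u b"
      using lim by (intro torus_periodic_tendsto[OF u]) (simp add: a b flip: a)
    then show "(\<lambda>n. U (z n)) \<longlonglongrightarrow> U y"
      by (simp add: a b U)
  qed
  then obtain q where q: "real_polynomial_function q"
    "\<And>z. z \<in> range (torus_embed :: real^'d \<Rightarrow> _) \<Longrightarrow> \<bar>U z - q z\<bar> < e"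
    using Stone_Weierstrass_real_polynomial_function[OF compact_range_torus_embed _ e] by metis
  show thesis
  proof (rule that[OF trig_poly_real_polynomial[OF q(1)]])
    fix x :: "real^'d"
    have "\<bar>u x - q (torus_embed x)\<bar> < e"
      using q(2)[of "torus_embed x"] by (simp add: U)
    then show "cmod (complex_of_real (u x) - complex_of_real (q (torus_embed x))) < e"
      by (metis norm_of_real of_real_diff real_norm_def)
  qed
qed

lemma trig_poly_approx_complex:
  fixes g :: "real^'d \<Rightarrow> complex"
  assumes g: "torus_periodic g" "continuous_on UNIV g" and e: "0 < e"
  obtains p where "trig_poly p" "\<And>x. cmod (g x - p x) < e"
proof -
  have re: "torus_periodic (\<lambda>x. Re (g x))" "continuous_on UNIV (\<lambda>x. Re (g x))"
    and im: "torus_periodic (\<lambda>x. Im (g x))" "continuous_on UNIV (\<lambda>x. Im (g x))"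
    using g(1) by (auto simp: torus_periodic_def intro!: continuous_intros g(2))
  have e2: "0 < e / 2" using e by simp
  obtain p1 where p1: "trig_poly p1" "\<And>x. cmod (complex_of_real (Re (g x)) - p1 x) < e / 2"
    using trig_poly_approx[OF re e2] by metis
  obtain p2 where p2: "trig_poly p2" "\<And>x. cmod (complex_of_real (Im (g x)) - p2 x) < e / 2"
    using trig_poly_approx[OF im e2] by metis
  show thesis
  proof (rule that)
    show "trig_poly (\<lambda>x. p1 x + \<i> * p2 x)"
      by (intro trig_poly.add trig_poly.scale p1 p2)
    fix x
    have "g x - (p1 x + \<i> * p2 x) = (complex_of_real (Re (g x)) - p1 x) + \<i> * (complex_of_real (Im (g x)) - p2 x)"
      using complex_eq[of "g x"] by (simp add: algebra_simps)
    also have "cmod \<dots> \<le> cmod (complex_of_real (Re (g x)) - p1 x) + cmod (\<i> * (complex_of_real (Im (g x)) - p2 x))"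
      by (rule norm_triangle_ineq)
    also have "\<dots> < e"
      using p1(2)[of x] p2(2)[of x] by (simp add: norm_mult)
    finally show "cmod (g x - (p1 x + \<i> * p2 x)) < e" .
  qed
qed

lemma trig_poly_continuous: "trig_poly p \<Longrightarrow> continuous_on S p"
  by (induction rule: trig_poly.induct) (auto intro!: continuous_intros)

lemma integral_mult_trig_poly_eq_0:
  fixes g :: "real^'d \<Rightarrow> complex"
  assumes "continuous_on UNIV g" "\<And>k. (\<integral>x. g x * torus_char k x \<partial>torus_lebesgue) = 0" "trig_poly p"
  shows "(\<integral>x. g x * p x \<partial>torus_lebesgue) = 0"
  using assms(3)
proof (induction rule: trig_poly.induct)
  case (scale p c)
  have "(\<integral>x. g x * (c * p x) \<partial>torus_lebesgue) = (\<integral>x. c * (g x * p x) \<partial>torus_lebesgue)"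
    by (simp add: mult.left_commute)
  then show ?case
    using scale by simp
next
  case (add p q)
  have "integrable torus_lebesgue (\<lambda>x. g x * p x)" "integrable torus_lebesgue (\<lambda>x. g x * q x)"
    by (intro integrable_torus_lebesgue continuous_on_mult trig_poly_continuous add(1,2)
        continuous_on_subset[OF assms(1)] subset_UNIV)+
  then show ?case
    using add by (simp add: distrib_left)
qed (simp add: assms(2))

text \<open>Such a g is orthogonal to all trigonometric polynomials; approximating its conjugate by
  them makes the integral of |g|^2 arbitrarily small, and continuity turns a vanishing integral into
  vanishing at every point.\<close>

lemma fourier_uniqueness:
  fixes g :: "real^'d \<Rightarrow> complex"
  assumes g: "torus_periodic g" "continuous_on UNIV g"
    and zero: "\<And>k. (\<integral>x. g x * torus_char k x \<partial>torus_lebesgue) = 0"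
  shows "g x = 0"
proof -
  obtain G where G: "0 \<le> G" "\<And>x. cmod (g x) \<le> G"
    using bounded_torus_periodic[OF g] by blast
  define I where "I = (\<integral>x. (cmod (g x))\<^sup>2 \<partial>torus_lebesgue)"
  have cont: "continuous_on S g" for S
    using g(2) by (rule continuous_on_subset) simp
  have cnj: "torus_periodic (\<lambda>x. cnj (g x))" "continuous_on UNIV (\<lambda>x. cnj (g x))"
    using g(1) by (auto simp: torus_periodic_def intro!: continuous_intros g(2))
  have le: "\<bar>I\<bar> \<le> G * e" if e: "0 < e" for e
  proof -
    obtain p where p: "trig_poly p" "\<And>x. cmod (cnj (g x) - p x) < e"
      using trig_poly_approx_complex[OF cnj e] by metis
    have "complex_of_real I = (\<integral>x. g x * cnj (g x) \<partial>torus_lebesgue)"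
      unfolding I_def by (simp flip: integral_complex_of_real complex_norm_square)
    also have "\<dots> = (\<integral>x. g x * cnj (g x) \<partial>torus_lebesgue) - (\<integral>x. g x * p x \<partial>torus_lebesgue)"
      by (simp add: integral_mult_trig_poly_eq_0[OF g(2) zero p(1)])
    also have "\<dots> = (\<integral>x. g x * cnj (g x) - g x * p x \<partial>torus_lebesgue)"
      by (intro Bochner_Integration.integral_diff[symmetric] integrable_torus_lebesgue
          continuous_on_mult continuous_on_cnj cont trig_poly_continuous[OF p(1)])
    also have "\<dots> = (\<integral>x. g x * (cnj (g x) - p x) \<partial>torus_lebesgue)"
      by (simp add: right_diff_distrib)
    finally have "\<bar>I\<bar> = cmod (\<integral>x. g x * (cnj (g x) - p x) \<partial>torus_lebesgue)"
      by (metis norm_of_real real_norm_def)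
    also have "\<dots> \<le> (\<integral>x. cmod (g x * (cnj (g x) - p x)) \<partial>torus_lebesgue)"
      by (rule integral_norm_bound)
    also have "\<dots> \<le> (\<integral>x. G * e \<partial>(torus_lebesgue :: (real^'d) measure))"
    proof (rule integral_mono)
      show "integrable torus_lebesgue (\<lambda>x. cmod (g x * (cnj (g x) - p x)))"
        by (intro integrable_torus_lebesgue continuous_on_norm continuous_on_mult continuous_on_diff
          continuous_on_cnj cont trig_poly_continuous[OF p(1)])
      show "integrable torus_lebesgue (\<lambda>x::real^'d. G * e)"
        by (intro integrable_torus_lebesgue continuous_on_const)
      show "cmod (g x * (cnj (g x) - p x)) \<le> G * e" for x
        using G p(2)[of x] e by (auto simp: norm_mult intro!: mult_mono)
    qed
    also have "\<dots> = G * e"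
      using emeasure_torus_lebesgue[where 'd='d] by (simp add: measure_def)
    finally show ?thesis .
  qed
  have "I = 0"
  proof (rule ccontr)
    assume "I \<noteq> 0"
    \<comment> \<open>Chosen so that G e is at most half of |I|; \<open>G + 1\<close> avoids a
      division by 0 when the bound G is 0.\<close>
    then have pos: "0 < \<bar>I\<bar> / (2 * (G + 1))"
      using G(1) by simp
    have "\<bar>I\<bar> \<le> G * (\<bar>I\<bar> / (2 * (G + 1)))"
      by (rule le[OF pos])
    also have "\<dots> \<le> (G + 1) * (\<bar>I\<bar> / (2 * (G + 1)))"
      using pos by (intro mult_right_mono) auto
    also have "\<dots> = \<bar>I\<bar> / 2"
      using G(1) by (simp add: divide_simps)
    finally show False
      using \<open>I \<noteq> 0\<close> by simp
  qed
  moreover have "I = integral unit_cube (\<lambda>x. (cmod (g x))\<^sup>2)"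
  proof -
    have "integrable torus_lebesgue (\<lambda>x. (cmod (g x))\<^sup>2)"
      by (intro integrable_torus_lebesgue continuous_on_power continuous_on_norm cont)
    then show ?thesis
      unfolding I_def torus_lebesgue_def by (intro lebesgue_integral_eq_integral) (simp_all add: unit_cube_def)
  qed
  ultimately have "integral (cbox 0 One) (\<lambda>x. (cmod (g x))\<^sup>2) = 0"
    by (simp add: unit_cube_def)
  moreover have "continuous_on (cbox 0 One) (\<lambda>x. (cmod (g x))\<^sup>2)"
    by (intro continuous_on_power continuous_on_norm cont)
  moreover have "box 0 (One :: real^'d) \<noteq> {}"
    by (simp add: box_ne_empty)
  ultimately have "\<forall>x\<in>unit_cube. (cmod (g x))\<^sup>2 = 0"
    unfolding unit_cube_def by (subst (asm) integral_cbox_eq_0_iff) simp_all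
  then show ?thesis
    using torus_proj_in_cube[of x] torus_periodic_proj[OF g(1), of x] by simp
qed

text \<open>Unordered sums converge along the net of finite subsets rather than along a sequence, so
  the exchange rests on uniform convergence (Weierstrass M-test); unit mass turns a uniform error
  into the same error of the integrals.\<close>

lemma has_sum_integral:
  fixes c :: "'i \<Rightarrow> complex" and h :: "'i \<Rightarrow> 'a \<Rightarrow> complex"
  assumes M: "emeasure M (space M) = 1" and c: "(\<lambda>i. cmod (c i)) summable_on A"
    and h: "\<And>i. i \<in> A \<Longrightarrow> integrable M (h i)" "\<And>i x. cmod (h i x) \<le> 1"
    and H: "\<And>x. x \<in> space M \<Longrightarrow> ((\<lambda>i. c i * h i x) has_sum H x) A" "integrable M H"
  shows "((\<lambda>i. c i * integral\<^sup>L M (h i)) has_sum integral\<^sup>L M H) A"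
proof -
  interpret finite_measure M
    by standard (simp add: M)
  have "uniform_limit (space M) (\<lambda>F x. \<Sum>i\<in>F. c i * h i x) H (finite_subsets_at_top A)"
    by (rule Weierstrass_m_test_general'[OF _ H(1) c]) (simp_all add: norm_mult h(2) mult_left_le)
  note unif = uniform_limitD[OF this]
  show ?thesis
    unfolding has_sum_def
  proof (rule tendstoI)
    fix e :: real assume e: "0 < e"
    then have "\<forall>\<^sub>F F in finite_subsets_at_top A. \<forall>x\<in>space M. dist (\<Sum>i\<in>F. c i * h i x) (H x) < e / 2"
      by (intro unif) simp
    moreover have "\<forall>\<^sub>F F in finite_subsets_at_top A. finite F \<and> F \<subseteq> A"
      by (rule eventually_finite_subsets_at_top_weakI) auto
    ultimately show "\<forall>\<^sub>F F in finite_subsets_at_top A.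
        dist (\<Sum>i\<in>F. c i * integral\<^sup>L M (h i)) (integral\<^sup>L M H) < e"
    proof eventually_elim
      case (elim F)
      have int: "integrable M (\<lambda>x. c i * h i x)" if "i \<in> F" for i
        using elim that by (intro integrable_mult_right h(1)) auto
      have "(\<Sum>i\<in>F. c i * integral\<^sup>L M (h i)) = (\<integral>x. (\<Sum>i\<in>F. c i * h i x) \<partial>M)"
        using int by (subst Bochner_Integration.integral_sum) auto
      then have "dist (\<Sum>i\<in>F. c i * integral\<^sup>L M (h i)) (integral\<^sup>L M H)
          = cmod (\<integral>x. (\<Sum>i\<in>F. c i * h i x) - H x \<partial>M)"
        using int H(2) by (subst Bochner_Integration.integral_diff) (auto simp: dist_norm)
      also have "\<dots> \<le> (\<integral>x. cmod ((\<Sum>i\<in>F. c i * h i x) - H x) \<partial>M)"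
        by (rule integral_norm_bound)
      also have "\<dots> \<le> (\<integral>x. e / 2 \<partial>M)"
        using elim int H(2) by (intro integral_mono) (auto simp: dist_norm less_imp_le)
      also have "\<dots> < e"
        using M e by (simp add: measure_def)
      finally show ?case .
    qed
  qed
qed

text \<open>Convergence to f is demanded at every point because the series is going to be integrated
  along a curve.\<close>

definition Hs_expansion :: "real \<Rightarrow> real \<Rightarrow> (int^'d \<Rightarrow> complex) \<Rightarrow> (real^'d \<Rightarrow> real) \<Rightarrow> bool" where
  "Hs_expansion s A a f \<longleftrightarrow> Hs_bounded s A a
     \<and> (\<forall>x. ((\<lambda>k. a k * torus_char k x) has_sum complex_of_real (f x)) UNIV)"

lemma Hs_bounded_summable:
  fixes a :: "int^'d \<Rightarrow> complex"
  assumes "real CARD('d) < 2 * s" "Hs_bounded s A a"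
  shows "(\<lambda>k. cmod (a k)) summable_on UNIV"
  using Hs_bounded_sum_le[OF assms]
  by (intro nonneg_bdd_above_summable_on bdd_aboveI2[where M = "A * sqrt (lattice_zeta TYPE('d) s)"]) auto

lemma in_Hs_bounded:
  assumes "in_Hs s f"
  shows "Hs_bounded s (Hs_norm s f) (fourier_coeff f)"
proof -
  have nonneg: "0 \<le> sobolev_weight s k * (cmod (fourier_coeff f k))\<^sup>2" for k
    by (intro mult_nonneg_nonneg less_imp_le[OF sobolev_weight_pos]) simp
  then have inf: "0 \<le> (\<Sum>\<^sub>\<infinity>k. sobolev_weight s k * (cmod (fourier_coeff f k))\<^sup>2)"
    by (intro infsum_nonneg)
  show ?thesis
    unfolding Hs_bounded_def Hs_norm_def real_sqrt_pow2[OF inf]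
    using assms nonneg inf by (auto simp: in_Hs_def intro!: finite_sum_le_infsum)
qed

text \<open>Summable coefficients make the Fourier series a continuous periodic function;
  integrating it term by term shows that it has the coefficients of f, and uniqueness identifies the
  two at every point.\<close>

lemma in_Hs_expansion:
  fixes f :: "real^'d \<Rightarrow> real"
  assumes s: "real CARD('d) < 2 * s" and f: "torus_periodic f" "continuous_on UNIV f" and Hs: "in_Hs s f"
  shows "Hs_expansion s (Hs_norm s f) (fourier_coeff f) f"
proof -
  define a where "a = fourier_coeff f"
  have sum: "(\<lambda>k. cmod (a k)) summable_on UNIV"
    unfolding a_def by (rule Hs_bounded_summable[OF s in_Hs_bounded[OF Hs]])
  define F where "F = (\<lambda>x. \<Sum>\<^sub>\<infinity>k. a k * torus_char k x)"
  have F: "((\<lambda>k. a k * torus_char k x) has_sum F x) UNIV" for x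
    unfolding F_def by (rule has_sum_infsum, rule abs_summable_summable) (simp add: norm_mult sum)
  have "uniform_limit UNIV (\<lambda>S x. \<Sum>k\<in>S. a k * torus_char k x) F (finite_subsets_at_top UNIV)"
    by (rule Weierstrass_m_test_general'[OF _ F sum]) (simp add: norm_mult)
  then have contF: "continuous_on UNIV F"
    by (rule uniform_limit_theorem[rotated]) (auto intro!: always_eventually continuous_intros)
  have perF: "torus_periodic F"
    unfolding torus_periodic_def F_def
  proof (intro allI ballI infsum_cong)
    fix x m :: "real^'d" and k
    assume "m \<in> int_vecs"
    then show "a k * torus_char k (x + m) = a k * torus_char k x"
      using torus_periodic_char[of k] by (simp add: torus_periodic_def)
  qed
  have contf: "continuous_on UNIV (\<lambda>x. complex_of_real (f x))"
    by (intro continuous_intros f(2))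
  have cont: "continuous_on S F" "continuous_on S (\<lambda>x. complex_of_real (f x))" for S
    using contF contf by (auto intro: continuous_on_subset)
  have coeff: "(\<integral>x. F x * torus_char j x \<partial>torus_lebesgue) = a (- j)" for j
  proof -
    have "((\<lambda>k. a k * (\<integral>x. torus_char (k + j) x \<partial>torus_lebesgue))
        has_sum (\<integral>x. F x * torus_char j x \<partial>torus_lebesgue)) UNIV"
    proof (rule has_sum_integral[OF emeasure_torus_lebesgue sum])
      show "((\<lambda>k. a k * torus_char (k + j) x) has_sum F x * torus_char j x) UNIV" for x
        using has_sum_cmult_left[OF F[of x], of "torus_char j x"] by (simp add: torus_char_add mult.assoc)
      show "integrable torus_lebesgue (\<lambda>x. F x * torus_char j x)"
        by (intro integrable_torus_lebesgue continuous_on_mult cont continuous_on_torus_char)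
      show "integrable torus_lebesgue (torus_char (k + j))" for k
        by (intro integrable_torus_lebesgue continuous_on_torus_char)
    qed simp
    moreover have "((\<lambda>k. a k * (\<integral>x. torus_char (k + j) x \<partial>torus_lebesgue)) has_sum a (- j)) UNIV"
    proof (rule has_sum_finite_neutralI[of "{- j}"])
      show "a k * (\<integral>x. torus_char (k + j) x \<partial>torus_lebesgue) = 0" if "k \<in> UNIV - {- j}" for k
        using that by (auto simp: integral_torus_char add_eq_0_iff2)
    qed (auto simp: emeasure_torus_lebesgue measure_def)
    ultimately show ?thesis
      by (rule has_sum_unique)
  qed
  have "F x - complex_of_real (f x) = 0" for x
  proof (rule fourier_uniqueness[of "\<lambda>x. F x - complex_of_real (f x)"])
    show "torus_periodic (\<lambda>x. F x - complex_of_real (f x))"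
      using perF f(1) by (simp add: torus_periodic_def)
    show "continuous_on UNIV (\<lambda>x. F x - complex_of_real (f x))"
      by (intro continuous_on_diff cont)
    fix k
    have "(\<integral>x. (F x - complex_of_real (f x)) * torus_char k x \<partial>torus_lebesgue)
        = (\<integral>x. F x * torus_char k x \<partial>torus_lebesgue) - (\<integral>x. complex_of_real (f x) * torus_char k x \<partial>torus_lebesgue)"
      unfolding left_diff_distrib
      by (intro Bochner_Integration.integral_diff integrable_torus_lebesgue continuous_on_mult cont
          continuous_on_torus_char)
    then show "(\<integral>x. (F x - complex_of_real (f x)) * torus_char k x \<partial>torus_lebesgue) = 0"
      by (simp add: coeff a_def fourier_coeff_eq)
  qed
  then show ?thesis
    using F in_Hs_bounded[OF Hs] by (simp add: Hs_expansion_def a_def)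
qed

text \<open>Taking 1 as a factor in the quadrature estimate measures how far the mean of the density
  along the geodesic is from 1.\<close>

lemma Hs_expansion_one:
  "Hs_expansion s (sqrt (sobolev_weight s (0 :: int^'d))) (\<lambda>k. if k = 0 then 1 else 0) (\<lambda>_ :: real^'d. 1)"
proof -
  have "(\<Sum>k\<in>F. sobolev_weight s k * (cmod (if k = 0 then 1 else 0))\<^sup>2) \<le> sobolev_weight s (0 :: int^'d)"
    if "finite F" for F :: "(int^'d) set"
  proof -
    have "(\<Sum>k\<in>F. sobolev_weight s k * (cmod (if k = 0 then 1 else 0))\<^sup>2)
        = (\<Sum>k\<in>F. if k = 0 then sobolev_weight s k else 0)"
      by (intro sum.cong) auto
    also have "\<dots> \<le> sobolev_weight s (0 :: int^'d)"
      using that less_imp_le[OF sobolev_weight_pos[of s "0 :: int^'d"]] by simp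
    finally show ?thesis .
  qed
  then have "Hs_bounded s (sqrt (sobolev_weight s (0 :: int^'d))) (\<lambda>k :: int^'d. if k = 0 then 1 else 0)"
    using less_imp_le[OF sobolev_weight_pos[of s "0 :: int^'d"]] by (simp add: Hs_bounded_def)
  moreover have "((\<lambda>k. (if k = 0 then 1 else 0) * torus_char k x) has_sum complex_of_real 1) UNIV" for x :: "real^'d"
    by (rule has_sum_finite_neutralI[of "{0}"]) auto
  ultimately show ?thesis
    by (simp add: Hs_expansion_def)
qed

text \<open>The double series stays indexed by pairs: collecting the terms with equal j + l would
  call for estimates of the convolved coefficients.\<close>

lemma Hs_expansion_product:
  fixes f g :: "real^'d \<Rightarrow> real"
  assumes s: "real CARD('d) < 2 * s" and f: "Hs_expansion s A a f" and g: "Hs_expansion s B b g"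
  shows "(\<lambda>(j, l). cmod (a j * b l)) summable_on UNIV"
    and "((\<lambda>(j, l). a j * b l * torus_char (j + l) x) has_sum complex_of_real (f x * g x)) UNIV"
proof -
  have a: "(\<lambda>k. cmod (a k)) summable_on UNIV" and b: "(\<lambda>k. cmod (b k)) summable_on UNIV"
    using Hs_bounded_summable[OF s] f g by (auto simp: Hs_expansion_def)
  have "(\<lambda>(j, l). cmod (a j * b l)) summable_on Sigma UNIV (\<lambda>_. UNIV)"
  proof (rule summable_on_SigmaI)
    show "((\<lambda>l. case (j, l) of (j, l) \<Rightarrow> cmod (a j * b l)) has_sum cmod (a j) * (\<Sum>\<^sub>\<infinity>l. cmod (b l))) UNIV" for j
      using has_sum_cmult_right[OF has_sum_infsum[OF b], of "cmod (a j)"] by (simp add: norm_mult)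
    show "(\<lambda>j. cmod (a j) * (\<Sum>\<^sub>\<infinity>l. cmod (b l))) summable_on UNIV"
      by (rule summable_on_cmult_left[OF a])
  qed auto
  then show sum: "(\<lambda>(j, l). cmod (a j * b l)) summable_on UNIV"
    by simp
  have "((\<lambda>(j, l). a j * b l * torus_char (j + l) x) has_sum complex_of_real (f x) * complex_of_real (g x))
      (Sigma UNIV (\<lambda>_. UNIV))"
  proof (rule has_sum_SigmaI)
    show "((\<lambda>l. case (j, l) of (j, l) \<Rightarrow> a j * b l * torus_char (j + l) x)
        has_sum a j * torus_char j x * complex_of_real (g x)) UNIV" for j
      using has_sum_cmult_right[of "\<lambda>l. b l * torus_char l x" UNIV "complex_of_real (g x)" "a j * torus_char j x"] g
      by (simp add: Hs_expansion_def torus_char_add mult_ac)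
    show "((\<lambda>j. a j * torus_char j x * complex_of_real (g x)) has_sum complex_of_real (f x) * complex_of_real (g x)) UNIV"
      using f by (intro has_sum_cmult_left) (simp add: Hs_expansion_def)
    show "(\<lambda>(j, l). a j * b l * torus_char (j + l) x) summable_on (SIGMA j:UNIV. UNIV)"
      by (rule abs_summable_summable) (use sum in \<open>simp add: norm_mult case_prod_unfold\<close>)
  qed
  then show "((\<lambda>(j, l). a j * b l * torus_char (j + l) x) has_sum complex_of_real (f x * g x)) UNIV"
    by simp
qed

section \<open>Quadrature along the closed geodesic\<close>

definition geodesic :: "int \<Rightarrow> real \<Rightarrow> real^'d" where
  "geodesic N t = (\<chi> i. t * of_int (power_vec N $ i))"

lemma continuous_on_geodesic [continuous_intros]: "continuous_on S (geodesic N)"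
  unfolding geodesic_def by (intro continuous_intros)

lemma torus_char_geodesic: "torus_char k (geodesic N t) = cis (2 * pi * (of_int (int_dot k (power_vec N)) * t))"
  by (simp add: torus_char_def geodesic_def int_dot_def sum_distrib_left mult_ac)

text \<open>Both integrals are expanded over the same pairs. The character of j + l integrates to 1
  on the geodesic when its inner product with the direction is 0, but on the torus only when j + l =
  0; the difference retains exactly the resonant pairs.\<close>

lemma geodesic_quadrature_error:
  fixes f g :: "real^'d \<Rightarrow> real"
  assumes s: "real CARD('d) < 2 * s" and N: "N \<ge> 1"
    and f: "Hs_expansion s A a f" and g: "Hs_expansion s B b g"
    and cont: "continuous_on UNIV f" "continuous_on UNIV g"
  shows "\<bar>(\<integral>t. f (geodesic N t) * g (geodesic N t) \<partial>lebesgue_on {0..1})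
      - (\<integral>x. f x * g x \<partial>torus_lebesgue)\<bar> \<le> 2 * A * B * lattice_zeta TYPE('d) s * (6 / N) powr s"
proof -
  define c where "c = (\<lambda>(j, l). a j * b l)"
  define R where "R = {(j, l). j + l \<in> (resonant N :: (int^'d) set)}"
  have sum: "(\<lambda>p. cmod (c p)) summable_on UNIV"
    using Hs_expansion_product(1)[OF s f g] by (simp add: c_def case_prod_unfold)
  have exp: "((\<lambda>p. c p * torus_char (fst p + snd p) x) has_sum complex_of_real (f x * g x)) UNIV" for x
    using Hs_expansion_product(2)[OF s f g, of x] by (simp add: c_def case_prod_unfold)
  have cfg: "continuous_on S (\<lambda>x. complex_of_real (f x * g x))" for S
    by (intro continuous_on_of_real continuous_on_mult continuous_on_subset[OF cont(1)]
        continuous_on_subset[OF cont(2)]) auto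
  have cfgN: "continuous_on S (\<lambda>t. complex_of_real (f (geodesic N t) * g (geodesic N t)))" for S
    by (rule continuous_on_compose2[OF cfg[of UNIV] continuous_on_geodesic]) auto
  have I1: "((\<lambda>p. c p * (\<integral>t. torus_char (fst p + snd p) (geodesic N t) \<partial>lebesgue_on {0..1}))
      has_sum (\<integral>t. complex_of_real (f (geodesic N t) * g (geodesic N t)) \<partial>lebesgue_on {0..1})) UNIV"
    by (rule has_sum_integral[OF lebesgue_on_unit_interval sum])
      (auto intro!: integrable_continuous_unit_interval exp cfgN simp del: of_real_mult
        intro: continuous_on_compose2[OF continuous_on_torus_char[of UNIV] continuous_on_geodesic])
  have I2: "((\<lambda>p. c p * (\<integral>x. torus_char (fst p + snd p) x \<partial>torus_lebesgue))
      has_sum (\<integral>x. complex_of_real (f x * g x) \<partial>torus_lebesgue)) UNIV"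
    by (rule has_sum_integral[OF emeasure_torus_lebesgue sum])
      (auto intro!: integrable_torus_lebesgue exp cfg continuous_on_torus_char simp del: of_real_mult)
  have coeff: "c p * (\<integral>t. torus_char (fst p + snd p) (geodesic N t) \<partial>lebesgue_on {0..1})
      - c p * (\<integral>x. torus_char (fst p + snd p) x \<partial>torus_lebesgue) = (if p \<in> R then c p else 0)" for p
  proof -
    have "int_dot 0 (power_vec N :: int^'d) = 0"
      by (simp add: int_dot_def)
    then show ?thesis
      unfolding torus_char_geodesic integral_cis_unit_interval integral_torus_char
      by (auto simp: R_def resonant_def case_prod_unfold)
  qed
  let ?I = "(\<integral>t. f (geodesic N t) * g (geodesic N t) \<partial>lebesgue_on {0..1}) - (\<integral>x. f x * g x \<partial>torus_lebesgue)"
  have "((\<lambda>p. if p \<in> R then c p else 0) has_sum complex_of_real ?I) UNIV"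
    using has_sum_add[OF I1 has_sum_uminusI[OF I2]]
    unfolding add_uminus_conv_diff coeff integral_complex_of_real by simp
  moreover have "((\<lambda>p. if p \<in> R then c p else 0) has_sum complex_of_real ?I) UNIV
      \<longleftrightarrow> (c has_sum complex_of_real ?I) R"
    by (rule has_sum_cong_neutral) auto
  ultimately have hs: "(c has_sum complex_of_real ?I) R"
    by simp
  have sumR: "(\<lambda>p. cmod (c p)) summable_on R"
    using sum by (rule summable_on_subset_banach) simp
  have "cmod (complex_of_real ?I) \<le> (\<Sum>\<^sub>\<infinity>p\<in>R. cmod (c p))"
    by (rule norm_infsum_le[OF hs has_sum_infsum[OF sumR]]) simp
  also have "\<dots> \<le> 2 * A * B * lattice_zeta TYPE('d) s * (6 / N) powr s"
  proof (rule infsum_le_finite_sums[OF sumR])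
    fix T assume T: "finite T" "T \<subseteq> R"
    have "(\<Sum>p\<in>T. cmod (c p)) = (\<Sum>(j, l)\<in>T. cmod (a j) * cmod (b l))"
      by (intro sum.cong) (auto simp: c_def norm_mult)
    also have "\<dots> \<le> 2 * A * B * lattice_zeta TYPE('d) s * (6 / N) powr s"
      using f g T by (intro sum_resonant_pairs[OF s N]) (auto simp: Hs_expansion_def R_def)
    finally show "(\<Sum>p\<in>T. cmod (c p)) \<le> 2 * A * B * lattice_zeta TYPE('d) s * (6 / N) powr s" .
  qed
  finally show ?thesis
    by (simp only: norm_of_real)
qed

section \<open>Unweighted curves along a geodesic\<close>

text \<open>Reparametrising by the normalised antiderivative of the weight turns a weighted curve measure
  into an unweighted one.\<close>

lemma weight_reparametrization:
  fixes g :: "real \<Rightarrow> real"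
  assumes g: "continuous_on {0..1} g" and m: "0 < m"
    and bounds: "\<And>t. t \<in> {0..1} \<Longrightarrow> m \<le> g t \<and> g t \<le> M"
  obtains \<sigma> where "\<sigma> 0 = 0" "\<sigma> 1 = 1" "\<And>u. u \<in> {0..1} \<Longrightarrow> \<sigma> u \<in> {0..1}"
    "\<And>u v. u \<in> {0..1} \<Longrightarrow> v \<in> {0..1} \<Longrightarrow> \<bar>\<sigma> u - \<sigma> v\<bar> \<le> M / m * \<bar>u - v\<bar>"
    "\<And>F :: real \<Rightarrow> real. continuous_on {0..1} F \<Longrightarrow>
      integral {0..1} (\<lambda>u. F (\<sigma> u)) = integral {0..1} (\<lambda>t. g t * F t) / integral {0..1} g"
proof -
  define Z where "Z = integral {0..1} g"
  define h where "h = (\<lambda>t. integral {0..t} g / Z)"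
  have int: "g integrable_on {a..b}" if "0 \<le> a" "b \<le> 1" for a b
    using that by (intro integrable_continuous_real continuous_on_subset[OF g]) auto
  have int_bounds: "m * (b - a) \<le> integral {a..b} g \<and> integral {a..b} g \<le> M * (b - a)"
    if "0 \<le> a" "a \<le> b" "b \<le> 1" for a b
  proof -
    have "integral {a..b} (\<lambda>_. m) \<le> integral {a..b} g" "integral {a..b} g \<le> integral {a..b} (\<lambda>_. M)"
      using that bounds by (intro integral_le int integrable_const_ivl; simp)+
    then show ?thesis
      using that by (simp add: mult.commute)
  qed
  have Z: "m \<le> Z" "Z \<le> M"
    using int_bounds[of 0 1] by (simp_all add: Z_def)
  have Z0: "0 < Z"
    using Z m by simp
  have h_mono: "m / Z * (t - r) \<le> h t - h r" if "0 \<le> r" "r \<le> t" "t \<le> 1" for r t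
  proof -
    have "integral {0..r} g + integral {r..t} g = integral {0..t} g"
      using that by (intro Henstock_Kurzweil_Integration.integral_combine int) auto
    then have "h t - h r = integral {r..t} g / Z"
      by (simp add: h_def add_divide_distrib flip: diff_divide_distrib)
    also have "\<dots> \<ge> m * (t - r) / Z"
      using int_bounds[of r t] that Z0 by (intro divide_right_mono) auto
    finally show ?thesis by simp
  qed
  have h_expand: "m / Z * \<bar>t - r\<bar> \<le> \<bar>h t - h r\<bar>" if "r \<in> {0..1}" "t \<in> {0..1}" for r t
    using h_mono[of r t] h_mono[of t r] that by (cases "r \<le> t") auto
  have h01: "h 0 = 0" "h 1 = 1"
    using Z0 by (simp_all add: h_def Z_def)
  have deriv: "(h has_field_derivative g t / Z) (at t within {0..1})" if "t \<in> {0..1}" for t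
    unfolding h_def by (intro DERIV_cdivide integral_has_real_derivative[OF g that])
  have h_cont: "continuous_on {0..1} h"
    using deriv by (intro DERIV_continuous_on) auto
  have h_range: "h t \<in> {0..1}" if "t \<in> {0..1}" for t
  proof -
    have "0 \<le> m / Z * t" "0 \<le> m / Z * (1 - t)"
      using that m Z0 by simp_all
    then show ?thesis
      using h_mono[of 0 t] h_mono[of t 1] that by (simp add: h01)
  qed
  \<comment> \<open>The intermediate value theorem yields a right inverse of h;
    \<open>h_expand\<close> then makes it Lipschitz and a left inverse as well.\<close>
  have "\<exists>t\<in>{0..1}. h t = u" if "u \<in> {0..1}" for u
    using IVT'[of h 0 u 1] h_cont that by (auto simp: h01)
  then obtain \<sigma> where \<sigma>: "\<And>u. u \<in> {0..1} \<Longrightarrow> \<sigma> u \<in> {0..1}" "\<And>u. u \<in> {0..1} \<Longrightarrow> h (\<sigma> u) = u"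
    by metis
  have lip: "\<bar>\<sigma> u - \<sigma> v\<bar> \<le> M / m * \<bar>u - v\<bar>" if "u \<in> {0..1}" "v \<in> {0..1}" for u v
  proof -
    have "m / Z * \<bar>\<sigma> u - \<sigma> v\<bar> \<le> \<bar>u - v\<bar>"
      using h_expand[OF \<sigma>(1)[OF that(2)] \<sigma>(1)[OF that(1)]] that by (simp add: \<sigma>(2))
    then have "\<bar>\<sigma> u - \<sigma> v\<bar> \<le> Z / m * \<bar>u - v\<bar>"
      using m Z0 by (simp add: field_simps)
    also have "\<dots> \<le> M / m * \<bar>u - v\<bar>"
      using Z m by (intro mult_right_mono divide_right_mono) auto
    finally show ?thesis .
  qed
  have \<sigma>h: "\<sigma> (h t) = t" if "t \<in> {0..1}" for t
  proof -
    have "m / Z * \<bar>\<sigma> (h t) - t\<bar> \<le> \<bar>h (\<sigma> (h t)) - h t\<bar>"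
      using h_expand[OF that \<sigma>(1)[OF h_range[OF that]]] .
    also have "\<dots> = 0"
      using \<sigma>(2)[OF h_range[OF that]] by simp
    finally have "\<not> 0 < m / Z * \<bar>\<sigma> (h t) - t\<bar>"
      by simp
    moreover have "0 < m / Z * \<bar>\<sigma> (h t) - t\<bar>" if "\<sigma> (h t) \<noteq> t"
      using that m Z0 by (intro mult_pos_pos) auto
    ultimately show ?thesis
      by blast
  qed
  have \<sigma>_cont: "continuous_on {0..1} \<sigma>"
    using lip m Z by (intro lipschitz_on_continuous_on[of "M / m"] lipschitz_onI) (auto simp: dist_real_def)
  have subst: "integral {0..1} (\<lambda>u. F (\<sigma> u)) = integral {0..1} (\<lambda>t. g t * F t) / Z"
    if F: "continuous_on {0..1} F" for F :: "real \<Rightarrow> real"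
  proof -
    have F\<sigma>: "continuous_on {0..1} (\<lambda>u. F (\<sigma> u))"
      using \<sigma>(1) by (intro continuous_on_compose2[OF F \<sigma>_cont]) auto
    \<comment> \<open>The substitution u = h t is performed in the integral of
      \<open>F (\<sigma> u)\<close>, so it is h that gets differentiated, while continuity is enough
      for \<open>\<sigma>\<close>.\<close>
    have "((\<lambda>t. (g t / Z) *\<^sub>R F (\<sigma> (h t))) has_integral integral {h 0..h 1} (\<lambda>u. F (\<sigma> u))) {0..1}"
      by (rule has_integral_substitution[OF _ _ _ F\<sigma> deriv]) (use h01 h_range in auto)
    then have "integral {0..1} (\<lambda>u. F (\<sigma> u)) = integral {0..1} (\<lambda>t. (g t / Z) *\<^sub>R F (\<sigma> (h t)))"
      unfolding h01 by (rule integral_unique[symmetric])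
    also have "\<dots> = integral {0..1} (\<lambda>t. g t * F t / Z)"
      by (rule Henstock_Kurzweil_Integration.integral_cong) (simp add: \<sigma>h)
    finally show ?thesis by simp
  qed
  show thesis
    using that[of \<sigma>] \<sigma> \<sigma>h[of 0] \<sigma>h[of 1] lip subst unfolding Z_def[symmetric] by (simp add: h01)
qed

lemma torus_lip_curve_mono:
  assumes "torus_lip_curve L \<gamma>" "L \<le> L'"
  shows "torus_lip_curve L' \<gamma>"
  unfolding torus_lip_curve_def
proof (intro conjI ballI)
  show "torus_proj (\<gamma> 0) = torus_proj (\<gamma> 1)"
    using assms(1) by (simp add: torus_lip_curve_def)
  fix s t :: real assume st: "s \<in> {0..1}" "t \<in> {0..1}"
  have "torus_dist (\<gamma> s) (\<gamma> t) \<le> L * \<bar>s - t\<bar>"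
    using assms(1) st by (simp add: torus_lip_curve_def)
  also have "\<dots> \<le> L' * \<bar>s - t\<bar>"
    using assms(2) by (intro mult_right_mono) auto
  finally show "torus_dist (\<gamma> s) (\<gamma> t) \<le> L' * \<bar>s - t\<bar>" .
qed

lemma norm_geodesic_diff_le:
  assumes "1 \<le> N"
  shows "norm (geodesic N a - geodesic N b :: real^'d)
    \<le> real CARD('d) * real_of_int N ^ (CARD('d) - 1) * \<bar>a - b\<bar>"
proof -
  have "norm (geodesic N a - geodesic N b :: real^'d) \<le> (\<Sum>i\<in>UNIV. \<bar>(geodesic N a - geodesic N b :: real^'d) $ i\<bar>)"
    by (rule norm_le_l1_cart)
  also have "\<dots> \<le> (\<Sum>i\<in>(UNIV :: 'd set). real_of_int N ^ (CARD('d) - 1) * \<bar>a - b\<bar>)"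
  proof (rule sum_mono)
    fix i :: 'd
    have "coord_index i < CARD('d)"
      using bij_betwE[OF bij_betw_coord_index] by auto
    then have "real_of_int N ^ coord_index i \<le> real_of_int N ^ (CARD('d) - 1)"
      using assms by (intro power_increasing) auto
    then have "real_of_int N ^ coord_index i * \<bar>a - b\<bar> \<le> real_of_int N ^ (CARD('d) - 1) * \<bar>a - b\<bar>"
      by (intro mult_right_mono) auto
    moreover have "\<bar>(geodesic N a - geodesic N b :: real^'d) $ i\<bar> = real_of_int N ^ coord_index i * \<bar>a - b\<bar>"
      using assms by (simp add: geodesic_def power_vec_def abs_mult flip: left_diff_distrib)
    ultimately show "\<bar>(geodesic N a - geodesic N b :: real^'d) $ i\<bar> \<le> real_of_int N ^ (CARD('d) - 1) * \<bar>a - b\<bar>"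
      by simp
  qed
  also have "\<dots> = real CARD('d) * real_of_int N ^ (CARD('d) - 1) * \<bar>a - b\<bar>"
    by simp
  finally show ?thesis .
qed

text \<open>The curve dwells at each point of the geodesic in proportion to the density, whose range
  costs the factor M/m in speed; the coordinates contribute d N^(d-1). The denominator is the total
  weight met along the geodesic.\<close>

lemma geodesic_reparametrized_curve:
  fixes \<rho> :: "real^'d \<Rightarrow> real"
  assumes \<rho>: "continuous_on UNIV \<rho>" and m: "0 < m" and bounds: "\<And>x. m \<le> \<rho> x \<and> \<rho> x \<le> M" and N: "1 \<le> N"
  obtains \<gamma> :: "real \<Rightarrow> real^'d"
  where "torus_lip_curve (real CARD('d) * (M / m) * real_of_int N ^ (CARD('d) - 1)) \<gamma>"
    "\<And>f. torus_periodic f \<Longrightarrow> continuous_on UNIV f \<Longrightarrow>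
      integral\<^sup>L (curve_measure \<gamma> (\<lambda>_. 1)) f
      = (\<integral>t. f (geodesic N t) * \<rho> (geodesic N t) \<partial>lebesgue_on {0..1})
        / (\<integral>t. \<rho> (geodesic N t) \<partial>lebesgue_on {0..1})"
proof -
  have cont: "continuous_on S (\<lambda>t. f (geodesic N t :: real^'d))" if "continuous_on UNIV f" for f :: "real^'d \<Rightarrow> real" and S
    by (rule continuous_on_compose2[OF that continuous_on_geodesic]) simp
  have to_HK: "integral\<^sup>L (lebesgue_on {0..1}) F = integral {0..1} F" if "continuous_on {0..1} F" for F :: "real \<Rightarrow> real"
    by (intro lebesgue_integral_eq_integral integrable_continuous_unit_interval that) simp
  obtain \<sigma> where \<sigma>: "\<sigma> 0 = 0" "\<sigma> 1 = 1" "\<And>u. u \<in> {0..1} \<Longrightarrow> \<sigma> u \<in> {0..1}"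
    and lip: "\<And>u v. u \<in> {0..1} \<Longrightarrow> v \<in> {0..1} \<Longrightarrow> \<bar>\<sigma> u - \<sigma> v\<bar> \<le> M / m * \<bar>u - v\<bar>"
    and subst: "\<And>F :: real \<Rightarrow> real. continuous_on {0..1} F \<Longrightarrow> integral {0..1} (\<lambda>u. F (\<sigma> u))
      = integral {0..1} (\<lambda>t. \<rho> (geodesic N t) * F t) / integral {0..1} (\<lambda>t. \<rho> (geodesic N t))"
    by (rule weight_reparametrization[OF cont[OF \<rho>] m bounds]) (rule that, assumption+)
  define \<gamma> :: "real \<Rightarrow> real^'d" where "\<gamma> = (\<lambda>u. geodesic N (\<sigma> u))"
  let ?L = "real CARD('d) * (M / m) * real_of_int N ^ (CARD('d) - 1)"
  have Mm: "0 < M / m"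
    using m bounds[of undefined] by simp
  have curve: "torus_lip_curve ?L \<gamma>"
    unfolding torus_lip_curve_def
  proof (intro conjI ballI)
    \<comment> \<open>The curve closes because the geodesic starts at 0 and ends at an integer
      vector.\<close>
    show "torus_proj (\<gamma> 0) = torus_proj (\<gamma> 1)"
      by (simp add: \<gamma>_def \<sigma> torus_proj_def geodesic_def vec_eq_iff)
  next
    fix u v :: real assume uv: "u \<in> {0..1}" "v \<in> {0..1}"
    have "torus_dist (\<gamma> u) (\<gamma> v) \<le> norm (\<gamma> u - \<gamma> v)"
      by (rule torus_dist_le_norm)
    also have "\<dots> \<le> real CARD('d) * real_of_int N ^ (CARD('d) - 1) * \<bar>\<sigma> u - \<sigma> v\<bar>"
      unfolding \<gamma>_def by (rule norm_geodesic_diff_le[OF N])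
    also have "\<dots> \<le> real CARD('d) * real_of_int N ^ (CARD('d) - 1) * (M / m * \<bar>u - v\<bar>)"
      using N by (intro mult_left_mono lip uv) auto
    finally show "torus_dist (\<gamma> u) (\<gamma> v) \<le> ?L * \<bar>u - v\<bar>"
      by (simp only: mult_ac)
  qed
  have L0: "0 \<le> ?L"
    using Mm N by (intro mult_nonneg_nonneg) auto
  have "integral\<^sup>L (curve_measure \<gamma> (\<lambda>_. 1)) f
      = (\<integral>t. f (geodesic N t) * \<rho> (geodesic N t) \<partial>lebesgue_on {0..1})
        / (\<integral>t. \<rho> (geodesic N t) \<partial>lebesgue_on {0..1})"
    if f: "torus_periodic f" "continuous_on UNIV f" for f
  proof -
    have "integral\<^sup>L (curve_measure \<gamma> (\<lambda>_. 1)) f = (\<integral>u. f (\<gamma> u) \<partial>lebesgue_on {0..1})"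
      using integral_curve_measure[OF curve curve_weight_one[OF L0] f] by simp
    also have "\<dots> = integral {0..1} (\<lambda>u. f (\<gamma> u))"
      by (rule to_HK[OF torus_lip_curve_compose_continuous[OF curve f]])
    also have "\<dots> = integral {0..1} (\<lambda>t. \<rho> (geodesic N t) * f (geodesic N t)) / integral {0..1} (\<lambda>t. \<rho> (geodesic N t))"
      unfolding \<gamma>_def by (rule subst[OF cont[OF f(2)]])
    also have "\<dots> = (\<integral>t. f (geodesic N t) * \<rho> (geodesic N t) \<partial>lebesgue_on {0..1})
        / (\<integral>t. \<rho> (geodesic N t) \<partial>lebesgue_on {0..1})"
      by (simp add: to_HK continuous_on_mult cont \<rho> f(2) mult.commute)
    finally show ?thesis .
  qed
  then show thesis
    using that curve by blast
qed

section \<open>Discrepancy between the density and the reparametrised geodesic\<close>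

lemma emeasure_density_torus:
  fixes \<rho> :: "real^'d \<Rightarrow> real"
  assumes "continuous_on UNIV \<rho>" "\<And>x. 0 \<le> \<rho> x" "integral\<^sup>L torus_lebesgue \<rho> = 1"
  defines "\<mu> \<equiv> density torus_lebesgue (\<lambda>x. ennreal (\<rho> x))"
  shows "emeasure \<mu> (space \<mu>) = 1"
proof -
  have int: "integrable torus_lebesgue \<rho>"
    by (intro integrable_torus_lebesgue continuous_on_subset[OF assms(1)]) simp
  then have [measurable]: "\<rho> \<in> borel_measurable torus_lebesgue"
    by (rule borel_measurable_integrable)
  have "emeasure \<mu> (space \<mu>) = (\<integral>\<^sup>+x. ennreal (\<rho> x) * indicator (space torus_lebesgue) x \<partial>torus_lebesgue)"
    unfolding \<mu>_def by (subst emeasure_density) auto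
  also have "\<dots> = (\<integral>\<^sup>+x. ennreal (\<rho> x) \<partial>torus_lebesgue)"
    by (intro nn_integral_cong) auto
  also have "\<dots> = ennreal (integral\<^sup>L torus_lebesgue \<rho>)"
    using assms(2) by (intro nn_integral_eq_integral int) auto
  finally show ?thesis
    by (simp add: assms(3))
qed

lemma integral_density_torus:
  fixes \<rho> f :: "real^'d \<Rightarrow> real"
  assumes "continuous_on UNIV \<rho>" "\<And>x. 0 \<le> \<rho> x" "continuous_on UNIV f"
  shows "integral\<^sup>L (density torus_lebesgue (\<lambda>x. ennreal (\<rho> x))) f = (\<integral>x. f x * \<rho> x \<partial>torus_lebesgue)"
proof -
  have "integrable torus_lebesgue \<rho>" "integrable torus_lebesgue f"
    by (auto intro!: integrable_torus_lebesgue intro: continuous_on_subset[OF assms(1)] continuous_on_subset[OF assms(3)])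
  then show ?thesis
    using assms(2) by (subst integral_density) (auto simp: mult.commute)
qed

text \<open>By P - Q/Z = (P - Q) + (Q/Z)(Z - 1), the error of a normalised average is the error of
  its numerator plus the error of its denominator, weighted by the average itself, which B
  bounds.\<close>

lemma weighted_average_error:
  fixes P Q Z B :: real
  assumes "0 < Z" "\<bar>Q\<bar> \<le> B * Z" "\<bar>Q - P\<bar> \<le> E1" "\<bar>Z - 1\<bar> \<le> E2" "0 \<le> B"
  shows "\<bar>P - Q / Z\<bar> \<le> E1 + B * E2"
proof -
  have "P - Q / Z = (P - Q) + Q / Z * (Z - 1)"
    using assms(1) by (simp add: field_simps)
  then have "\<bar>P - Q / Z\<bar> \<le> \<bar>P - Q\<bar> + \<bar>Q / Z\<bar> * \<bar>Z - 1\<bar>"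
    by (simp only: abs_mult[symmetric] abs_triangle_ineq)
  also have "\<bar>Q / Z\<bar> * \<bar>Z - 1\<bar> \<le> B * E2"
    using assms by (intro mult_mono) (auto simp: divide_le_eq)
  finally show ?thesis
    using assms(3) by linarith
qed

lemma geodesic_curve_discrepancy:
  fixes K :: "real^'d \<Rightarrow> real^'d \<Rightarrow> real" and \<rho> :: "real^'d \<Rightarrow> real"
  assumes s: "real CARD('d) < 2 * s" and K: "torus_kernel K"
    and c1: "0 < c1"
    and K_Hs: "\<And>f. continuous_on UNIV f \<Longrightarrow> torus_periodic f \<Longrightarrow> in_rkhs K f \<Longrightarrow>
      in_Hs s f \<and> c1 * Hs_norm s f \<le> rkhs_norm K f"
    and \<rho>: "continuous_on UNIV \<rho>" "torus_periodic \<rho>" "in_Hs s \<rho>" "integral\<^sup>L torus_lebesgue \<rho> = 1"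
    and m: "0 < m" and bounds: "\<And>x. m \<le> \<rho> x \<and> \<rho> x \<le> M"
  shows "\<exists>C\<ge>0. \<forall>N\<ge>1.
    \<exists>\<gamma>. torus_lip_curve (real CARD('d) * (M / m) * real_of_int N ^ (CARD('d) - 1)) \<gamma>
      \<and> discrepancy K (density torus_lebesgue (\<lambda>x. ennreal (\<rho> x))) (curve_measure \<gamma> (\<lambda>_. 1)) \<le> C * (6 / N) powr s"
proof -
  obtain B where B: "0 \<le> B" "\<And>f x. in_rkhs K f \<Longrightarrow> rkhs_norm K f \<le> 1 \<Longrightarrow> \<bar>f x\<bar> \<le> B"
    by (rule rkhs_ball_uniform_bound[OF K]) (rule that, assumption+)
  let ?\<mu> = "density torus_lebesgue (\<lambda>x. ennreal (\<rho> x))"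
  let ?z = "lattice_zeta TYPE('d) s"
  let ?R = "Hs_norm s \<rho>"
  let ?W = "sqrt (sobolev_weight s (0 :: int^'d))"
  \<comment> \<open>The first summand is the error for the product of a test function, of Sobolev
    norm at most 1/c1, with the density. The second is the sup bound B times the error for 1 and the
    density, \<open>?W\<close> being the bound in the expansion of 1.\<close>
  define C where "C = 2 * (1 / c1) * ?R * ?z + B * (2 * ?W * ?R * ?z)"
  have R: "0 \<le> ?R"
    using in_Hs_bounded[OF \<rho>(3)] by (simp add: Hs_bounded_def)
  have exp\<rho>: "Hs_expansion s ?R (fourier_coeff \<rho>) \<rho>"
    by (rule in_Hs_expansion[OF s \<rho>(2,1,3)])
  have \<rho>0: "0 \<le> \<rho> x" for x
    using bounds[of x] m by simp
  show ?thesis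
  proof (intro exI[of _ C] conjI allI impI)
    have W: "0 \<le> ?W"
      using less_imp_le[OF sobolev_weight_pos[of s "0 :: int^'d"]] by simp
    show "0 \<le> C"
      unfolding C_def using c1 R B(1) W lattice_zeta_nonneg[of s, where 'd='d]
      by (intro add_nonneg_nonneg mult_nonneg_nonneg) auto
    fix N :: int assume N: "1 \<le> N"
    let ?J = "\<lambda>F :: real^'d \<Rightarrow> real. \<integral>t. F (geodesic N t) \<partial>lebesgue_on {0..1}"
    obtain \<gamma> :: "real \<Rightarrow> real^'d" where \<gamma>: "torus_lip_curve (real CARD('d) * (M / m) * real_of_int N ^ (CARD('d) - 1)) \<gamma>"
      and int\<gamma>: "\<And>f. torus_periodic f \<Longrightarrow> continuous_on UNIV f \<Longrightarrow>
        integral\<^sup>L (curve_measure \<gamma> (\<lambda>_. 1)) f = ?J (\<lambda>x. f x * \<rho> x) / ?J \<rho>"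
      by (rule geodesic_reparametrized_curve[OF \<rho>(1) m bounds N]) (rule that, assumption+)
    have int_geo: "integrable (lebesgue_on {0..1}) (\<lambda>t. f (geodesic N t))" if "continuous_on UNIV f" for f :: "real^'d \<Rightarrow> real"
      by (rule integrable_continuous_unit_interval, rule continuous_on_compose2[OF that continuous_on_geodesic]) simp
    have "m = (\<integral>t. m \<partial>lebesgue_on {0..1::real})"
      using lebesgue_on_unit_interval by (simp add: measure_def)
    also have "\<dots> \<le> ?J \<rho>"
      using bounds by (intro integral_mono int_geo \<rho>(1) integrable_continuous_unit_interval continuous_on_const) auto
    finally have Z: "0 < ?J \<rho>"
      using m by simp
    have errZ: "\<bar>?J \<rho> - 1\<bar> \<le> 2 * ?W * ?R * ?z * (6 / N) powr s"
      using geodesic_quadrature_error[OF s N Hs_expansion_one exp\<rho> continuous_on_const \<rho>(1)]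
      by (simp add: \<rho>(4))
    have "discrepancy K ?\<mu> (curve_measure \<gamma> (\<lambda>_. 1)) \<le> C * (6 / N) powr s"
    proof (rule discrepancy_leI)
      fix \<phi> assume \<phi>: "in_rkhs K \<phi>" "rkhs_norm K \<phi> \<le> 1"
      have cont: "continuous_on UNIV \<phi>" and per: "torus_periodic \<phi>"
        by (rule rkhs_ball_continuous[OF K \<phi>] rkhs_ball_periodic[OF K \<phi>])+
      have Hs: "in_Hs s \<phi>" and "c1 * Hs_norm s \<phi> \<le> 1"
        using K_Hs[OF cont per \<phi>(1)] \<phi>(2) by auto
      then have norm: "Hs_norm s \<phi> \<le> 1 / c1"
        using c1 by (simp add: pos_le_divide_eq mult.commute)
      have err: "\<bar>?J (\<lambda>x. \<phi> x * \<rho> x) - (\<integral>x. \<phi> x * \<rho> x \<partial>torus_lebesgue)\<bar>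
          \<le> 2 * (1 / c1) * ?R * ?z * (6 / N) powr s"
      proof -
        have "\<bar>?J (\<lambda>x. \<phi> x * \<rho> x) - (\<integral>x. \<phi> x * \<rho> x \<partial>torus_lebesgue)\<bar>
            \<le> 2 * Hs_norm s \<phi> * ?R * ?z * (6 / N) powr s"
          by (rule geodesic_quadrature_error[OF s N in_Hs_expansion[OF s per cont Hs] exp\<rho> cont \<rho>(1)])
        also have "\<dots> \<le> 2 * (1 / c1) * ?R * ?z * (6 / N) powr s"
          using norm R lattice_zeta_nonneg[of s, where 'd='d] by (intro mult_right_mono mult_left_mono) auto
        finally show ?thesis .
      qed
      have "\<bar>?J (\<lambda>x. \<phi> x * \<rho> x)\<bar> \<le> (\<integral>t. \<bar>\<phi> (geodesic N t) * \<rho> (geodesic N t)\<bar> \<partial>lebesgue_on {0..1})"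
        by (rule integral_abs_bound)
      also have "\<dots> \<le> (\<integral>t. B * \<rho> (geodesic N t) \<partial>lebesgue_on {0..1})"
      proof (rule integral_mono)
        show "integrable (lebesgue_on {0..1}) (\<lambda>t. \<bar>\<phi> (geodesic N t) * \<rho> (geodesic N t)\<bar>)"
          by (intro integrable_abs int_geo[of "\<lambda>x. \<phi> x * \<rho> x"] continuous_on_mult cont \<rho>(1))
        show "integrable (lebesgue_on {0..1}) (\<lambda>t. B * \<rho> (geodesic N t))"
          by (intro integrable_mult_right int_geo \<rho>(1))
        show "\<bar>\<phi> (geodesic N t) * \<rho> (geodesic N t)\<bar> \<le> B * \<rho> (geodesic N t)" for t
          using B(2)[OF \<phi>, of "geodesic N t"] \<rho>0[of "geodesic N t"] by (simp add: abs_mult mult_right_mono)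
      qed
      finally have Q: "\<bar>?J (\<lambda>x. \<phi> x * \<rho> x)\<bar> \<le> B * ?J \<rho>"
        by simp
      show "\<bar>integral\<^sup>L ?\<mu> \<phi> - integral\<^sup>L (curve_measure \<gamma> (\<lambda>_. 1)) \<phi>\<bar> \<le> C * (6 / N) powr s"
        using weighted_average_error[OF Z Q err errZ B(1)]
        unfolding integral_density_torus[OF \<rho>(1) \<rho>0 cont] int\<gamma>[OF per cont] C_def
        by (simp only: distrib_right mult.assoc)
    qed
    with \<gamma> show "\<exists>\<gamma>. torus_lip_curve (real CARD('d) * (M / m) * real_of_int N ^ (CARD('d) - 1)) \<gamma>
      \<and> discrepancy K ?\<mu> (curve_measure \<gamma> (\<lambda>_. 1)) \<le> C * (6 / N) powr s"
      by blast
  qed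
qed

text \<open>N is the largest integer with C0 N^d \<le> L. The floor of a real x \<ge> 1 is at least
  x/2, and this loss turns 6 into 12.\<close>

lemma floor_power_scale:
  fixes L C0 s :: real and d :: nat
  assumes d: "1 \<le> d" and C0: "0 < C0" and L: "C0 \<le> L" and s: "0 < s"
  obtains N :: int where "1 \<le> N" "C0 * real_of_int N ^ d \<le> L"
    "(6 / N) powr s \<le> 12 powr s * C0 powr (s / d) * L powr - (s / d)"
proof -
  define x where "x = (L / C0) powr (1 / d)"
  have x1: "1 \<le> x"
    unfolding x_def using C0 L by (intro ge_one_powr_ge_zero) auto
  define N where "N = \<lfloor>x\<rfloor>"
  have N1: "1 \<le> N"
    using x1 by (simp add: N_def)
  have Nx: "real_of_int N \<le> x" "x / 2 \<le> real_of_int N"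
    using x1 floor_correct[of x] N1 unfolding N_def by linarith+
  have LC: "0 < L / C0"
    using C0 L by simp
  show thesis
  proof (rule that[OF N1])
    have "real_of_int N ^ d \<le> x ^ d"
      using N1 Nx by (intro power_mono) auto
    also have "x ^ d = x powr real d"
      using x1 by (simp add: powr_realpow)
    also have "\<dots> = L / C0"
      using d C0 L by (simp add: x_def powr_powr)
    finally show "C0 * real_of_int N ^ d \<le> L"
      using C0 by (simp add: field_simps)
    have "(6 / N) powr s \<le> (12 / x) powr s"
      using N1 Nx x1 s by (intro powr_mono2) (auto simp: field_simps)
    also have "\<dots> = 12 powr s * x powr - s"
      using x1 by (simp add: powr_divide powr_minus_divide)
    also have "x powr - s = (L / C0) powr - (s / d)"
      by (simp add: x_def powr_powr)
    also have "\<dots> = C0 powr (s / d) * L powr - (s / d)"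
      using C0 L by (simp add: powr_divide powr_minus_divide)
    finally show "(6 / N) powr s \<le> 12 powr s * C0 powr (s / d) * L powr - (s / d)"
      by (simp add: mult.assoc)
  qed
qed

theorem theorem8:
  fixes K :: "real^'d \<Rightarrow> real^'d \<Rightarrow> real" and s :: real and \<rho> :: "real^'d \<Rightarrow> real"
  assumes "CARD('d) \<ge> 2"
    and "s > real CARD('d) / 2"
    and "torus_kernel K"
    and "\<exists>c1 c2. 0 < c1 \<and> 0 < c2 \<and>
           (\<forall>f. continuous_on UNIV f \<and> torus_periodic f \<longrightarrow>
              (in_rkhs K f \<longleftrightarrow> in_Hs s f) \<and>
              (in_Hs s f \<longrightarrow> c1 * Hs_norm s f \<le> rkhs_norm K f \<and> rkhs_norm K f \<le> c2 * Hs_norm s f))"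
    and "continuous_on UNIV \<rho>" and "torus_periodic \<rho>" and "\<forall>x. 0 < \<rho> x"
    and "in_Hs s \<rho>"
    and "integral\<^sup>L torus_lebesgue \<rho> = 1"
  shows "\<exists>c>0. \<forall>L\<ge>1.
    (let \<mu> = density torus_lebesgue (\<lambda>x. ennreal (\<rho> x)) in
      (\<exists>\<nu>\<in>Acurve_measures L. discrepancy K \<mu> \<nu> = (INF \<nu>'\<in>Acurve_measures L. discrepancy K \<mu> \<nu>'))
    \<and> (\<exists>\<nu>\<in>Lcurve_measures L. discrepancy K \<mu> \<nu> = (INF \<nu>'\<in>Lcurve_measures L. discrepancy K \<mu> \<nu>'))
    \<and> (INF \<nu>\<in>Acurve_measures L. discrepancy K \<mu> \<nu>) \<le> (INF \<nu>\<in>Lcurve_measures L. discrepancy K \<mu> \<nu>)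
    \<and> (INF \<nu>\<in>Lcurve_measures L. discrepancy K \<mu> \<nu>) \<le> c * L powr (- (s / (real CARD('d) - 1))))"
proof -
  note K = \<open>torus_kernel K\<close> and \<rho>_cont = \<open>continuous_on UNIV \<rho>\<close> and \<rho>_per = \<open>torus_periodic \<rho>\<close>
  define \<mu> where "\<mu> = density torus_lebesgue (\<lambda>x. ennreal (\<rho> x))"
  have s: "real CARD('d) < 2 * s" and s0: "0 < s"
    using assms(1,2) by auto
  obtain c1 where c1: "0 < c1" "\<And>f. continuous_on UNIV f \<Longrightarrow> torus_periodic f \<Longrightarrow> in_rkhs K f \<Longrightarrow>
      in_Hs s f \<and> c1 * Hs_norm s f \<le> rkhs_norm K f"
    using assms(4) by blast
  have \<rho>0: "0 \<le> \<rho> x" for x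
    using assms(7) by (simp add: less_imp_le)
  have \<mu>_mass: "emeasure \<mu> (space \<mu>) = 1"
    unfolding \<mu>_def by (rule emeasure_density_torus[OF \<rho>_cont \<rho>0 assms(9)])
  obtain m M where m: "0 < m" and bounds: "\<And>x. m \<le> \<rho> x \<and> \<rho> x \<le> M"
  proof -
    have cube: "continuous_on unit_cube \<rho>" "unit_cube \<noteq> ({} :: (real^'d) set)"
      using \<rho>_cont continuous_on_subset torus_proj_in_cube by blast+
    obtain x0 where x0: "\<And>y. y \<in> unit_cube \<Longrightarrow> \<rho> x0 \<le> \<rho> y"
      using continuous_attains_inf[OF compact_unit_cube cube(2,1)] by blast
    obtain x1 where x1: "\<And>y. y \<in> unit_cube \<Longrightarrow> \<rho> y \<le> \<rho> x1"
      using continuous_attains_sup[OF compact_unit_cube cube(2,1)] by blast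
    show thesis
    proof (rule that[of "\<rho> x0" "\<rho> x1"])
      show "\<rho> x0 \<le> \<rho> x \<and> \<rho> x \<le> \<rho> x1" for x
        using x0[OF torus_proj_in_cube[of x]] x1[OF torus_proj_in_cube[of x]]
        by (simp add: torus_periodic_proj[OF \<rho>_per])
    qed (use assms(7) in auto)
  qed
  have "\<exists>C\<ge>0. \<forall>N\<ge>1.
    \<exists>\<gamma>. torus_lip_curve (real CARD('d) * (M / m) * real_of_int N ^ (CARD('d) - 1)) \<gamma>
      \<and> discrepancy K \<mu> (curve_measure \<gamma> (\<lambda>_. 1)) \<le> C * (6 / N) powr s"
    unfolding \<mu>_def by (rule geodesic_curve_discrepancy[OF s K c1 \<rho>_cont \<rho>_per assms(8,9) m bounds])
  then obtain C where C: "0 \<le> C" and curves: "\<And>N. 1 \<le> N \<Longrightarrow>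
    \<exists>\<gamma>. torus_lip_curve (real CARD('d) * (M / m) * real_of_int N ^ (CARD('d) - 1)) \<gamma>
      \<and> discrepancy K \<mu> (curve_measure \<gamma> (\<lambda>_. 1)) \<le> C * (6 / N) powr s"
    by blast
  obtain B where B: "0 \<le> B" "\<And>f x. in_rkhs K f \<Longrightarrow> rkhs_norm K f \<le> 1 \<Longrightarrow> \<bar>f x\<bar> \<le> B"
    by (rule rkhs_ball_uniform_bound[OF K]) (rule that, assumption+)
  define C0 where "C0 = real CARD('d) * (M / m)"
  have C0: "0 < C0"
    using m bounds[of undefined] by (simp add: C0_def)
  \<comment> \<open>At least 1 because d \<ge> 2, so that a d1-th root of L is available.\<close>
  define d1 where "d1 = CARD('d) - 1"
  have d1: "1 \<le> d1" "real d1 = real CARD('d) - 1"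
    using assms(1) by (simp_all add: d1_def of_nat_diff)
  \<comment> \<open>\<open>C * 12 powr s\<close> serves L \<ge> C0 and \<open>2 * B\<close> serves L
    < C0; the 1 makes c positive.\<close>
  define c where "c = (C * 12 powr s + 2 * B + 1) * C0 powr (s / d1)"
  have c: "0 < c"
    unfolding c_def using C B(1) C0 by (intro mult_pos_pos add_nonneg_pos) auto
  have main: "(\<exists>\<nu>\<in>Acurve_measures L. discrepancy K \<mu> \<nu> = (INF \<nu>'\<in>Acurve_measures L. discrepancy K \<mu> \<nu>'))
    \<and> (\<exists>\<nu>\<in>Lcurve_measures L. discrepancy K \<mu> \<nu> = (INF \<nu>'\<in>Lcurve_measures L. discrepancy K \<mu> \<nu>'))
    \<and> (INF \<nu>\<in>Acurve_measures L. discrepancy K \<mu> \<nu>) \<le> (INF \<nu>\<in>Lcurve_measures L. discrepancy K \<mu> \<nu>)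
    \<and> (INF \<nu>\<in>Lcurve_measures L. discrepancy K \<mu> \<nu>) \<le> c * L powr (- (s / d1))"
    if L: "1 \<le> L" for L
  proof (intro conjI)
    have L0: "0 \<le> L"
      using L by simp
    have one: "curve_weight L (\<lambda>_. 1)"
      by (rule curve_weight_one[OF L0])
    have mass: "emeasure \<nu> (space \<nu>) = 1" if "\<nu> \<in> Acurve_measures L" for \<nu>
      using that emeasure_curve_measure by (auto simp: Acurve_measures_eq)
    have sub: "Lcurve_measures L \<subseteq> Acurve_measures L"
      using one by (auto simp: Lcurve_measures_eq Acurve_measures_eq)
    have bdd: "bdd_below (discrepancy K \<mu> ` Acurve_measures L)"
      by (rule bdd_belowI2[of _ 0]) (rule discrepancy_nonneg[OF K \<mu>_mass mass])
    have L_mem: "curve_measure \<gamma> (\<lambda>_. 1) \<in> Lcurve_measures L" if "torus_lip_curve L \<gamma>" for \<gamma>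
      using that by (auto simp: Lcurve_measures_eq)
    \<comment> \<open>Closedness is immediate here, since the limit weight is itself
      admissible.\<close>
    show "\<exists>\<nu>\<in>Acurve_measures L. discrepancy K \<mu> \<nu> = (INF \<nu>'\<in>Acurve_measures L. discrepancy K \<mu> \<nu>')"
      using discrepancy_minimizer_exists[OF K \<mu>_mass L0, of "Collect (curve_weight L)"] one
      by (auto simp: Acurve_measures_eq)
    \<comment> \<open>A pointwise limit of the constant 1 is again 1 on [0,1], so a singleton is
      closed in the required sense.\<close>
    have "\<exists>\<nu>\<in>{curve_measure \<gamma> w |\<gamma> w. torus_lip_curve L \<gamma> \<and> w \<in> {\<lambda>_. 1}}. discrepancy K \<mu> \<nu>
        = (INF \<nu>'\<in>{curve_measure \<gamma> w |\<gamma> w. torus_lip_curve L \<gamma> \<and> w \<in> {\<lambda>_. 1}}. discrepancy K \<mu> \<nu>')"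
      by (rule discrepancy_minimizer_exists[OF K \<mu>_mass L0])
        (use one in \<open>auto simp: LIMSEQ_const_iff\<close>)
    then show "\<exists>\<nu>\<in>Lcurve_measures L. discrepancy K \<mu> \<nu> = (INF \<nu>'\<in>Lcurve_measures L. discrepancy K \<mu> \<nu>')"
      by (simp add: Lcurve_measures_eq)
    show "(INF \<nu>\<in>Acurve_measures L. discrepancy K \<mu> \<nu>) \<le> (INF \<nu>\<in>Lcurve_measures L. discrepancy K \<mu> \<nu>)"
      using L_mem[OF torus_lip_curve_const[OF L0]] by (intro cINF_superset_mono[OF _ bdd sub]) auto
    have INF_le: "(INF \<nu>\<in>Lcurve_measures L. discrepancy K \<mu> \<nu>) \<le> b"
      if "torus_lip_curve L \<gamma>" "discrepancy K \<mu> (curve_measure \<gamma> (\<lambda>_. 1)) \<le> b" for \<gamma> b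
      using bdd_below_mono[OF bdd image_mono[OF sub]] L_mem[OF that(1)] that(2) by (rule cINF_lower2)
    show "(INF \<nu>\<in>Lcurve_measures L. discrepancy K \<mu> \<nu>) \<le> c * L powr (- (s / d1))"
    proof (cases "C0 \<le> L")
      case True
      obtain N :: int where N: "1 \<le> N" "C0 * real_of_int N ^ d1 \<le> L"
        and rate: "(6 / N) powr s \<le> 12 powr s * C0 powr (s / d1) * L powr - (s / d1)"
        by (rule floor_power_scale[OF d1(1) C0 True s0]) (rule that, assumption+)
      obtain \<gamma> where \<gamma>: "torus_lip_curve (C0 * real_of_int N ^ d1) \<gamma>"
        "discrepancy K \<mu> (curve_measure \<gamma> (\<lambda>_. 1)) \<le> C * (6 / N) powr s"
        using curves[OF N(1)] unfolding C0_def d1_def by blast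
      have "C * (6 / N) powr s \<le> C * (12 powr s * C0 powr (s / d1) * L powr - (s / d1))"
        by (rule mult_left_mono[OF rate C])
      also have "\<dots> = C * 12 powr s * C0 powr (s / d1) * L powr - (s / d1)"
        by (simp only: mult.assoc)
      also have "\<dots> \<le> c * L powr - (s / d1)"
        unfolding c_def using B(1) by (intro mult_right_mono) auto
      finally have "C * (6 / N) powr s \<le> c * L powr - (s / d1)" .
      then show ?thesis
        using INF_le[OF torus_lip_curve_mono[OF \<gamma>(1) N(2)]] \<gamma>(2) by (meson order_trans)
    next
      case False
      \<comment> \<open>Below C0 the available Lipschitz bound exceeds L for every N \<ge> 1. A
        constant curve has discrepancy at most 2B, and (C0/L)^(s/d1) \<ge> 1 brings this into the
        form of the rate.\<close>
      have "discrepancy K \<mu> (curve_measure (\<lambda>_. 0) (\<lambda>_. 1)) \<le> 2 * B"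
      proof (rule discrepancy_leI)
        fix \<phi> assume \<phi>: "in_rkhs K \<phi>" "rkhs_norm K \<phi> \<le> 1"
        show "\<bar>integral\<^sup>L \<mu> \<phi> - integral\<^sup>L (curve_measure (\<lambda>_. 0) (\<lambda>_. 1)) \<phi>\<bar> \<le> 2 * B"
          using integral_bound_of_unit_mass[OF \<mu>_mass, of \<phi> B, OF B(2)[OF \<phi>]]
            integral_bound_of_unit_mass[OF emeasure_curve_measure[OF torus_lip_curve_const[OF L0, of 0] one], of \<phi> B, OF B(2)[OF \<phi>]]
          by (simp add: abs_le_iff)
      qed
      then have "(INF \<nu>\<in>Lcurve_measures L. discrepancy K \<mu> \<nu>) \<le> 2 * B * 1"
        using INF_le[OF torus_lip_curve_const[OF L0]] by simp
      also have "\<dots> \<le> 2 * B * (C0 powr (s / d1) * L powr - (s / d1))"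
      proof (rule mult_left_mono)
        have "1 \<le> (C0 / L) powr (s / d1)"
          using False L s0 by (intro ge_one_powr_ge_zero) auto
        then show "1 \<le> C0 powr (s / d1) * L powr - (s / d1)"
          using L C0 by (simp add: powr_divide powr_minus_divide)
      qed (use B(1) in simp)
      also have "\<dots> = 2 * B * C0 powr (s / d1) * L powr - (s / d1)"
        by (simp only: mult.assoc)
      also have "\<dots> \<le> c * L powr - (s / d1)"
        unfolding c_def using C by (intro mult_right_mono) auto
      finally show ?thesis .
    qed
  qed
  show ?thesis
    unfolding Let_def \<mu>_def[symmetric] d1(2)[symmetric] using c main by blast
qed

end
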